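(* Let $0<s<1$, $\lambda\in\mathbb{R}$, $l>0$, and let $\Omega$ be a region contained in the narrow slab $\{x\in\mathbb{R}^N \mid \lambda-l<x_1<\lambda\}\subset\Sigma_\lambda$. For some sufficiently large $\bar t$, assume that $w_\lambda(x,t)\in\big(C^{1,1}_{loc}(\Omega)\cap\mathcal{L}_{2s}\big)\times C^1([\bar t,\infty))$ is uniformly bounded and lower semi-continuous in $x$ on $\overline{\Omega}$, and satisfies $$\begin{cases}\dfrac{\partial w_\lambda}{\partial t}(x,t)+(-\Delta)^s w_\lambda(x,t)=c_\lambda(x,t)\,w_\lambda(x,t), & (x,t)\in\Omega\times[\bar t,\infty),\\ w_\lambda(x,t)\ge 0, & (x,t)\in(\Sigma_\lambda\setminus\Omega)\times[\bar t,\infty),\\ w_\lambda(x,t)=-w_\lambda(x^\lambda,t), & (x,t)\in\Sigma_\lambda\times[\bar t,\infty),\end{cases}$$ where $c_\lambda(x,t)$ is bounded from above. Then the following hold. (i) If $\Omega$ is bounded, then for $l$ sufficiently small (how small depending only on $N$, $s$ and an upper bound of $c_\lambda$), $$\varliminf_{t\to\infty}w_\lambda(x,t)\ge 0\qquad\text{for all }x\in\Omega.$$ (ii) If $\Omega$ is unbounded, then the same conclusion (for $l$ sufficiently small in the same sense) still holds under the condition $$\varliminf_{|x|\to\infty}w_\lambda(x,t)\ge 0\quad\text{uniformly for } t\ge\bar t.$$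
   Context: For $\lambda\in\mathbb{R}$: $T_\lambda=\{x\in\mathbb{R}^N\mid x_1=\lambda\}$, $\Sigma_\lambda=\{x\in\mathbb{R}^N\mid x_1<\lambda\}$, and $x^\lambda=(2\lambda-x_1,x_2,\dots,x_N)$ is the reflection of $x$ about $T_\lambda$. The notation $w\in X\times C^1(I)$ means that $w(\cdot,t)\in X$ for each $t\in I$ and $w(x,\cdot)\in C^1(I)$ for each $x$. The space $\mathcal{L}_{2s}$ consists of functions $w(\cdot,t)\in L^1_{loc}(\mathbb{R}^N)$ with $\int_{\mathbb{R}^N}\frac{|w(x,t)|}{1+|x|^{N+2s}}dx<+\infty$. For each fixed $t$, the fractional Laplacian is $$(-\Delta)^s w(x,t)=C_{N,s}\,\lim_{\varepsilon\to0}\int_{\mathbb{R}^N\setminus B_\varepsilon(x)}\frac{w(x,t)-w(y,t)}{|x-y|^{N+2s}}\,dy,$$ where $C_{N,s}>0$ is the usual normalization constant. *)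

theory Defs
  imports "HOL-Analysis.Analysis"
begin

text \<open>The coordinates of \<^typ>\<open>real ^ 'n\<close> are not ordered, so the index \<open>k\<close> of the
  distinguished coordinate (called $x_1$ in the literature) is a parameter below.\<close>

definition left_half_space :: "'n::finite \<Rightarrow> real \<Rightarrow> (real ^ 'n) set" where
  "left_half_space k lam = {x. x $ k < lam}"

definition plane_reflection :: "'n::finite \<Rightarrow> real \<Rightarrow> real ^ 'n \<Rightarrow> real ^ 'n" where
  "plane_reflection k lam x = (\<chi> i. if i = k then 2 * lam - x $ k else x $ i)"

definition slab :: "'n::finite \<Rightarrow> real \<Rightarrow> real \<Rightarrow> (real ^ 'n) set" where
  "slab k lam l = {x. lam - l < x $ k \<and> x $ k < lam}"

definition lsc_on :: "'a::topological_space set \<Rightarrow> ('a \<Rightarrow> real) \<Rightarrow> bool" where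
  "lsc_on S u \<longleftrightarrow> (\<forall>x\<in>S. \<forall>a. a < u x \<longrightarrow> (\<forall>\<^sub>F y in at x within S. a < u y))"

definition C11_loc :: "(real ^ 'n::finite) set \<Rightarrow> (real ^ 'n \<Rightarrow> real) set" where
  "C11_loc \<Omega> = {u. \<exists>g. (\<forall>x\<in>\<Omega>. GDERIV u x :> g x) \<and>
     (\<forall>K. compact K \<and> K \<subseteq> \<Omega> \<longrightarrow> (\<exists>L. L-lipschitz_on K g))}"

definition L2s_space :: "real \<Rightarrow> (real ^ 'n::finite \<Rightarrow> real) set" where
  "L2s_space s = {u. (\<forall>K. compact K \<longrightarrow> set_integrable lebesgue K u) \<and>
     integrable lebesgue (\<lambda>x. \<bar>u x\<bar> / (1 + norm x powr (real CARD('n) + 2 * s)))}"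

text \<open>The library's \<open>C1_differentiable_on\<close> uses two-sided derivatives and hence would constrain
  a function on $[a,\infty)$ also to the left of $a$; here derivatives are relative to \<open>I\<close>.\<close>

definition C1_on :: "real set \<Rightarrow> (real \<Rightarrow> real) \<Rightarrow> bool" where
  "C1_on I f \<longleftrightarrow> (\<exists>D. (\<forall>t\<in>I. (f has_vector_derivative D t) (at t within I)) \<and> continuous_on I D)"

definition times_C1 :: "(real ^ 'n::finite \<Rightarrow> real) set \<Rightarrow> real set \<Rightarrow> (real ^ 'n \<Rightarrow> real \<Rightarrow> real) set" where
  "times_C1 X I = {w. (\<forall>t\<in>I. (\<lambda>x. w x t) \<in> X) \<and> (\<forall>x. C1_on I (w x))}"

text \<open>Normalization making the Fourier symbol of $(-\Delta)^s$ equal to $|\xi|^{2s}$, i.e.\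
  $4^s\,\Gamma(N/2+s) / (\pi^{N/2}\,|\Gamma(-s)|)$, where $|\Gamma(-s)| = \Gamma(1-s)/s$ for
  $0 < s < 1$.\<close>

definition frac_laplace_const :: "nat \<Rightarrow> real \<Rightarrow> real" where
  "frac_laplace_const N s =
     s * 4 powr s * Gamma (real N / 2 + s) / (pi powr (real N / 2) * Gamma (1 - s))"

definition frac_laplace :: "real \<Rightarrow> (real ^ 'n::finite \<Rightarrow> real) \<Rightarrow> real ^ 'n \<Rightarrow> real" where
  "frac_laplace s u x = frac_laplace_const CARD('n) s *
     Lim (at_right 0) (\<lambda>\<epsilon>. LINT y:- ball x \<epsilon>|lebesgue.
       (u x - u y) / norm (x - y) powr (real CARD('n) + 2 * s))"

end

theory Submission
  imports Defs
begin

text \<open>Suppose that $w \ge -m$ on \<open>\<Omega>\<close> from some time on. At a point $x$ where $w(\cdot,t)$ has a negative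
  minimum over $\Sigma_\lambda$, of size about $m$, folding the integral along $T_\lambda$ with the
  antisymmetry shows that
  $(-\Delta)^s w(x,t)$ is at most a negative multiple of $m\,d^{-2s}$, where $d < l$ is the distance
  from $x$ to $T_\lambda$. For small $l$ this dominates the term with \<open>c\<close>, so that the minimum
  increases. Two things have to be added to this heuristic.

  The minimum need not be attained: no control of $w$ is available close to $T_\lambda$. One
  therefore works with $w + \psi$, where \<open>\<psi>\<close> is a layer of height $\theta m$ and width \<open>\<delta>\<close> along
  $T_\lambda$, which keeps the negative part away from the plane. The fractional Laplacian of such a
  layer costs at most a multiple of $\theta m\,d^{-2s}$ with a factor independent of \<open>\<delta>\<close>; for a small
  universal \<open>\<theta>\<close> the gain wins. As \<open>\<psi>\<close> vanishes at points whose distance to the plane is at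
  least \<open>\<delta>\<close>, this gives $w \ge \kappa(t)$ in \<open>\<Omega>\<close> with
  $\kappa(t) \to -(1-\theta/2)m$ (\<open>lower_bound_improves\<close>), and iteration lets the bound tend
  to $0$. The estimate of the operator is \<open>half_second_diff_upper_bound\<close>.

  The function $w$ is only separately regular in $x$ and in $t$, so that its infimum over $x$ could,
  a priori, drop at once. Consider $V = ((\kappa - \psi - w)_+)^2$ on \<open>\<Omega>\<close>, extended by $0$. It has
  bounded support, is of class $C^{1,1}$ in $x$ at each time, vanishes initially, and satisfies
  $\partial_t V \le -L V$ in the whole space for a translation invariant operator $L$: squaring is
  convex, and the loss caused by replacing the antisymmetric extension by the zero extension is
  absorbed by the gain. It remains to see that such a $V$ vanishes (\<open>V_vanishes\<close>). Say that
  comparison holds from $p$ to $q$ if the barriers $V(\cdot,\sigma) + c$, raised at the rate given by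
  the $C^{1,1}$ bound of $V(\cdot,\sigma)$, are preserved between these times.

  \<^item> Comparison inside $(\alpha,\beta]$ extends to $\alpha$: the square integral of the excess over a
    barrier is continuous in time by dominated convergence, which needs only pointwise continuity,
    and it does not increase, because comparison bounds the difference quotients of $V$ from above,
    so that a Fatou argument applies (\<open>comparison_left_end\<close>).

  \<^item> Comparison holds on an interval where $V$ is uniformly upper semicontinuous from the right, by
    the maximum principle (\<open>comparison_if_forward_usc\<close>).

  \<^item> The times at which $V(\cdot,t)$ has $C^{1,1}$ bound $n$ form a closed set, and these sets cover the
    time axis. If the closed set of times without comparison nearby were nonempty, then by Baire
    the times with some fixed bound $n$ would contain a relatively open piece of it. On that piece $V$ is equicontinuous in
    $x$, and the gaps are covered by the first item; hence the second item gives comparison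
    there, a contradiction (\<open>all_locally_comparable\<close>).\<close>

section \<open>Second differences and squares of positive parts\<close>

definition second_diff :: "('a::real_vector \<Rightarrow> real) \<Rightarrow> 'a \<Rightarrow> 'a \<Rightarrow> real" where
  "second_diff f x h = 2 * f x - f (x + h) - f (x - h)"

text \<open>The second differences are compared with \<open>min 1 (|h|\<^sup>2)\<close>, so that a bound of order two near
  the origin and boundedness of the function are recorded by one constant. All conditions are
  inequalities between point values and hence survive pointwise limits.\<close>

definition C11_bound :: "real \<Rightarrow> ('a::real_normed_vector \<Rightarrow> real) \<Rightarrow> bool" where
  "C11_bound n f \<longleftrightarrow> 0 \<le> n \<and> (\<forall>x y. \<bar>f x - f y\<bar> \<le> n * norm (x - y)) \<and>
     (\<forall>x h. \<bar>second_diff f x h\<bar> \<le> n * min 1 ((norm h)\<^sup>2))"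

lemma C11_bound_mono: "C11_bound n f \<Longrightarrow> n \<le> m \<Longrightarrow> C11_bound m f"
proof -
  assume a: "C11_bound n f" "n \<le> m"
  have "n * norm (x - y) \<le> m * norm (x - y)" for x y :: 'a
    using a by (intro mult_right_mono) auto
  moreover have "n * min 1 ((norm h)\<^sup>2) \<le> m * min 1 ((norm h)\<^sup>2)" for h :: 'a
    using a by (intro mult_right_mono) auto
  ultimately show ?thesis
    using a unfolding C11_bound_def by (meson order_trans)
qed

lemma C11_bound_continuous:
  assumes "C11_bound n f"
  shows "continuous_on UNIV f"
proof -
  have "n-lipschitz_on UNIV f"
    using assms unfolding C11_bound_def by (intro lipschitz_onI) (auto simp: dist_norm)
  then show ?thesis by (rule lipschitz_on_continuous_on)
qed

lemma C11_bound_diff: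
  assumes "C11_bound n f" "C11_bound m g"
  shows "C11_bound (n + m) (\<lambda>x. f x - g x)"
proof -
  have 1: "\<bar>f x - g x - (f y - g y)\<bar> \<le> (n + m) * norm (x - y)" for x y
  proof -
    have "\<bar>f x - f y\<bar> \<le> n * norm (x - y)" "\<bar>g x - g y\<bar> \<le> m * norm (x - y)"
      using assms unfolding C11_bound_def by auto
    then show ?thesis unfolding distrib_right by linarith
  qed
  have 2: "\<bar>second_diff (\<lambda>x. f x - g x) x h\<bar> \<le> (n + m) * min 1 ((norm h)\<^sup>2)" for x h
  proof -
    have "\<bar>second_diff f x h\<bar> \<le> n * min 1 ((norm h)\<^sup>2)" "\<bar>second_diff g x h\<bar> \<le> m * min 1 ((norm h)\<^sup>2)"
      using assms unfolding C11_bound_def by auto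
    moreover have "second_diff (\<lambda>x. f x - g x) x h = second_diff f x h - second_diff g x h"
      by (simp add: second_diff_def)
    ultimately show ?thesis
      unfolding distrib_right using order_trans[OF abs_triangle_ineq4 add_mono] by simp
  qed
  show ?thesis using assms 1 2 unfolding C11_bound_def by auto
qed

text \<open>The tangent inequality for the convex function $a \mapsto (a_+)^2$, whose derivative is $2a_+$.\<close>

lemma sqr_pos_part_convex: "(max 0 b)\<^sup>2 \<ge> (max 0 a)\<^sup>2 + 2 * max 0 a * (b - a)" for a b :: real
proof (cases "a \<le> 0")
  case False
  have "0 \<le> (b - a)\<^sup>2" by simp
  moreover have "a * b \<le> 0" if "b \<le> 0" using False that by (simp add: mult_nonneg_nonpos)
  ultimately show ?thesis using False
    by (cases "b \<le> 0") (auto simp: power2_eq_square algebra_simps)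
qed auto

lemma sqr_pos_part_upper: "(max 0 b)\<^sup>2 \<le> (max 0 a)\<^sup>2 + 2 * max 0 a * (b - a) + (b - a)\<^sup>2" for a b :: real
proof -
  consider "a \<le> 0" "b \<le> 0" | "a \<le> 0" "b > 0" | "a > 0" "b \<le> 0" | "a > 0" "b > 0" by linarith
  then show ?thesis
  proof cases
    case 1
    then show ?thesis by simp
  next
    case 2
    then have "b\<^sup>2 \<le> (b - a)\<^sup>2" by (intro power_mono) auto
    with 2 show ?thesis by auto
  next
    case 3
    have "a\<^sup>2 + 2 * a * (b - a) + (b - a)\<^sup>2 = b\<^sup>2" by (simp add: power2_eq_square algebra_simps)
    with 3 show ?thesis by auto
  qed (auto simp: power2_eq_square algebra_simps)
qed

lemma DERIV_sqr_pos_part: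
  "((\<lambda>a. (max 0 a)\<^sup>2) has_real_derivative 2 * max 0 a) (at a)" for a :: real
proof -
  have "((\<lambda>h. ((max 0 (a + h))\<^sup>2 - (max 0 a)\<^sup>2) / h) \<longlongrightarrow> 2 * max 0 a) (at 0)"
  proof (rule tendsto_rabs_zero_cancel [THEN LIM_zero_cancel])
    show "((\<lambda>h. \<bar>((max 0 (a + h))\<^sup>2 - (max 0 a)\<^sup>2) / h - 2 * max 0 a\<bar>) \<longlongrightarrow> 0) (at 0)"
    proof (rule tendsto_sandwich[where f="\<lambda>_. 0" and h="\<lambda>h. \<bar>h\<bar>"])
      show "\<forall>\<^sub>F h in at 0. \<bar>((max 0 (a + h))\<^sup>2 - (max 0 a)\<^sup>2) / h - 2 * max 0 a\<bar> \<le> \<bar>h\<bar>"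
      proof (rule eventually_at_filter[THEN iffD2], intro always_eventually allI impI)
        fix h :: real assume "h \<noteq> 0"
        have "\<bar>(max 0 (a + h))\<^sup>2 - (max 0 a)\<^sup>2 - 2 * max 0 a * h\<bar> \<le> h\<^sup>2"
          using sqr_pos_part_convex[of a "a + h"] sqr_pos_part_upper[of "a + h" a] by auto
        moreover have *: "h\<^sup>2 / \<bar>h\<bar> = \<bar>h\<bar>"
          using \<open>h \<noteq> 0\<close> by (metis abs_eq_0 nonzero_mult_div_cancel_left power2_abs power2_eq_square)
        ultimately have "\<bar>((max 0 (a + h))\<^sup>2 - (max 0 a)\<^sup>2 - 2 * max 0 a * h) / h\<bar> \<le> h\<^sup>2 / \<bar>h\<bar>"
          by (metis abs_divide abs_ge_zero divide_right_mono)
        then show "\<bar>((max 0 (a + h))\<^sup>2 - (max 0 a)\<^sup>2) / h - 2 * max 0 a\<bar> \<le> \<bar>h\<bar>"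
          using \<open>h \<noteq> 0\<close> *  by (simp add: diff_divide_distrib)
      qed
    qed (auto intro!: tendsto_eq_intros)
  qed
  then show ?thesis unfolding DERIV_def .
qed

lemma has_real_derivative_sqr_pos_part:
  assumes "(u has_real_derivative u') (at t within S)"
  shows "((\<lambda>t. (max 0 (u t))\<^sup>2) has_real_derivative 2 * max 0 (u t) * u') (at t within S)"
  using DERIV_chain[OF DERIV_sqr_pos_part assms] by (simp add: o_def)

section \<open>Symmetric nonlocal operators\<close>

lemma lborel_translation:
  fixes f :: "'a::euclidean_space \<Rightarrow> real"
  assumes [measurable]: "f \<in> borel_measurable borel"
  shows "integrable lborel (\<lambda>x. f (x + c)) \<longleftrightarrow> integrable lborel f"
    and "(\<integral>x. f (x + c) \<partial>lborel) = (\<integral>x. f x \<partial>lborel)"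
proof -
  have "integrable lborel f \<longleftrightarrow> integrable (distr lborel borel ((+) c)) f"
    by (simp add: lborel_distr_plus)
  also have "\<dots> \<longleftrightarrow> integrable lborel (\<lambda>x. f (c + x))"
    by (rule integrable_distr_eq) auto
  finally show "integrable lborel (\<lambda>x. f (x + c)) \<longleftrightarrow> integrable lborel f"
    by (simp add: add.commute)
  have "integral\<^sup>L lborel f = integral\<^sup>L (distr lborel borel ((+) c)) f"
    by (simp add: lborel_distr_plus)
  also have "\<dots> = integral\<^sup>L lborel (\<lambda>x. f (c + x))"
    by (rule integral_distr) auto
  finally show "(\<integral>x. f (x + c) \<partial>lborel) = (\<integral>x. f x \<partial>lborel)"
    by (simp add: add.commute)
qed

text \<open>The operator below is written with symmetric second differences, so that on functions with a
  \<^term>\<open>C11_bound\<close> it is an absolutely convergent integral and no principal value is needed.\<close>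

locale levy_kernel =
  fixes K :: "'a::euclidean_space \<Rightarrow> real"
  assumes K_nonneg: "0 \<le> K h"
    and K_measurable [measurable]: "K \<in> borel_measurable borel"
    and K_integrable: "integrable lborel (\<lambda>h. min 1 ((norm h)\<^sup>2) * K h)"
begin

definition mass :: real where
  "mass = (\<integral>h. min 1 ((norm h)\<^sup>2) * K h \<partial>lborel)"

definition nonlocal_op :: "('a \<Rightarrow> real) \<Rightarrow> 'a \<Rightarrow> real" where
  "nonlocal_op f x = (\<integral>h. second_diff f x h * K h \<partial>lborel)"

lemma mass_nonneg: "0 \<le> mass"
  unfolding mass_def by (intro integral_nonneg_AE) (auto simp: K_nonneg)

lemma integrable_second_diff:
  assumes "C11_bound n f"
  shows "integrable lborel (\<lambda>h. second_diff f x h * K h)"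
proof -
  have [measurable]: "f \<in> borel_measurable borel"
    using C11_bound_continuous[OF assms] by (rule borel_measurable_continuous_onI)
  show ?thesis
  proof (rule Bochner_Integration.integrable_bound)
    show "integrable lborel (\<lambda>h. n * (min 1 ((norm h)\<^sup>2) * K h))"
      using K_integrable by simp
    show "(\<lambda>h. second_diff f x h * K h) \<in> borel_measurable lborel"
      unfolding second_diff_def by measurable
    have "\<bar>second_diff f x h\<bar> * K h \<le> n * min 1 ((norm h)\<^sup>2) * K h" for h
      using assms K_nonneg unfolding C11_bound_def by (intro mult_right_mono) auto
    then show "AE h in lborel. norm (second_diff f x h * K h) \<le> norm (n * (min 1 ((norm h)\<^sup>2) * K h))"
      using assms by (auto simp: C11_bound_def abs_mult K_nonneg mult.assoc)
  qed
qed

lemma nonlocal_op_bound: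
  assumes "C11_bound n f"
  shows "\<bar>nonlocal_op f x\<bar> \<le> n * mass"
proof -
  have "\<bar>nonlocal_op f x\<bar> \<le> (\<integral>h. \<bar>second_diff f x h * K h\<bar> \<partial>lborel)"
    unfolding nonlocal_op_def by (rule integral_abs_bound)
  also have "\<dots> \<le> (\<integral>h. n * (min 1 ((norm h)\<^sup>2) * K h) \<partial>lborel)"
  proof (rule integral_mono)
    show "integrable lborel (\<lambda>h. \<bar>second_diff f x h * K h\<bar>)"
      using integrable_second_diff[OF assms] by simp
    show "integrable lborel (\<lambda>h. n * (min 1 ((norm h)\<^sup>2) * K h))"
      using K_integrable by simp
    show "\<bar>second_diff f x h * K h\<bar> \<le> n * (min 1 ((norm h)\<^sup>2) * K h)" for h
    proof -
      have "\<bar>second_diff f x h\<bar> * K h \<le> n * min 1 ((norm h)\<^sup>2) * K h"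
        using assms K_nonneg unfolding C11_bound_def by (intro mult_right_mono) auto
      then show ?thesis by (simp add: abs_mult K_nonneg mult.assoc)
    qed
  qed
  also have "\<dots> = n * mass" by (simp add: mass_def)
  finally show ?thesis .
qed

lemma nonlocal_op_diff:
  assumes "C11_bound n f" "C11_bound m g"
  shows "nonlocal_op (\<lambda>x. f x - g x) x = nonlocal_op f x - nonlocal_op g x"
proof -
  have "nonlocal_op (\<lambda>x. f x - g x) x = (\<integral>h. second_diff f x h * K h - second_diff g x h * K h \<partial>lborel)"
    unfolding nonlocal_op_def by (rule Bochner_Integration.integral_cong) (auto simp: second_diff_def algebra_simps)
  also have "\<dots> = nonlocal_op f x - nonlocal_op g x"
    unfolding nonlocal_op_def
    by (rule Bochner_Integration.integral_diff) (use assms integrable_second_diff in auto)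
  finally show ?thesis .
qed

text \<open>At a maximum point of \<open>f - g\<close> the second differences are ordered for every increment.\<close>

lemma nonlocal_op_mono_touching:
  assumes "C11_bound n f" "C11_bound m g" and "\<And>y. f y - g y \<le> f z - g z"
  shows "nonlocal_op g z \<le> nonlocal_op f z"
  unfolding nonlocal_op_def
proof (rule integral_mono)
  fix h
  have "second_diff g z h \<le> second_diff f z h"
    using assms(3)[of "z + h"] assms(3)[of "z - h"] by (simp add: second_diff_def)
  then show "second_diff g z h * K h \<le> second_diff f z h * K h"
    by (intro mult_right_mono) (auto simp: K_nonneg)
qed (use assms integrable_second_diff in auto)

text \<open>With $Y = (Z-c)_+$, convexity bounds \<open>Y x * second_diff Z x h\<close> from below by half of the
  second difference of $Y^2$, and the latter has integral zero in $x$ for every $h$. The condition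
  $c \ge 0$ gives $Y$ bounded support.\<close>

lemma nonlocal_op_energy:
  assumes Z: "C11_bound n Z" and supp: "\<And>x. R < norm x \<Longrightarrow> Z x = 0" and c: "0 \<le> c"
  shows "0 \<le> (\<integral>x. max 0 (Z x - c) * nonlocal_op Z x \<partial>lborel)"
proof -
  have contZ: "continuous_on UNIV Z" using C11_bound_continuous[OF Z] .
  have [measurable]: "Z \<in> borel_measurable borel"
    using contZ by (rule borel_measurable_continuous_onI)
  have "bounded (Z ` cball (0::'a) R)"
    by (intro compact_imp_bounded compact_continuous_image continuous_on_subset[OF contZ]) auto
  then obtain B where "\<forall>y\<in>Z ` cball (0::'a) R. norm y \<le> B"
    unfolding bounded_iff by blast
  then have B: "\<And>x. x \<in> cball (0::'a) R \<Longrightarrow> \<bar>Z x\<bar> \<le> B" by simp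
  define Y where "Y x = max 0 (Z x - c)" for x
  have [measurable]: "Y \<in> borel_measurable borel" unfolding Y_def by measurable
  have Y0: "0 \<le> Y x" for x by (simp add: Y_def)
  have Yind: "Y x \<le> B * indicator (cball (0::'a) R) x" for x
    using supp[of x] B[of x] c by (auto simp: Y_def indicator_def)
  have ball_int: "integrable lborel (indicator (cball (0::'a) R) :: 'a \<Rightarrow> real)"
    using emeasure_lborel_cball_finite[of "0::'a" R] by (intro integrable_real_indicator) auto
  define G where "G x h = Y x * (second_diff Z x h * K h)" for x h
  have Gmeas: "case_prod G \<in> borel_measurable (lborel \<Otimes>\<^sub>M lborel)"
    unfolding G_def second_diff_def by measurable
  have Gbound: "norm (G x h) \<le> (B * indicator (cball (0::'a) R) x) * (n * (min 1 ((norm h)\<^sup>2) * K h))" for x h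
  proof -
    have "\<bar>second_diff Z x h\<bar> * K h \<le> n * min 1 ((norm h)\<^sup>2) * K h"
      using Z K_nonneg unfolding C11_bound_def by (intro mult_right_mono) auto
    moreover have "0 \<le> B * indicator (cball (0::'a) R) x" using Yind[of x] Y0[of x] by linarith
    ultimately have "Y x * (\<bar>second_diff Z x h\<bar> * K h) \<le> (B * indicator (cball (0::'a) R) x) * (n * min 1 ((norm h)\<^sup>2) * K h)"
      using Yind[of x] K_nonneg[of h] by (intro mult_mono[of "Y x" _ "\<bar>second_diff Z x h\<bar> * K h"]) auto
    then show ?thesis by (simp add: G_def abs_mult Y0 K_nonneg mult.assoc)
  qed
  have Gh: "integrable lborel (\<lambda>h. G x h)" for x
    unfolding G_def using integrable_second_diff[OF Z] by simp
  have Gint: "integrable (lborel \<Otimes>\<^sub>M lborel) (case_prod G)"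
  proof (rule lborel_pair.Fubini_integrable[OF Gmeas])
    show "AE x in lborel. integrable lborel (\<lambda>y. case (x, y) of (x, xa) \<Rightarrow> G x xa)"
      using Gh by simp
    show "integrable lborel (\<lambda>x. \<integral>y. norm (case (x, y) of (x, xa) \<Rightarrow> G x xa) \<partial>lborel)"
    proof (rule Bochner_Integration.integrable_bound)
      show "integrable lborel (\<lambda>x. (B * indicator (cball (0::'a) R) x) * (n * mass))"
        using ball_int by simp
      show "(\<lambda>x. \<integral>y. norm (case (x, y) of (x, xa) \<Rightarrow> G x xa) \<partial>lborel) \<in> borel_measurable lborel"
        using Gmeas by measurable
      have "(\<integral>y. norm (G x y) \<partial>lborel) \<le> (B * indicator (cball (0::'a) R) x) * (n * mass)" for x
      proof -
        have "(\<integral>y. norm (G x y) \<partial>lborel) \<le> (\<integral>h. (B * indicator (cball (0::'a) R) x) * (n * (min 1 ((norm h)\<^sup>2) * K h)) \<partial>lborel)"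
          using Gh K_integrable Gbound by (intro integral_mono) auto
        then show ?thesis by (simp add: mass_def)
      qed
      moreover have "0 \<le> (\<integral>y. norm (G x y) \<partial>lborel)" for x
        by (rule Bochner_Integration.integral_nonneg) simp
      ultimately show "AE x in lborel. norm (\<integral>y. norm (case (x, y) of (x, xa) \<Rightarrow> G x xa) \<partial>lborel) \<le> norm (B * indicator (cball (0::'a) R) x * (n * mass))"
        by (intro AE_I2, unfold prod.case real_norm_def) (metis abs_of_nonneg abs_ge_self order_trans)
    qed
  qed
  have "0 \<le> (\<integral>h. (\<integral>x. G x h \<partial>lborel) \<partial>lborel)"
  proof (rule Bochner_Integration.integral_nonneg)
    fix h :: 'a
    define F where "F x = (Y x)\<^sup>2" for x
    have [measurable]: "F \<in> borel_measurable borel" unfolding F_def by measurable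
    have Fint: "integrable lborel F"
    proof (rule Bochner_Integration.integrable_bound)
      show "integrable lborel (\<lambda>x. B\<^sup>2 * indicator (cball (0::'a) R) x)" using ball_int by simp
      have "F x \<le> B\<^sup>2 * indicator (cball (0::'a) R) x" for x
        using power_mono[OF Yind[of x] Y0, of 2] by (auto simp: F_def indicator_def power2_eq_square split: if_splits)
      then show "AE x in lborel. norm (F x) \<le> norm (B\<^sup>2 * indicator (cball (0::'a) R) x)"
        by (auto simp: F_def intro!: AE_I2)
    qed simp
    have Fp: "integrable lborel (\<lambda>x. F (x + h))" "integrable lborel (\<lambda>x. F (x - h))"
      using lborel_translation(1)[of F h] lborel_translation(1)[of F "-h"] Fint by auto
    have "0 = (\<integral>x. (2 * F x - F (x + h) - F (x - h)) / 2 * K h \<partial>lborel)"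
      using Fint Fp lborel_translation(2)[of F h] lborel_translation(2)[of F "-h"] by simp
    also have "\<dots> \<le> (\<integral>x. G x h \<partial>lborel)"
    proof (rule integral_mono)
      show "integrable lborel (\<lambda>x. (2 * F x - F (x + h) - F (x - h)) / 2 * K h)"
        using Fint Fp by simp
      show "integrable lborel (\<lambda>x. G x h)"
      proof (rule Bochner_Integration.integrable_bound)
        show "integrable lborel (\<lambda>x. (B * indicator (cball (0::'a) R) x) * (n * (min 1 ((norm h)\<^sup>2) * K h)))"
          using ball_int by simp
        show "(\<lambda>x. G x h) \<in> borel_measurable lborel" unfolding G_def second_diff_def by measurable
        show "AE x in lborel. norm (G x h) \<le> norm (B * indicator (cball (0::'a) R) x * (n * (min 1 ((norm h)\<^sup>2) * K h)))"
          using Gbound[of _ h] by (intro AE_I2) (metis abs_ge_self order_trans real_norm_def)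
      qed
      fix x
      have *: "(Y x)\<^sup>2 - (Y y)\<^sup>2 \<le> 2 * (Y x * (Z x - Z y))" for y
        using sqr_pos_part_convex[of "Z x - c" "Z y - c"] by (simp add: Y_def algebra_simps)
      have "Y x * second_diff Z x h = Y x * (Z x - Z (x + h)) + Y x * (Z x - Z (x - h))"
        by (simp add: second_diff_def algebra_simps)
      moreover have "(2 * a - b - c) / 2 \<le> r" if "r = p + q" "a - b \<le> 2 * p" "a - c \<le> 2 * q" for a b c p q r :: real
        using that by simp
      ultimately have "(2 * F x - F (x + h) - F (x - h)) / 2 \<le> Y x * second_diff Z x h"
        using *[of "x + h"] *[of "x - h"] unfolding F_def by blast
      then show "(2 * F x - F (x + h) - F (x - h)) / 2 * K h \<le> G x h"
        unfolding G_def mult.assoc[symmetric] by (rule mult_right_mono) (rule K_nonneg)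
    qed
    finally show "0 \<le> (\<integral>x. G x h \<partial>lborel)" .
  qed
  also have "\<dots> = (\<integral>x. (\<integral>h. G x h \<partial>lborel) \<partial>lborel)"
    by (rule lborel_pair.Fubini_integral[OF Gint])
  also have "\<dots> = (\<integral>x. Y x * nonlocal_op Z x \<partial>lborel)"
    by (simp add: G_def nonlocal_op_def)
  finally show ?thesis by (simp add: Y_def)
qed

end

section \<open>Category, monotonicity and null sets\<close>

text \<open>If no \<open>F n\<close> contained a relatively open piece of \<open>S\<close>, all \<open>S - F n\<close> would be dense and open
  in \<open>S\<close>, and Baire would produce a point outside of the cover.\<close>

lemma closed_cover_portion:
  fixes S :: "'a::{real_normed_vector,heine_borel} set" and F :: "nat \<Rightarrow> 'a set"
  assumes S: "closed S" "S \<noteq> {}" and F: "\<And>n. closed (F n)" "S \<subseteq> (\<Union>n. F n)"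
  obtains n U where "open U" "S \<inter> U \<noteq> {}" "S \<inter> U \<subseteq> F n"
proof -
  have "\<exists>n. \<not> S \<subseteq> closure (S - F n)"
  proof (rule ccontr)
    assume "\<not> ?thesis"
    then have dense: "S \<subseteq> closure (S - F n)" for n by blast
    have "S \<subseteq> closure (\<Inter>(range (\<lambda>n. S - F n)))"
    proof (rule Baire[OF S(1)])
      fix T assume "T \<in> range (\<lambda>n. S - F n)"
      then obtain n where T: "T = S - F n" by auto
      then have "T = S \<inter> - F n" by auto
      then have "openin (top_of_set S) T"
        using F(1)[of n] by (metis openin_open_Int open_Compl)
      then show "openin (top_of_set S) T \<and> S \<subseteq> closure T"
        using dense[of n] T by simp
    qed auto
    also have "\<Inter>(range (\<lambda>n. S - F n)) = {}" using F(2) by auto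
    finally show False using S(2) by simp
  qed
  then obtain n where "\<not> S \<subseteq> closure (S - F n)" by blast
  then show ?thesis
    by (intro that[of "- closure (S - F n)" n]) (use closure_subset[of "S - F n"] in \<open>auto simp: open_Compl\<close>)
qed

text \<open>The points reachable from \<open>s\<close> with slope at most \<open>e\<close> form a closed set, and \<open>step\<close> prevents its
  supremum from lying before \<open>b\<close>. Steps start after \<open>a\<close> only; continuity carries the conclusion to \<open>a\<close>.\<close>

lemma nonincreasing_if_forward_steps:
  fixes f :: "real \<Rightarrow> real"
  assumes ab: "a < b" and cont: "continuous_on {a..b} f"
    and step: "\<And>t e d. a < t \<Longrightarrow> t < b \<Longrightarrow> 0 < e \<Longrightarrow> 0 < d \<Longrightarrow>
                 \<exists>t'. t < t' \<and> t' < t + d \<and> t' \<le> b \<and> f t' \<le> f t + e * (t' - t)"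
  shows "f b \<le> f a"
proof -
  have inner: "f b \<le> f s + e * (b - s)" if s: "a < s" "s < b" and e: "0 < e" for s e
  proof -
    define T where "T = {t \<in> {s..b}. f t \<le> f s + e * (t - s)}"
    have "closed T"
      unfolding T_def using s
      by (intro continuous_on_closed_Collect_le continuous_on_subset[OF cont] continuous_intros) auto
    moreover have "s \<in> T" using s by (simp add: T_def)
    moreover have bdd: "bdd_above T" by (auto simp: T_def intro: bdd_aboveI[of _ b])
    ultimately have T: "Sup T \<in> T" by (intro closed_contains_Sup) auto
    have "Sup T = b"
    proof (rule ccontr)
      assume "Sup T \<noteq> b"
      then have lt: "Sup T < b" "a < Sup T" using T s by (auto simp: T_def)
      obtain t' where t': "Sup T < t'" "t' \<le> b" "f t' \<le> f (Sup T) + e * (t' - Sup T)"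
        using step[OF lt(2,1) e, of 1] by auto
      have "f (Sup T) \<le> f s + e * (Sup T - s)" using T by (simp add: T_def)
      then have "f t' \<le> f s + e * (t' - s)" using t'(3) by (simp add: algebra_simps)
      then have "t' \<in> T" using t' T by (auto simp: T_def)
      then show False using cSup_upper[OF _ bdd] t'(1) by fastforce
    qed
    then show ?thesis using T by (simp add: T_def)
  qed
  have le: "f b \<le> f s" if s: "a < s" "s < b" for s
  proof (rule field_le_epsilon)
    fix e :: real assume "0 < e"
    then show "f b \<le> f s + e" using inner[OF s, of "e / (b - s)"] s by simp
  qed
  have "(f \<longlongrightarrow> f a) (at a within {a..b})" using cont ab by (simp add: continuous_on_def)
  then have "(f \<longlongrightarrow> f a) (at_right a)" using ab by (simp add: at_within_Icc_at_right)
  moreover have "\<forall>\<^sub>F s in at_right a. f b \<le> f s"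
    using eventually_at_right_real[OF ab] by eventually_elim (use le in auto)
  ultimately show ?thesis by (rule tendsto_lowerbound) simp
qed

lemma integrable_indicator_cball:
  "integrable lborel (indicator (cball (0::'a::euclidean_space) R) :: 'a \<Rightarrow> real)"
  using emeasure_lborel_cball_finite[of "0::'a" R] by (intro integrable_real_indicator) auto

lemma AE_lborel_zero_continuous:
  fixes f :: "'a::euclidean_space \<Rightarrow> real"
  assumes "continuous_on UNIV f" "AE x in lborel. f x = 0"
  shows "f x = 0"
proof (rule ccontr)
  assume "f x \<noteq> 0"
  have [measurable]: "f \<in> borel_measurable borel"
    using assms(1) by (rule borel_measurable_continuous_onI)
  have "open {x. f x \<noteq> 0}"
    using open_Collect_neq[OF assms(1) continuous_on_const[of UNIV 0]] .
  moreover have "{x. f x \<noteq> 0} \<in> null_sets lborel"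
    using assms(2) AE_iff_null_sets[of "{x. f x \<noteq> 0}" lborel] by auto
  then have "negligible {x. f x \<noteq> 0}"
    using null_sets_completionI negligible_iff_null_sets by blast
  ultimately have "{x. f x \<noteq> 0} = {}"
    using open_not_negligible by blast
  then show False using \<open>f x \<noteq> 0\<close> by auto
qed

section \<open>Comparison for subsolutions without joint continuity\<close>

text \<open>The function \<open>V\<close> is continuous in space and in time separately, and its $C^{1,1}$ bounds in space
  may depend on the time in any way; this is the reason for the category argument below.\<close>

locale nonlocal_subsolution = levy_kernel K for K :: "'a::euclidean_space \<Rightarrow> real" +
  fixes V D :: "'a \<Rightarrow> real \<Rightarrow> real" and a R M :: real
  assumes V_nonneg: "a \<le> t \<Longrightarrow> 0 \<le> V x t"
    and V_bounded: "a \<le> t \<Longrightarrow> V x t \<le> M"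
    and V_support: "a \<le> t \<Longrightarrow> R < norm x \<Longrightarrow> V x t = 0"
    and V_C11: "a \<le> t \<Longrightarrow> \<exists>n. C11_bound n (\<lambda>x. V x t)"
    and V_deriv: "a \<le> t \<Longrightarrow> (V x has_real_derivative D x t) (at t within {a..})"
    and V_sub: "a \<le> t \<Longrightarrow> D x t \<le> - nonlocal_op (\<lambda>x. V x t) x"
    and V_init: "V x a = 0"
begin

text \<open>The rate \<open>n * mass\<close> bounds the operator on $V(\cdot,\sigma)$, so that the raised barrier is a
  supersolution. Taking slices of \<open>V\<close> itself as barriers makes comparison from time \<open>p\<close>, with
  $\sigma = p$ and $c = 0$, a one-sided Lipschitz bound in time.\<close>

definition comparison :: "real \<Rightarrow> real \<Rightarrow> bool" where
  "comparison p q \<longleftrightarrow> (\<forall>\<sigma> n c. a \<le> \<sigma> \<longrightarrow> C11_bound n (\<lambda>x. V x \<sigma>) \<longrightarrow> 0 \<le> c \<longrightarrow>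
     (\<forall>x. V x p \<le> V x \<sigma> + c) \<longrightarrow> (\<forall>x. V x q \<le> V x \<sigma> + c + n * mass * (q - p)))"

lemma comparisonD:
  assumes "comparison p q" "a \<le> \<sigma>" "C11_bound n (\<lambda>x. V x \<sigma>)" "0 \<le> c" "\<And>x. V x p \<le> V x \<sigma> + c"
  shows "V x q \<le> V x \<sigma> + c + n * mass * (q - p)"
  using assms unfolding comparison_def by blast

lemma rate_nonneg: "C11_bound n f \<Longrightarrow> 0 \<le> n * mass"
  using mass_nonneg by (auto simp: C11_bound_def)

lemma comparison_trans:
  assumes "comparison p q" "comparison q r" "p \<le> q"
  shows "comparison p r"
  unfolding comparison_def
proof (intro allI impI)
  fix \<sigma> n c x
  assume s: "a \<le> \<sigma>" "C11_bound n (\<lambda>x. V x \<sigma>)" "0 \<le> c" "\<forall>x. V x p \<le> V x \<sigma> + c"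
  have "V x q \<le> V x \<sigma> + (c + n * mass * (q - p))" for x
    using comparisonD[OF assms(1) s(1-3)] s(4) by (simp add: add.assoc)
  moreover have "0 \<le> c + n * mass * (q - p)"
    using rate_nonneg[OF s(2)] assms(3) s(3) by simp
  ultimately have "V x r \<le> V x \<sigma> + (c + n * mass * (q - p)) + n * mass * (r - q)"
    using comparisonD[OF assms(2) s(1,2)] by blast
  then show "V x r \<le> V x \<sigma> + c + n * mass * (r - p)" by (simp add: algebra_simps)
qed

lemma V_time_continuous: "continuous_on {a..} (V x)"
  by (rule DERIV_continuous_on) (use V_deriv in auto)

lemma V_space_continuous: "a \<le> t \<Longrightarrow> continuous_on UNIV (\<lambda>x. V x t)"
  using V_C11 C11_bound_continuous by blast

text \<open>Follow the excess over a slightly faster barrier back to the first time at which it is attained.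
  Right semicontinuity shows that this first time is itself such a time; if it came after \<open>p\<close>, the
  excess at its maximum point in $x$ would have been larger just before.\<close>

lemma comparison_if_forward_usc:
  assumes pq: "a \<le> p" "p \<le> q"
    and usc: "\<And>\<tau> \<eta>. p \<le> \<tau> \<Longrightarrow> \<tau> < q \<Longrightarrow> 0 < \<eta> \<Longrightarrow>
                \<exists>\<delta>>0. \<forall>t x. \<tau> < t \<and> t < \<tau> + \<delta> \<and> t \<le> q \<longrightarrow> V x t \<le> V x \<tau> + \<eta>"
  shows "comparison p q"
  unfolding comparison_def
proof (intro allI impI)
  fix \<sigma> n c x0
  assume s: "a \<le> \<sigma>" and n: "C11_bound n (\<lambda>x. V x \<sigma>)" and c: "0 \<le> c"
    and start: "\<forall>x. V x p \<le> V x \<sigma> + c"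
  define C where "C = n * mass"
  have C0: "0 \<le> C" using rate_nonneg[OF n] by (simp add: C_def)
  show "V x0 q \<le> V x0 \<sigma> + c + n * mass * (q - p)"
  proof (rule ccontr)
    assume "\<not> ?thesis"
    then obtain e where e: "0 < e" "V x0 q = V x0 \<sigma> + c + C * (q - p) + e"
      unfolding C_def by (metis add_diff_cancel_left' diff_gt_0_iff_gt linorder_not_le add_diff_eq diff_add_cancel add.commute)
    \<comment> \<open>the excess \<open>e\<close> at time \<open>q\<close> is split: half for a strictly larger rate, half for a strict inequality at \<open>p\<close>\<close>
    define \<epsilon> where "\<epsilon> = e / 2 / (q - p + 1)"
    define d where "d t = c + (C + \<epsilon>) * (t - p) + e / 2" for t
    have eps: "0 < \<epsilon>" using e pq by (simp add: \<epsilon>_def)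
    have dpos: "0 < d t" if "p \<le> t" for t
    proof -
      have "0 \<le> (C + \<epsilon>) * (t - p)" using that eps C0 by simp
      then show ?thesis using c e by (simp add: d_def)
    qed
    have dmono: "d s \<le> d t" if "s \<le> t" for s t
      using that eps C0 by (auto simp: d_def intro!: mult_left_mono)
    have "\<epsilon> * (q - p) \<le> \<epsilon> * (q - p + 1)" using eps by simp
    also have "\<dots> = e / 2" using pq nonzero_divide_eq_eq[of "q - p + 1" "e / 2" \<epsilon>] unfolding \<epsilon>_def by simp
    finally have dq: "d q \<le> c + C * (q - p) + e" by (simp add: d_def algebra_simps)
    define T where "T = {t \<in> {p..q}. \<exists>x. V x \<sigma> + d t \<le> V x t}"
    have qT: "q \<in> T" unfolding T_def using e dq pq by (auto intro!: exI[of _ x0])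
    have bdd: "bdd_below T" unfolding T_def by (auto intro: bdd_belowI[of _ p])
    define \<tau> where "\<tau> = Inf T"
    have \<tau>: "p \<le> \<tau>" "\<tau> \<le> q"
      unfolding \<tau>_def using qT bdd by (auto intro!: cInf_greatest cInf_lower simp: T_def)
    have a\<tau>: "a \<le> \<tau>" using \<tau> pq by simp
    define g where "g x = V x \<tau> - V x \<sigma>" for x
    have contg: "continuous_on UNIV g"
      unfolding g_def by (intro continuous_intros V_space_continuous a\<tau> s)
    have g0: "g x = 0" if "R < norm x" for x
      using V_support[OF a\<tau> that] V_support[OF s that] by (simp add: g_def)
    have max_attained: "\<exists>z. \<forall>x. g x \<le> max 0 (g z)"
    proof (cases "cball (0::'a) R = {}")
      case True
      then have "\<forall>x. g x \<le> 0" using g0 by (metis cball_eq_empty norm_ge_zero order_less_le_trans order_refl)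
      then show ?thesis by (metis max.coboundedI1)
    next
      case False
      then obtain z where "\<forall>x\<in>cball 0 R. g x \<le> g z"
        using continuous_attains_sup[OF compact_cball, of 0 R g] continuous_on_subset[OF contg] by blast
      then have "g x \<le> max 0 (g z)" for x
        using g0[of x] by (cases "norm x \<le> R") (auto simp: le_max_iff_disj)
      then show ?thesis by blast
    qed
    have \<tau>T: "\<tau> \<in> T"
    proof (rule ccontr)
      assume nT: "\<tau> \<notin> T"
      then have "\<tau> < q" using \<tau> qT by (cases "\<tau> = q") auto
      have less: "g x < d \<tau>" for x
        using nT \<tau> by (auto simp: T_def g_def not_le algebra_simps)
      obtain z where z: "\<And>x. g x \<le> max 0 (g z)" using max_attained by blast
      define \<eta> where "\<eta> = (d \<tau> - max 0 (g z)) / 2"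
      have \<eta>: "0 < \<eta>" using less[of z] dpos[OF \<tau>(1)] by (simp add: \<eta>_def)
      obtain \<delta> where \<delta>: "0 < \<delta>" "\<And>t x. \<tau> < t \<Longrightarrow> t < \<tau> + \<delta> \<Longrightarrow> t \<le> q \<Longrightarrow> V x t \<le> V x \<tau> + \<eta>"
        using usc[OF \<tau>(1) \<open>\<tau> < q\<close> \<eta>] by blast
      obtain t where t: "t \<in> T" "t < \<tau> + \<delta>"
        using cInf_lessD[of T "\<tau> + \<delta>"] qT \<delta>(1) by (auto simp: \<tau>_def)
      have "\<tau> \<le> t" using cInf_lower[OF t(1) bdd] by (simp add: \<tau>_def)
      then have "\<tau> < t" using t nT by (metis order_le_less)
      obtain x where x: "V x \<sigma> + d t \<le> V x t" using t by (auto simp: T_def)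
      have "V x t \<le> V x \<tau> + \<eta>" using \<delta>(2) \<open>\<tau> < t\<close> t by (auto simp: T_def)
      moreover have "d \<tau> \<le> d t" using dmono \<open>\<tau> < t\<close> by simp
      ultimately have "d \<tau> - \<eta> \<le> g x" using x by (simp add: g_def)
      moreover have "2 * \<eta> = d \<tau> - max 0 (g z)" by (simp add: \<eta>_def)
      then have "g x \<le> d \<tau> - 2 * \<eta>" using z[of x] by linarith
      ultimately show False using \<eta> by simp
    qed
    then obtain x1 where x1: "d \<tau> \<le> g x1" by (auto simp: T_def g_def algebra_simps)
    show False
    proof (cases "\<tau> = p")
      case True
      then have "c + e / 2 \<le> g x1" using x1 by (simp add: d_def)
      then show False using start e True by (auto simp: g_def algebra_simps) (smt (verit) field_sum_of_halves)
    next
      case False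
      then have "p < \<tau>" using \<tau> by simp
      obtain z where z: "\<And>x. g x \<le> max 0 (g z)" using max_attained by blast
      have gz: "\<And>x. g x \<le> g z" "d \<tau> \<le> g z"
      proof -
        have "0 < g x1" using x1 dpos[OF \<tau>(1)] by simp
        then have "max 0 (g z) = g z" using z[of x1] by simp
        then show all: "g x \<le> g z" for x using z[of x] by simp
        show "d \<tau> \<le> g z" using all[of x1] x1 by simp
      qed
      obtain m where m: "C11_bound m (\<lambda>x. V x \<tau>)" using V_C11[OF a\<tau>] by blast
      have "nonlocal_op (\<lambda>x. V x \<sigma>) z \<le> nonlocal_op (\<lambda>x. V x \<tau>) z"
        by (rule nonlocal_op_mono_touching[OF m n]) (use gz(1) in \<open>auto simp: g_def\<close>)
      moreover have "- C \<le> nonlocal_op (\<lambda>x. V x \<sigma>) z"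
        using nonlocal_op_bound[OF n, of z] by (auto simp: C_def)
      ultimately have "D z \<tau> \<le> C" using V_sub[OF a\<tau>, of z] by linarith
      have "((\<lambda>t. V z t - (C + \<epsilon>) * t) has_real_derivative D z \<tau> - (C + \<epsilon>)) (at \<tau> within {a..})"
        by (auto intro!: derivative_eq_intros V_deriv[OF a\<tau>])
      moreover have "D z \<tau> - (C + \<epsilon>) < 0" using \<open>D z \<tau> \<le> C\<close> eps by simp
      ultimately have "\<exists>\<delta>>0. \<forall>h>0. \<tau> - h \<in> {a..} \<longrightarrow> h < \<delta> \<longrightarrow> V z \<tau> - (C + \<epsilon>) * \<tau> < V z (\<tau> - h) - (C + \<epsilon>) * (\<tau> - h)"
        by (rule has_real_derivative_neg_dec_left)
      then obtain \<delta> where \<delta>: "0 < \<delta>"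
        "\<And>h. 0 < h \<Longrightarrow> \<tau> - h \<in> {a..} \<Longrightarrow> h < \<delta> \<Longrightarrow> V z \<tau> - (C + \<epsilon>) * \<tau> < V z (\<tau> - h) - (C + \<epsilon>) * (\<tau> - h)"
        by blast
      define h where "h = min (\<tau> - p) (\<delta> / 2)"
      have h: "0 < h" "h \<le> \<tau> - p" "h < \<delta>" using \<open>p < \<tau>\<close> \<delta>(1) by (auto simp: h_def)
      have "V z \<tau> - (C + \<epsilon>) * \<tau> < V z (\<tau> - h) - (C + \<epsilon>) * (\<tau> - h)"
        using \<delta>(2)[OF h(1) _ h(3)] h pq by auto
      then have "V z \<sigma> + d (\<tau> - h) \<le> V z (\<tau> - h)"
        using gz(2) by (simp add: g_def d_def algebra_simps)
      then have "\<tau> - h \<in> T" using h \<tau> unfolding T_def by auto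
      then have "\<tau> \<le> \<tau> - h" using cInf_lower[OF _ bdd] by (simp add: \<tau>_def)
      then show False using h by simp
    qed
  qed
qed

text \<open>At \<open>\<alpha>\<close> nothing but pointwise convergence of $V(x,t)$ is available, so a quantity
  that is continuous under bounded pointwise convergence is used: the square integral of the excess
  over the barrier. For $t > \alpha$, comparison bounds the difference quotients of
  \<open>V\<close> from above uniformly in $x$, which is what a Fatou argument needs to differentiate it.\<close>

lemma comparison_left_end:
  assumes ab: "a \<le> \<alpha>" "\<alpha> < \<beta>"
    and int: "\<And>p r. \<alpha> < p \<Longrightarrow> p \<le> r \<Longrightarrow> r \<le> \<beta> \<Longrightarrow> comparison p r"
  shows "comparison \<alpha> \<beta>"
  unfolding comparison_def
proof (intro allI impI)
  fix \<sigma> n c x0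
  assume s: "a \<le> \<sigma>" and n: "C11_bound n (\<lambda>x. V x \<sigma>)" and c: "0 \<le> c"
    and start: "\<forall>x. V x \<alpha> \<le> V x \<sigma> + c"
  define C where "C = n * mass"
  have C0: "0 \<le> C" using rate_nonneg[OF n] by (simp add: C_def)
  define lev where "lev t = c + C * (t - \<alpha>)" for t
  have lev0: "0 \<le> lev t" if "\<alpha> \<le> t" for t using that c C0 by (simp add: lev_def)
  define Z where "Z t x = V x t - V x \<sigma>" for t x
  define Y where "Y t x = max 0 (Z t x - lev t)" for t x
  define I where "I t = (\<integral>x. (Y t x)\<^sup>2 \<partial>lborel)" for t
  have M0: "0 \<le> M" using V_nonneg[OF s] V_bounded[OF s] order_trans by blast
  have Zcont: "continuous_on UNIV (Z t)" if "\<alpha> \<le> t" for t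
    unfolding Z_def using that ab s by (intro continuous_intros V_space_continuous) auto
  have Ycont: "continuous_on UNIV (Y t)" if "\<alpha> \<le> t" for t
    unfolding Y_def using Zcont[OF that] by (intro continuous_intros)
  have Ymeas [measurable]: "Y t \<in> borel_measurable borel" if "\<alpha> \<le> t" for t
    using Ycont[OF that] by (rule borel_measurable_continuous_onI)
  have Y0: "0 \<le> Y t x" for t x by (simp add: Y_def)
  have Zsupp: "Z t x = 0" if "\<alpha> \<le> t" "R < norm x" for t x
    using V_support[of t x] V_support[of \<sigma> x] that s ab by (simp add: Z_def)
  have Ysupp: "Y t x = 0" if "\<alpha> \<le> t" "R < norm x" for t x
    using Zsupp[OF that] lev0[OF that(1)] by (simp add: Y_def)
  have YM: "Y t x \<le> M" if "\<alpha> \<le> t" for t x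
    using V_bounded[of t x] V_nonneg[of \<sigma> x] lev0[OF that] that ab s M0 by (auto simp: Y_def Z_def)
  have Ysq_bound: "(Y t x)\<^sup>2 \<le> M\<^sup>2 * indicator (cball (0::'a) R) x" if "\<alpha> \<le> t" for t x
    using Ysupp[OF that, of x] power_mono[OF YM[OF that] Y0, of x 2] by (auto simp: indicator_def)
  have bnd_int: "integrable lborel (\<lambda>x. B * indicator (cball (0::'a) R) x)" for B :: real
    by (intro integrable_mult_right integrable_indicator_cball)
  have Ysq_int: "integrable lborel (\<lambda>x. (Y t x)\<^sup>2)" if "\<alpha> \<le> t" for t
  proof (rule Bochner_Integration.integrable_bound[OF bnd_int[of "M\<^sup>2"]])
    show "(\<lambda>x. (Y t x)\<^sup>2) \<in> borel_measurable lborel" using Ymeas[OF that] by measurable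
  qed (use Ysq_bound[OF that] in auto)
  have Icont: "continuous_on {\<alpha>..\<beta>} I"
    unfolding continuous_on_sequentially
  proof (intro allI impI ballI, elim conjE)
    fix u :: "nat \<Rightarrow> real" and t
    assume t: "t \<in> {\<alpha>..\<beta>}" and u: "\<forall>i. u i \<in> {\<alpha>..\<beta>}" "u \<longlonglongrightarrow> t"
    have "(\<lambda>i. I (u i)) \<longlonglongrightarrow> I t"
      unfolding I_def
    proof (rule integral_dominated_convergence[OF _ _ bnd_int[of "M\<^sup>2"]])
      show "(\<lambda>x. (Y t x)\<^sup>2) \<in> borel_measurable lborel" "(\<lambda>x. (Y (u i) x)\<^sup>2) \<in> borel_measurable lborel" for i
        using Ymeas[of t] Ymeas[of "u i"] t u(1) by auto
      show "AE x in lborel. norm ((Y (u i) x)\<^sup>2) \<le> M\<^sup>2 * indicator (cball 0 R) x" for i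
        using Ysq_bound[of "u i"] u(1) by auto
      have "(\<lambda>i. V x (u i)) \<longlonglongrightarrow> V x t" for x
        using continuous_on_tendsto_compose[OF V_time_continuous u(2), of x] t u(1) ab by (auto simp: order_trans)
      then have "(\<lambda>i. (Y (u i) x)\<^sup>2) \<longlonglongrightarrow> (Y t x)\<^sup>2" for x
        unfolding Y_def Z_def lev_def by (intro tendsto_intros u(2))
      then show "AE x in lborel. (\<lambda>i. (Y (u i) x)\<^sup>2) \<longlonglongrightarrow> (Y t x)\<^sup>2" by simp
    qed
    then show "(I \<circ> u) \<longlonglongrightarrow> I t" by (simp add: o_def)
  qed
  have "I \<beta> \<le> I \<alpha>"
  proof (rule nonincreasing_if_forward_steps[OF ab(2) Icont])
    fix t e d :: real
    assume t: "\<alpha> < t" "t < \<beta>" and e: "0 < e" and d: "0 < d"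
    have at: "a \<le> t" "\<alpha> \<le> t" using t ab by auto
    obtain m where m: "C11_bound m (\<lambda>x. V x t)" using V_C11[OF at(1)] by blast
    define L where "L = m * mass"
    have L0: "0 \<le> L" using rate_nonneg[OF m] by (simp add: L_def)
    define H where "H = min d (\<beta> - t) / 2"
    have H: "0 < H" "H < d" "H < \<beta> - t" using t d by (auto simp: H_def)
    define h where "h i = H * inverse (real (Suc i))" for i
    have hpos: "0 < h i" "h i \<le> H" for i
    proof -
      show "0 < h i" using H by (simp add: h_def)
      have "inverse (real (Suc i)) \<le> 1" by (simp add: inverse_le_1_iff)
      then have "H * inverse (real (Suc i)) \<le> H * 1" using H by (intro mult_left_mono) auto
      then show "h i \<le> H" by (simp add: h_def)
    qed
    have hlim: "h \<longlonglongrightarrow> 0"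
      unfolding h_def using tendsto_mult_right_zero[OF LIMSEQ_inverse_real_of_nat] by simp
    define q where "q i x = ((Y (t + h i) x)\<^sup>2 - (Y t x)\<^sup>2) / h i" for i x
    define Q where "Q x = 2 * Y t x * (D x t - C)" for x
    define g where "g x = 2 * Y t x * (- nonlocal_op (Z t) x)" for x
    have C11Z: "C11_bound (m + n) (Z t)"
      unfolding Z_def by (rule C11_bound_diff[OF m n])
    have opZ: "\<bar>nonlocal_op (Z t) x\<bar> \<le> (m + n) * mass" for x
      by (rule nonlocal_op_bound[OF C11Z])
    have Ystep: "Y (t + h i) x \<le> Y t x + L * h i" for i x
    proof -
      have "V x (t + h i) \<le> V x t + 0 + m * mass * (t + h i - t)"
        by (rule comparisonD[OF int at(1) m]) (use t hpos[of i] H in auto)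
      moreover have "lev t \<le> lev (t + h i)" using hpos[of i] C0 by (auto simp: lev_def intro!: mult_left_mono)
      moreover have "0 \<le> L * h i" using L0 hpos[of i] by simp
      ultimately show ?thesis by (auto simp: Y_def Z_def L_def)
    qed
    define W where "W = 2 * M * L + L\<^sup>2 * H"
    have W0: "0 \<le> W" using M0 L0 H by (simp add: W_def)
    have qW: "q i x \<le> W * indicator (cball 0 R) x" for i x
    proof (cases "R < norm x")
      case True
      then show ?thesis using Ysupp[of t x] Ysupp[of "t + h i" x] at hpos[of i] W0 by (simp add: q_def)
    next
      case False
      have "(Y (t + h i) x)\<^sup>2 \<le> (Y t x + L * h i)\<^sup>2"
        by (rule power_mono[OF Ystep Y0])
      then have "(Y (t + h i) x)\<^sup>2 - (Y t x)\<^sup>2 \<le> (2 * Y t x * L + L\<^sup>2 * h i) * h i"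
        by (simp add: power2_eq_square algebra_simps)
      then have "q i x \<le> 2 * Y t x * L + L\<^sup>2 * h i"
        using hpos[of i] by (simp add: q_def pos_divide_le_eq)
      also have "\<dots> \<le> W"
        unfolding W_def using YM[OF at(2), of x] Y0[of t x] M0 L0 hpos[of i] by (intro add_mono mult_mono) auto
      finally show ?thesis using False by (simp add: indicator_def)
    qed
    define B where "B = 2 * M * ((m + n) * mass)"
    have gB: "\<bar>g x\<bar> \<le> B * indicator (cball 0 R) x" for x
    proof (cases "R < norm x")
      case True
      then show ?thesis using Ysupp[OF at(2) True] by (simp add: g_def)
    next
      case False
      have "\<bar>g x\<bar> = 2 * Y t x * \<bar>nonlocal_op (Z t) x\<bar>" using Y0[of t x] by (simp add: g_def abs_mult)
      also have "\<dots> \<le> B"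
        unfolding B_def using YM[OF at(2), of x] Y0[of t x] opZ[of x] M0 by (intro mult_mono) auto
      finally show ?thesis using False by (simp add: indicator_def)
    qed
    have [measurable]: "Z t \<in> borel_measurable borel"
      using Zcont[OF at(2)] by (rule borel_measurable_continuous_onI)
    have opZm [measurable]: "nonlocal_op (Z t) \<in> borel_measurable borel"
      unfolding nonlocal_op_def second_diff_def by measurable
    have Ym [measurable]: "Y t \<in> borel_measurable borel" "Y (t + h i) \<in> borel_measurable borel" for i
      using Ymeas[of t] Ymeas[of "t + h i"] at hpos[of i] by auto
    have gm [measurable]: "g \<in> borel_measurable borel" unfolding g_def by measurable
    have qm [measurable]: "q i \<in> borel_measurable borel" for i unfolding q_def by measurable
    have Qg: "Q x \<le> g x" for x
    proof -
      have "nonlocal_op (Z t) x = nonlocal_op (\<lambda>x. V x t) x - nonlocal_op (\<lambda>x. V x \<sigma>) x"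
        unfolding Z_def by (rule nonlocal_op_diff[OF m n])
      moreover have "- C \<le> nonlocal_op (\<lambda>x. V x \<sigma>) x"
        using nonlocal_op_bound[OF n, of x] by (auto simp: C_def)
      ultimately have "D x t - C \<le> - nonlocal_op (Z t) x"
        using V_sub[OF at(1), of x] by linarith
      then show ?thesis unfolding Q_def g_def using Y0[of t x] by (intro mult_left_mono) auto
    qed
    have qlim: "(\<lambda>i. q i x) \<longlonglongrightarrow> Q x" for x
    proof -
      have "((\<lambda>\<tau>. V x \<tau> - V x \<sigma> - lev \<tau>) has_real_derivative D x t - C) (at t within {a..})"
        unfolding lev_def by (auto intro!: derivative_eq_intros V_deriv[OF at(1)])
      then have "((\<lambda>\<tau>. (Y \<tau> x)\<^sup>2) has_real_derivative Q x) (at t within {a..})"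
        unfolding Y_def Z_def Q_def by (rule has_real_derivative_sqr_pos_part)
      then have "((\<lambda>\<tau>. ((Y \<tau> x)\<^sup>2 - (Y t x)\<^sup>2) / (\<tau> - t)) \<longlongrightarrow> Q x) (at t within {a..})"
        by (simp add: has_field_derivative_iff)
      moreover have "filterlim (\<lambda>i. t + h i) (at t within {a..}) sequentially"
        unfolding filterlim_at
      proof (intro conjI always_eventually allI)
        show "(\<lambda>i. t + h i) \<longlonglongrightarrow> t" using tendsto_add[OF tendsto_const hlim, of t] by simp
        have "h i \<noteq> 0" for i using hpos(1)[of i] by simp
        then show "t + h i \<in> {a..}" "t + h i \<noteq> t" for i
          using hpos(1)[of i] at by auto
      qed
      ultimately have "(\<lambda>i. ((Y (t + h i) x)\<^sup>2 - (Y t x)\<^sup>2) / (t + h i - t)) \<longlonglongrightarrow> Q x"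
        by (rule filterlim_compose)
      then show ?thesis by (simp add: q_def)
    qed
    \<comment> \<open>the quotients \<open>q i\<close> are bounded above only; since their limit is at most \<open>g\<close>, taking the maximum with \<open>g\<close> makes the sequence dominated without spoiling the bound\<close>
    have "(\<lambda>i. \<integral>x. max (q i x) (g x) \<partial>lborel) \<longlonglongrightarrow> (\<integral>x. g x \<partial>lborel)"
    proof (rule integral_dominated_convergence[OF _ _ bnd_int[of "W + B"]])
      have "(\<lambda>i. max (q i x) (g x)) \<longlonglongrightarrow> max (Q x) (g x)" for x
        by (intro tendsto_max qlim tendsto_const)
      then show "AE x in lborel. (\<lambda>i. max (q i x) (g x)) \<longlonglongrightarrow> g x"
        using Qg by (simp add: max_absorb2)
      have "\<bar>max (q i x) (g x)\<bar> \<le> (W + B) * indicator (cball 0 R) x" for i x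
        using qW[of i x] gB[of x] W0 by (auto simp: indicator_def max_def abs_le_iff split: if_splits)
      then show "AE x in lborel. norm (max (q i x) (g x)) \<le> (W + B) * indicator (cball 0 R) x" for i
        by simp
    qed auto
    moreover have "(\<integral>x. g x \<partial>lborel) < e"
    proof -
      have "0 \<le> (\<integral>x. max 0 (Z t x - lev t) * nonlocal_op (Z t) x \<partial>lborel)"
        by (rule nonlocal_op_energy[OF C11Z Zsupp[OF at(2)] lev0[OF at(2)]])
      moreover have "(\<integral>x. g x \<partial>lborel) = - 2 * (\<integral>x. max 0 (Z t x - lev t) * nonlocal_op (Z t) x \<partial>lborel)"
        unfolding integral_mult_right_zero[symmetric] by (rule Bochner_Integration.integral_cong) (auto simp: g_def Y_def)
      ultimately show ?thesis using e by linarith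
    qed
    ultimately have "\<forall>\<^sub>F i in sequentially. (\<integral>x. max (q i x) (g x) \<partial>lborel) < e"
      by (rule order_tendstoD)
    then obtain i where i: "(\<integral>x. max (q i x) (g x) \<partial>lborel) < e"
      by (auto simp: eventually_sequentially)
    have sq: "integrable lborel (\<lambda>x. (Y (t + h i) x)\<^sup>2)" "integrable lborel (\<lambda>x. (Y t x)\<^sup>2)"
      using Ysq_int[of t] Ysq_int[of "t + h i"] at hpos[of i] by auto
    then have qint: "integrable lborel (q i)" unfolding q_def by simp
    have gint: "integrable lborel g"
      by (rule Bochner_Integration.integrable_bound[OF bnd_int[of B]]) (use gB order_trans[OF gB abs_ge_self] in auto)
    have "(I (t + h i) - I t) / h i = (\<integral>x. q i x \<partial>lborel)"
      unfolding I_def q_def using sq by simp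
    also have "\<dots> \<le> (\<integral>x. max (q i x) (g x) \<partial>lborel)"
      by (rule integral_mono) (use qint gint in auto)
    also have "\<dots> < e" by (rule i)
    finally have "I (t + h i) \<le> I t + e * (t + h i - t)"
      using hpos[of i] by (simp add: pos_divide_less_eq)
    then show "\<exists>t'. t < t' \<and> t' < t + d \<and> t' \<le> \<beta> \<and> I t' \<le> I t + e * (t' - t)"
      using hpos[of i] H by (intro exI[of _ "t + h i"]) auto
  qed
  also have "I \<alpha> = 0"
  proof -
    have "Y \<alpha> x = 0" for x using start by (auto simp: Y_def Z_def lev_def max_def add.commute diff_le_eq intro: antisym)
    then show ?thesis by (simp add: I_def)
  qed
  finally have "I \<beta> \<le> 0" .
  moreover have "0 \<le> I \<beta>" unfolding I_def by (rule Bochner_Integration.integral_nonneg) simp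
  ultimately have "I \<beta> = 0" by simp
  then have "AE x in lborel. (Y \<beta> x)\<^sup>2 = 0"
    using integral_nonneg_eq_0_iff_AE[OF Ysq_int[of \<beta>]] ab by (simp add: I_def)
  then have "AE x in lborel. Y \<beta> x = 0" by simp
  then have "Y \<beta> x0 = 0"
    by (intro AE_lborel_zero_continuous Ycont) (use ab in auto)
  then have "Z \<beta> x0 - lev \<beta> \<le> 0" unfolding Y_def by simp
  then show "V x0 \<beta> \<le> V x0 \<sigma> + c + n * mass * (\<beta> - \<alpha>)"
    by (simp add: Z_def lev_def C_def)
qed

text \<open>Restricting to \<open>a \<le> p\<close> makes the notion meaningful at the initial time, too.\<close>

definition locally_comparable :: "real \<Rightarrow> bool" where
  "locally_comparable t \<longleftrightarrow> (\<exists>e>0. \<forall>p r. a \<le> p \<and> t - e < p \<and> p \<le> r \<and> r < t + e \<longrightarrow> comparison p r)"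

lemma comparison_if_locally_comparable:
  assumes "a \<le> p" "p \<le> r" "\<And>t. p \<le> t \<Longrightarrow> t \<le> r \<Longrightarrow> locally_comparable t"
  shows "comparison p r"
proof -
  have "a \<le> p \<and> p \<le> r \<longrightarrow> p \<le> p \<and> r \<le> r \<longrightarrow> comparison p r"
    using assms(2)
  proof (induction rule: Bolzano[where P = "\<lambda>p' r'. a \<le> p' \<and> p' \<le> r' \<longrightarrow> p \<le> p' \<and> r' \<le> r \<longrightarrow> comparison p' r'"])
    case (trans a' b' c')
    then show ?case using comparison_trans[of a' b' c'] by auto
  next
    case (local t)
    obtain e where e: "0 < e" "\<And>p r. a \<le> p \<Longrightarrow> t - e < p \<Longrightarrow> p \<le> r \<Longrightarrow> r < t + e \<Longrightarrow> comparison p r"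
      using assms(3)[OF local] unfolding locally_comparable_def by blast
    show ?case by (rule exI[of _ e]) (use e in auto)
  qed
  then show ?thesis using assms by simp
qed

lemma closed_regular_times: "closed {t \<in> {a..}. C11_bound n (\<lambda>x. V x t)}"
proof (cases "0 \<le> n")
  case True
  have "closed {t \<in> {a..}. \<bar>V x t - V y t\<bar> \<le> B}" for x y B
    by (intro continuous_on_closed_Collect_le continuous_intros V_time_continuous)
  moreover have "closed {t \<in> {a..}. \<bar>second_diff (\<lambda>x. V x t) x h\<bar> \<le> B}" for x h B
    unfolding second_diff_def
    by (intro continuous_on_closed_Collect_le continuous_intros V_time_continuous)
  ultimately have "closed ((\<Inter>x. \<Inter>y. {t \<in> {a..}. \<bar>V x t - V y t\<bar> \<le> n * norm (x - y)}) \<inter>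
      (\<Inter>x. \<Inter>h. {t \<in> {a..}. \<bar>second_diff (\<lambda>x. V x t) x h\<bar> \<le> n * min 1 ((norm h)\<^sup>2)}))"
    by (intro closed_Int closed_INT ballI) blast+
  also have "\<dots> = {t \<in> {a..}. C11_bound n (\<lambda>x. V x t)}"
    using True by (auto simp: C11_bound_def)
  finally show ?thesis .
qed (simp add: C11_bound_def)

text \<open>A common Lipschitz constant in $x$ turns pointwise continuity in $t$ into uniform continuity over
  the compact support.\<close>

lemma uniform_continuity_at_regular_times:
  assumes "a \<le> \<tau>" "0 < \<eta>"
  obtains \<delta> where "0 < \<delta>"
    "\<And>s x. a \<le> s \<Longrightarrow> \<bar>s - \<tau>\<bar> < \<delta> \<Longrightarrow> C11_bound n (\<lambda>x. V x s) \<Longrightarrow> V x s \<le> V x \<tau> + \<eta>"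
proof -
  have "\<exists>\<delta>>0. \<forall>s x. a \<le> s \<and> \<bar>s - \<tau>\<bar> < \<delta> \<and> C11_bound n (\<lambda>x. V x s) \<longrightarrow> V x s \<le> V x \<tau> + \<eta>"
  proof (rule ccontr)
    assume "\<not> ?thesis"
    then have "\<exists>s x. a \<le> s \<and> \<bar>s - \<tau>\<bar> < inverse (real (Suc i)) \<and> C11_bound n (\<lambda>x. V x s) \<and> V x \<tau> + \<eta> < V x s" for i
      by (metis inverse_positive_iff_positive not_le of_nat_0_less_iff zero_less_Suc)
    then obtain s x where sx: "\<And>i. a \<le> s i" "\<And>i. \<bar>s i - \<tau>\<bar> < inverse (real (Suc i))"
      "\<And>i. C11_bound n (\<lambda>x. V x (s i))" "\<And>i. V (x i) \<tau> + \<eta> < V (x i) (s i)"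
      by metis
    have "x i \<in> cball 0 R" for i
      using V_support[OF sx(1)[of i], of "x i"] V_nonneg[OF assms(1), of "x i"] sx(4)[of i] assms(2)
      by (cases "R < norm (x i)") auto
    then obtain z r where z: "strict_mono r" "(x \<circ> r) \<longlonglongrightarrow> z"
      using compact_cball[of "0::'a" R] unfolding compact_def by metis
    have "(\<lambda>i. s i - \<tau>) \<longlonglongrightarrow> 0"
      by (rule tendsto_rabs_zero_cancel, rule tendsto_sandwich[OF _ _ tendsto_const LIMSEQ_inverse_real_of_nat])
         (use sx(2) in \<open>auto intro!: always_eventually less_imp_le\<close>)
    then have "s \<longlonglongrightarrow> \<tau>" by (rule LIM_zero_cancel)
    then have s\<tau>: "(\<lambda>i. s (r i)) \<longlonglongrightarrow> \<tau>"
      using LIMSEQ_subseq_LIMSEQ[OF _ z(1)] by (simp add: o_def)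
    have xz: "(\<lambda>i. x (r i)) \<longlonglongrightarrow> z" using z(2) by (simp add: o_def)
    have lim1: "(\<lambda>i. V z (s (r i)) + n * norm (x (r i) - z)) \<longlonglongrightarrow> V z \<tau> + n * norm (z - z)"
      by (intro tendsto_intros xz continuous_on_tendsto_compose[OF V_time_continuous s\<tau>]) (use assms sx in auto)
    have lim2: "(\<lambda>i. V (x (r i)) \<tau> + \<eta>) \<longlonglongrightarrow> V z \<tau> + \<eta>"
      by (intro tendsto_intros continuous_on_tendsto_compose[OF V_space_continuous[OF assms(1)] xz]) auto
    have "V (x (r i)) \<tau> + \<eta> \<le> V z (s (r i)) + n * norm (x (r i) - z)" for i
    proof -
      have "\<bar>V (x (r i)) (s (r i)) - V z (s (r i))\<bar> \<le> n * norm (x (r i) - z)"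
        using sx(3)[of "r i"] unfolding C11_bound_def by blast
      then show ?thesis using sx(4)[of "r i"] by linarith
    qed
    then have "V z \<tau> + \<eta> \<le> V z \<tau> + n * norm (z - z)"
      by (intro LIMSEQ_le[OF lim2 lim1]) auto
    then show False using assms(2) by simp
  qed
  then show ?thesis using that by blast
qed

text \<open>The times where the claim fails form a closed set \<open>S\<close>. By Baire a nonempty portion of it carries a
  uniform $C^{1,1}$ bound. Right semicontinuity at a point of this portion is checked in two stages:
  along the portion by equicontinuity, and from its last point before \<open>t\<close> across a gap, where comparison
  holds including the left end.\<close>

lemma all_locally_comparable:
  assumes "a \<le> t"
  shows "locally_comparable t"
proof -
  define S where "S = {t \<in> {a..}. \<not> locally_comparable t}"
  have "open {t. locally_comparable t}"
    unfolding open_dist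
  proof (intro ballI)
    fix t assume "t \<in> {t. locally_comparable t}"
    then obtain e where e: "0 < e" "\<forall>p r. a \<le> p \<and> t - e < p \<and> p \<le> r \<and> r < t + e \<longrightarrow> comparison p r"
      by (auto simp: locally_comparable_def)
    have "locally_comparable s" if "dist s t < e" for s
      unfolding locally_comparable_def
    proof (intro exI conjI allI impI)
      show "0 < e - dist s t" using that by simp
      fix p r assume "a \<le> p \<and> s - (e - dist s t) < p \<and> p \<le> r \<and> r < s + (e - dist s t)"
      then have "a \<le> p \<and> t - e < p \<and> p \<le> r \<and> r < t + e" unfolding dist_real_def by linarith
      then show "comparison p r" using e(2) by blast
    qed
    then show "\<exists>e>0. \<forall>s. dist s t < e \<longrightarrow> s \<in> {t. locally_comparable t}" using e by auto
  qed
  then have "closed ({a..} \<inter> - {t. locally_comparable t})" by (intro closed_Int) auto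
  moreover have "{a..} \<inter> - {t. locally_comparable t} = S" by (auto simp: S_def)
  ultimately have "closed S" by simp
  have "S = {}"
  proof (rule ccontr)
    assume "S \<noteq> {}"
    define F where "F n = {t \<in> {a..}. C11_bound (real n) (\<lambda>x. V x t)}" for n
    have "S \<subseteq> (\<Union>n. F n)"
    proof
      fix t assume "t \<in> S"
      then have "a \<le> t" by (simp add: S_def)
      then obtain n where n: "C11_bound n (\<lambda>x. V x t)" using V_C11 by blast
      have "n \<le> real (nat \<lceil>n\<rceil>)" by linarith
      then show "t \<in> (\<Union>n. F n)" using C11_bound_mono[OF n] \<open>a \<le> t\<close> by (auto simp: F_def)
    qed
    then obtain n U where nU: "open U" "S \<inter> U \<noteq> {}" "S \<inter> U \<subseteq> F n"
      using closed_cover_portion[OF \<open>closed S\<close> \<open>S \<noteq> {}\<close>, of F] closed_regular_times unfolding F_def by metis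
    then obtain t0 where t0: "t0 \<in> S" "t0 \<in> U" by auto
    obtain e where e: "0 < e" "\<And>t. \<bar>t - t0\<bar> < e \<Longrightarrow> t \<in> U"
      using nU(1) t0(2) unfolding open_dist dist_real_def by blast
    have "comparison p q" if pq: "a \<le> p" "t0 - e < p" "p \<le> q" "q < t0 + e" for p q
    proof (rule comparison_if_forward_usc[OF pq(1,3)])
      fix \<tau> \<eta> :: real assume \<tau>: "p \<le> \<tau>" "\<tau> < q" and \<eta>: "0 < \<eta>"
      have a\<tau>: "a \<le> \<tau>" using \<tau> pq by simp
      obtain m where m: "C11_bound m (\<lambda>x. V x \<tau>)" using V_C11[OF a\<tau>] by blast
      define L where "L = m * mass + 1"
      have L: "0 < L" "m * mass \<le> L" using rate_nonneg[OF m] by (auto simp: L_def)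
      show "\<exists>\<delta>>0. \<forall>t x. \<tau> < t \<and> t < \<tau> + \<delta> \<and> t \<le> q \<longrightarrow> V x t \<le> V x \<tau> + \<eta>"
      proof (cases "locally_comparable \<tau>")
        case True
        then obtain d where d: "0 < d" "\<And>p r. a \<le> p \<Longrightarrow> \<tau> - d < p \<Longrightarrow> p \<le> r \<Longrightarrow> r < \<tau> + d \<Longrightarrow> comparison p r"
          unfolding locally_comparable_def by blast
        have "V x t \<le> V x \<tau> + \<eta>" if t: "\<tau> < t" "t < \<tau> + min d (\<eta> / L)" for t x
        proof -
          have "V x t \<le> V x \<tau> + 0 + m * mass * (t - \<tau>)"
            by (rule comparisonD[OF d(2) a\<tau> m]) (use t a\<tau> d in auto)
          also have "m * mass * (t - \<tau>) \<le> L * (\<eta> / L)"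
            using t L by (intro mult_mono) auto
          finally show ?thesis using L by simp
        qed
        then show ?thesis using d \<eta> L by (intro exI[of _ "min d (\<eta> / L)"]) auto
      next
        case False
        obtain d where d: "0 < d" "\<And>s x. a \<le> s \<Longrightarrow> \<bar>s - \<tau>\<bar> < d \<Longrightarrow> C11_bound (real n) (\<lambda>x. V x s) \<Longrightarrow> V x s \<le> V x \<tau> + \<eta> / 2"
          using uniform_continuity_at_regular_times[OF a\<tau>, of "\<eta> / 2" "real n"] \<eta> by auto
        have "V x t \<le> V x \<tau> + \<eta>" if t: "\<tau> < t" "t < \<tau> + min d (\<eta> / 2 / L)" "t \<le> q" for t x
        proof -
          \<comment> \<open>the last exceptional time before \<open>t\<close>; between it and \<open>t\<close> all times are unexceptional\<close>
          define A where "A = S \<inter> {\<tau>..t}"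
          define \<alpha> where "\<alpha> = Sup A"
          have "\<tau> \<in> A" using False a\<tau> t by (auto simp: A_def S_def)
          moreover have bdd: "bdd_above A" by (auto simp: A_def intro: bdd_aboveI[of _ t])
          moreover have "closed A" using \<open>closed S\<close> by (auto simp: A_def)
          ultimately have "\<alpha> \<in> A" unfolding \<alpha>_def by (intro closed_contains_Sup) auto
          then have \<alpha>: "\<alpha> \<in> S" "\<tau> \<le> \<alpha>" "\<alpha> \<le> t" by (auto simp: A_def)
          have gap: "locally_comparable s" if "\<alpha> < s" "s \<le> t" for s
          proof (rule ccontr)
            assume "\<not> locally_comparable s"
            then have "s \<in> A" using that \<alpha> a\<tau> by (auto simp: A_def S_def)
            then show False using cSup_upper[OF _ bdd] that unfolding \<alpha>_def by fastforce
          qed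
          have "\<alpha> \<in> F n" using nU(3) \<alpha> e(2)[of \<alpha>] \<tau> pq t by auto
          then have near: "V x \<alpha> \<le> V x \<tau> + \<eta> / 2" for x
            using d(2)[of \<alpha>] \<alpha> t by (auto simp: F_def)
          show ?thesis
          proof (cases "\<alpha> = t")
            case True
            then show ?thesis using near[of x] \<eta> by simp
          next
            case False
            then have "\<alpha> < t" using \<alpha> by simp
            have "comparison \<alpha> t"
              by (rule comparison_left_end[OF _ \<open>\<alpha> < t\<close>]) (use \<alpha> a\<tau> gap in \<open>auto intro!: comparison_if_locally_comparable\<close>)
            then have "V x t \<le> V x \<tau> + \<eta> / 2 + m * mass * (t - \<alpha>)"
              by (rule comparisonD[OF _ a\<tau> m]) (use near \<eta> in auto)
            also have "m * mass * (t - \<alpha>) \<le> L * (\<eta> / 2 / L)"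
              using t L \<alpha> by (intro mult_mono) auto
            finally show ?thesis using L by simp
          qed
        qed
        then show ?thesis using d \<eta> L by (intro exI[of _ "min d (\<eta> / 2 / L)"]) auto
      qed
    qed
    then have "locally_comparable t0" unfolding locally_comparable_def using e(1) by blast
    then show False using t0 by (simp add: S_def)
  qed
  then show ?thesis using assms by (auto simp: S_def)
qed

text \<open>The initial slice is a barrier of rate \<open>0\<close>.\<close>

theorem V_vanishes:
  assumes "a \<le> t"
  shows "V x t = 0"
proof -
  have "comparison a t" using assms by (intro comparison_if_locally_comparable all_locally_comparable) auto
  moreover have "C11_bound 0 (\<lambda>x. V x a)" by (simp add: C11_bound_def second_diff_def V_init)
  ultimately have "V x t \<le> V x a + 0 + 0 * mass * (t - a)"
    by (intro comparisonD[where \<sigma> = a]) auto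
  then show ?thesis using V_nonneg[OF assms, of x] V_init[of x] by simp
qed

end

section \<open>Affine changes of variables for Lebesgue measure\<close>

lemma lebesgue_integral_affine:
  fixes f :: "'a::euclidean_space \<Rightarrow> real" and c :: "'a \<Rightarrow> real" and t :: 'a
  defines "T x \<equiv> t + (\<Sum>j\<in>Basis. (c j * (x \<bullet> j)) *\<^sub>R j)"
  assumes c: "\<And>j. j \<in> Basis \<Longrightarrow> c j \<noteq> 0" and f [measurable]: "f \<in> borel_measurable lebesgue"
  shows "(\<lambda>x. f (T x)) \<in> borel_measurable lebesgue"
    and "integrable lebesgue (\<lambda>x. f (T x)) \<longleftrightarrow> integrable lebesgue f"
    and "integral\<^sup>L lebesgue f = (\<Prod>j\<in>Basis. \<bar>c j\<bar>) * integral\<^sup>L lebesgue (\<lambda>x. f (T x))"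
proof -
  define P where "P = (\<Prod>j\<in>Basis. \<bar>c j\<bar>)"
  have P: "P \<noteq> 0" "0 \<le> P" using c by (auto simp: P_def intro: prod_nonneg)
  have T [measurable]: "T \<in> lebesgue \<rightarrow>\<^sub>M lebesgue"
    unfolding T_def[abs_def] using c by (rule lebesgue_affine_measurable)
  show "(\<lambda>x. f (T x)) \<in> borel_measurable lebesgue" by measurable
  have eq: "lebesgue = density (distr lebesgue lebesgue T) (\<lambda>_. ennreal P)"
    unfolding T_def[abs_def] P_def using c by (rule lebesgue_affine_euclidean)
  have "integrable lebesgue f \<longleftrightarrow> integrable (density (distr lebesgue lebesgue T) (\<lambda>_. ennreal P)) f"
    using arg_cong[OF eq, of "\<lambda>M. integrable M f"] .
  also have "\<dots> \<longleftrightarrow> integrable (distr lebesgue lebesgue T) (\<lambda>x. P * f x)"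
    using P by (subst integrable_density) auto
  also have "\<dots> \<longleftrightarrow> integrable lebesgue (\<lambda>x. P * f (T x))"
    by (subst integrable_distr_eq) auto
  also have "\<dots> \<longleftrightarrow> integrable lebesgue (\<lambda>x. f (T x))"
    using P by simp
  finally show "integrable lebesgue (\<lambda>x. f (T x)) \<longleftrightarrow> integrable lebesgue f" by simp
  have "integral\<^sup>L lebesgue f = integral\<^sup>L (density (distr lebesgue lebesgue T) (\<lambda>_. ennreal P)) f"
    using arg_cong[OF eq, of "\<lambda>M. integral\<^sup>L M f"] .
  also have "\<dots> = integral\<^sup>L (distr lebesgue lebesgue T) (\<lambda>x. P * f x)"
    using P by (subst integral_density) auto
  also have "\<dots> = integral\<^sup>L lebesgue (\<lambda>x. P * f (T x))"
    by (subst integral_distr) auto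
  finally show "integral\<^sup>L lebesgue f = (\<Prod>j\<in>Basis. \<bar>c j\<bar>) * integral\<^sup>L lebesgue (\<lambda>x. f (T x))"
    by (simp add: P_def)
qed

lemma scaleR_as_sum: "c *\<^sub>R x = (\<Sum>j\<in>Basis. (c * (x \<bullet> j)) *\<^sub>R j)" for x :: "'a::euclidean_space"
  unfolding scaleR_scaleR[symmetric] scaleR_sum_right[symmetric] euclidean_representation ..

lemma lebesgue_integral_shift_scale:
  fixes f :: "'a::euclidean_space \<Rightarrow> real"
  assumes "f \<in> borel_measurable lebesgue" "c \<noteq> 0"
  shows "(\<lambda>x. f (t + c *\<^sub>R x)) \<in> borel_measurable lebesgue"
    and "integrable lebesgue (\<lambda>x. f (t + c *\<^sub>R x)) \<longleftrightarrow> integrable lebesgue f"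
    and "integral\<^sup>L lebesgue f = \<bar>c\<bar> ^ DIM('a) * integral\<^sup>L lebesgue (\<lambda>x. f (t + c *\<^sub>R x))"
  using lebesgue_integral_affine[of "\<lambda>_. c" f t] assms unfolding scaleR_as_sum[symmetric] by auto

lemma lebesgue_integral_uminus:
  fixes f :: "'a::euclidean_space \<Rightarrow> real"
  assumes "f \<in> borel_measurable lebesgue"
  shows "(\<lambda>x. f (- x)) \<in> borel_measurable lebesgue"
    and "integrable lebesgue (\<lambda>x. f (- x)) \<longleftrightarrow> integrable lebesgue f"
    and "integral\<^sup>L lebesgue (\<lambda>x. f (- x)) = integral\<^sup>L lebesgue f"
  using lebesgue_integral_shift_scale[OF assms, of "-1" 0] by auto

lemma lebesgue_integral_translation:
  fixes f :: "'a::euclidean_space \<Rightarrow> real"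
  assumes "f \<in> borel_measurable lebesgue"
  shows "(\<lambda>x. f (t + x)) \<in> borel_measurable lebesgue"
    and "integrable lebesgue (\<lambda>x. f (t + x)) \<longleftrightarrow> integrable lebesgue f"
    and "integral\<^sup>L lebesgue (\<lambda>x. f (t + x)) = integral\<^sup>L lebesgue f"
  using lebesgue_integral_shift_scale[OF assms, of 1 t] by auto

text \<open>This diagonal form gives access to the change of variables formula.\<close>

lemma plane_reflection_as_sum:
  fixes x :: "real ^ 'n::finite"
  shows "plane_reflection k d x = axis k (2 * d) + (\<Sum>j\<in>Basis. ((if j = axis k 1 then - 1 else 1) * (x \<bullet> j)) *\<^sub>R j)"
proof (rule euclidean_eqI)
  fix b :: "real ^ 'n" assume b: "b \<in> Basis"
  then obtain i where i: "b = axis i 1" by (auto simp: Basis_vec_def)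
  have "(\<Sum>j\<in>Basis. ((if j = axis k 1 then - 1 else 1) * (x \<bullet> j)) *\<^sub>R j) \<bullet> b = (if b = axis k 1 then - 1 else 1) * (x \<bullet> b)"
    using b by (simp add: inner_sum_left inner_Basis if_distrib sum.delta cong: if_cong)
  moreover have "plane_reflection k d x \<bullet> b = plane_reflection k d x $ i" "x \<bullet> b = x $ i"
     "axis k (2 * d) \<bullet> b = (if i = k then 2 * d else 0)" "(b = axis k 1) = (i = k)"
    unfolding i inner_axis axis_eq_axis by (auto simp: axis_def)
  ultimately show "plane_reflection k d x \<bullet> b = (axis k (2 * d) + (\<Sum>j\<in>Basis. ((if j = axis k 1 then - 1 else 1) * (x \<bullet> j)) *\<^sub>R j)) \<bullet> b"
    by (simp add: inner_add_left plane_reflection_def)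
qed

lemma lebesgue_integral_plane_reflection:
  fixes f :: "real ^ 'n::finite \<Rightarrow> real"
  assumes "f \<in> borel_measurable lebesgue"
  shows "(\<lambda>x. f (plane_reflection k d x)) \<in> borel_measurable lebesgue"
    and "integrable lebesgue (\<lambda>x. f (plane_reflection k d x)) \<longleftrightarrow> integrable lebesgue f"
    and "integral\<^sup>L lebesgue (\<lambda>x. f (plane_reflection k d x)) = integral\<^sup>L lebesgue f"
proof -
  have 1: "(\<Prod>j\<in>Basis. \<bar>if j = axis k 1 then - 1 else 1\<bar> :: real) = 1"
    by (rule prod.neutral) auto
  show "(\<lambda>x. f (plane_reflection k d x)) \<in> borel_measurable lebesgue"
    and "integrable lebesgue (\<lambda>x. f (plane_reflection k d x)) \<longleftrightarrow> integrable lebesgue f"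
    and "integral\<^sup>L lebesgue (\<lambda>x. f (plane_reflection k d x)) = integral\<^sup>L lebesgue f"
    using lebesgue_integral_affine[of "\<lambda>j. if j = axis k 1 then - 1 else 1" f "axis k (2 * d)"] assms 1
    unfolding plane_reflection_as_sum[symmetric] by auto
qed

section \<open>The kernel of the fractional Laplacian\<close>

definition frac_kernel :: "real \<Rightarrow> 'a::euclidean_space \<Rightarrow> real" where
  "frac_kernel s h = 1 / norm h powr (real DIM('a) + 2 * s)"

lemma frac_kernel_nonneg: "0 \<le> frac_kernel s h"
  by (simp add: frac_kernel_def)

lemma frac_kernel_minus: "frac_kernel s (- h) = frac_kernel s h"
  by (simp add: frac_kernel_def)

lemma frac_kernel_measurable [measurable]: "frac_kernel s \<in> borel_measurable borel"
  unfolding frac_kernel_def by measurable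

lemma frac_kernel_scale:
  fixes h :: "'a::euclidean_space"
  assumes "0 < d"
  shows "d ^ DIM('a) * frac_kernel s (d *\<^sub>R h) = d powr (- 2 * s) * frac_kernel s h"
proof -
  have "d ^ DIM('a) / d powr (real DIM('a) + 2 * s) = d powr (real DIM('a) - (real DIM('a) + 2 * s))"
    unfolding powr_diff using powr_realpow[OF assms, of "DIM('a)"] by simp
  then have *: "d ^ DIM('a) / d powr (real DIM('a) + 2 * s) = d powr (- 2 * s)" by simp
  have "d ^ DIM('a) * frac_kernel s (d *\<^sub>R h) = (d ^ DIM('a) / d powr (real DIM('a) + 2 * s)) * frac_kernel s h"
    using assms by (simp add: frac_kernel_def powr_mult)
  then show ?thesis using * by simp
qed

text \<open>With $p = N + 2s$, the kernel is at most $2^{-jp}$ on the shell $2^j \le |h| \le 2^{j+1}$, and the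
  integrand is at most $4^{-j}2^{(j+1)p}$ on the shell $2^{-j-1} \le |h| \le 2^{-j}$. Each shell is
  enlarged to the ball bounded by its outer sphere. Both families of bounds then have geometric
  integrals, with ratios $2^{-2s}$ and $2^{2s-2}$.\<close>

lemma integrable_frac_kernel_min:
  fixes s :: real
  assumes s: "0 < s" "s < 1"
  shows "integrable lborel (\<lambda>h::'a::euclidean_space. min 1 ((norm h)\<^sup>2) * frac_kernel s h)"
proof -
  define N where "N = DIM('a)"
  define p where "p = real N + 2 * s"
  have p: "0 < p" using s by (simp add: p_def N_def)
  define A where "A j = 2 powr (- (real j * p))" for j :: nat
  define B where "B j = (2 powr (- real j))\<^sup>2 * 2 powr ((real j + 1) * p)" for j :: nat
  define f where "f h = min 1 ((norm h)\<^sup>2) * frac_kernel s h" for h :: 'a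
  define gA where "gA j h = ennreal (A j) * indicator (cball (0::'a) (2 powr (real j + 1))) h" for j h
  define gB where "gB j h = ennreal (B j) * indicator (cball (0::'a) (2 powr (- real j))) h" for j h
  have fm: "f \<in> borel_measurable lborel"
    unfolding f_def by measurable
  have [measurable]: "gA j \<in> borel_measurable lborel" "gB j \<in> borel_measurable lborel" for j
    unfolding gA_def gB_def by (auto intro!: borel_measurable_times_ennreal borel_measurable_indicator)
  have f0: "0 \<le> f h" for h by (simp add: f_def frac_kernel_nonneg)
  have frac: "frac_kernel s h = 1 / norm h powr p" for h :: 'a
    by (simp add: frac_kernel_def p_def N_def)
  have big: "ennreal (f h) \<le> (\<Sum>j. gA j h)" if h: "1 \<le> norm h" for h
  proof -
    define j where "j = nat \<lfloor>log 2 (norm h)\<rfloor>"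
    have "0 < norm h" using h by linarith
    then have "0 \<le> log 2 (norm h)" using h by simp
    then have j: "real j \<le> log 2 (norm h)" "log 2 (norm h) < real j + 1" unfolding j_def by linarith+
    have "2 powr (real j) \<le> norm h" using j(1) h by (subst (asm) le_log_iff) auto
    then have "(2 powr real j) powr p \<le> norm h powr p" using p by (intro powr_mono2) auto
    moreover have "0 < norm h powr p * 2 powr (real j * p)" using \<open>0 < norm h\<close> by simp
    ultimately have "1 / norm h powr p \<le> 1 / 2 powr (real j * p)" 
      using h by (intro divide_left_mono) (auto simp: powr_powr)
    then have "f h \<le> A j"
      using h unfolding f_def A_def frac powr_minus_divide by (simp add: min_absorb1 one_le_power)
    moreover have "norm h \<le> 2 powr (real j + 1)" using j(2) h by (subst (asm) log_less_iff) auto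
    ultimately have "ennreal (f h) \<le> gA j h" by (simp add: gA_def indicator_def ennreal_leI)
    also have "\<dots> \<le> (\<Sum>j. gA j h)" using sum_le_suminf[of "\<lambda>j. gA j h" "{j}"] by simp
    finally show ?thesis .
  qed
  have small: "ennreal (f h) \<le> (\<Sum>j. gB j h)" if h: "norm h < 1" "h \<noteq> 0" for h
  proof -
    define j where "j = nat \<lfloor>- log 2 (norm h)\<rfloor>"
    have "0 \<le> - log 2 (norm h)" using h by simp
    then have j: "real j \<le> - log 2 (norm h)" "- log 2 (norm h) < real j + 1" unfolding j_def by linarith+
    then have j': "log 2 (norm h) \<le> - real j" "- (real j + 1) < log 2 (norm h)" by linarith+
    have up: "norm h \<le> 2 powr (- real j)" using j'(1) h by (subst (asm) log_le_iff) auto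
    have "2 powr (- (real j + 1)) \<le> norm h" using j'(2) h by (subst (asm) less_log_iff) auto
    then have "(2 powr (- (real j + 1))) powr p \<le> norm h powr p" using p by (intro powr_mono2) auto
    then have "2 powr (- ((real j + 1) * p)) \<le> norm h powr p"
      unfolding powr_powr minus_mult_left .
    then have "1 / norm h powr p \<le> 1 / 2 powr (- ((real j + 1) * p))" 
      using h by (intro divide_left_mono) auto
    also have "\<dots> = 2 powr ((real j + 1) * p)" by (simp add: powr_minus_divide)
    finally have k: "frac_kernel s h \<le> 2 powr ((real j + 1) * p)" by (simp add: frac)
    have "f h \<le> (2 powr (- real j))\<^sup>2 * 2 powr ((real j + 1) * p)"
      unfolding f_def using k up frac_kernel_nonneg
      by (intro mult_mono) (auto intro!: min.coboundedI2 power_mono)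
    then have "ennreal (f h) \<le> gB j h" using up by (simp add: gB_def indicator_def ennreal_leI B_def)
    also have "\<dots> \<le> (\<Sum>j. gB j h)" using sum_le_suminf[of "\<lambda>j. gB j h" "{j}"] by simp
    finally show ?thesis .
  qed
  have "(\<integral>\<^sup>+h. ennreal (f h) \<partial>lborel) \<le> (\<integral>\<^sup>+h. (\<Sum>j. gA j h) + (\<Sum>j. gB j h) \<partial>lborel)"
  proof (rule nn_integral_mono)
    fix h :: 'a
    show "ennreal (f h) \<le> (\<Sum>j. gA j h) + (\<Sum>j. gB j h)"
    proof (cases "h = 0")
      case False
      then show ?thesis
        using big[of h] small[of h] by (cases "1 \<le> norm h") (auto intro: add_increasing add_increasing2)
    qed (simp add: f_def)
  qed
  also have "\<dots> = (\<Sum>j. \<integral>\<^sup>+h. gA j h \<partial>lborel) + (\<Sum>j. \<integral>\<^sup>+h. gB j h \<partial>lborel)"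
    by (simp add: nn_integral_add nn_integral_suminf)
  also have "\<dots> < \<infinity>"
  proof -
    define \<omega> where "\<omega> = unit_ball_vol (real N)"
    have \<omega>: "0 \<le> \<omega>" by (simp add: \<omega>_def)
    have pw: "2 powr (real j * c) = (2 powr c) ^ j" for j c
      by (subst powr_realpow[symmetric], simp, subst powr_powr, simp only: mult.commute)
    have IA: "(\<integral>\<^sup>+h. gA j h \<partial>lborel) = ennreal (\<omega> * 2 ^ N * (2 powr (- 2 * s)) ^ j)" for j
    proof -
      have "(\<integral>\<^sup>+h. gA j h \<partial>lborel) = ennreal (A j) * ennreal (\<omega> * (2 powr (real j + 1)) ^ N)"
        unfolding gA_def by (subst nn_integral_cmult_indicator) (auto simp: emeasure_cball \<omega>_def N_def)
      also have "\<dots> = ennreal (A j * (\<omega> * (2 powr (real j + 1)) ^ N))"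
        by (rule ennreal_mult'[symmetric]) (simp add: A_def)
      also have "A j * (\<omega> * (2 powr (real j + 1)) ^ N) = \<omega> * (2 powr (- (real j * p)) * 2 powr ((real j + 1) * real N))"
        using pw[of N "real j + 1"] by (simp add: A_def mult.commute)
      also have "2 powr (- (real j * p)) * 2 powr ((real j + 1) * real N) = 2 powr (real N + real j * (- 2 * s))"
        by (simp add: powr_add[symmetric] p_def algebra_simps)
      also have "\<dots> = 2 ^ N * (2 powr (- 2 * s)) ^ j"
        unfolding powr_add pw using powr_realpow[of 2 N] by simp
      finally show ?thesis by (simp add: mult.assoc)
    qed
    have IB: "(\<integral>\<^sup>+h. gB j h \<partial>lborel) = ennreal (\<omega> * 2 powr p * (2 powr (2 * s - 2)) ^ j)" for j
    proof -
      have "(\<integral>\<^sup>+h. gB j h \<partial>lborel) = ennreal (B j) * ennreal (\<omega> * (2 powr (- real j)) ^ N)"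
        unfolding gB_def by (subst nn_integral_cmult_indicator) (auto simp: emeasure_cball \<omega>_def N_def)
      also have "\<dots> = ennreal (B j * (\<omega> * (2 powr (- real j)) ^ N))"
        by (rule ennreal_mult'[symmetric]) (simp add: B_def)
      also have "B j * (\<omega> * (2 powr (- real j)) ^ N) = \<omega> * (2 powr (- real j * 2) * 2 powr ((real j + 1) * p) * 2 powr (- real j * real N))"
        using pw[of N "- real j"] pw[of 2 "- real j"] by (simp add: B_def mult.commute)
      also have "2 powr (- real j * 2) * 2 powr ((real j + 1) * p) * 2 powr (- real j * real N) = 2 powr (p + real j * (2 * s - 2))"
        by (simp add: powr_add[symmetric] p_def algebra_simps)
      also have "\<dots> = 2 powr p * (2 powr (2 * s - 2)) ^ j"
        unfolding powr_add pw ..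
      finally show ?thesis by (simp add: mult.assoc)
    qed
    have q: "2 powr (- 2 * s) < 1" "2 powr (2 * s - 2) < 1"
      using s powr_less_cancel_iff[of 2 "- 2 * s" 0] powr_less_cancel_iff[of 2 "2 * s - 2" 0] by auto
    have "(\<Sum>j. \<integral>\<^sup>+h. gA j h \<partial>lborel) \<noteq> top"
      unfolding IA using \<omega> q by (intro ennreal_suminf_neq_top summable_mult summable_geometric) auto
    moreover have "(\<Sum>j. \<integral>\<^sup>+h. gB j h \<partial>lborel) \<noteq> top"
      unfolding IB using \<omega> q by (intro ennreal_suminf_neq_top summable_mult summable_geometric) auto
    ultimately show ?thesis by (simp add: less_top)
  qed
  finally have "(\<integral>\<^sup>+h. ennreal (norm (f h)) \<partial>lborel) < \<infinity>" using f0 by simp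
  then have "integrable lborel f"
    unfolding integrable_iff_bounded using fm by simp
  then show ?thesis unfolding f_def[abs_def] .
qed

section \<open>Local regularity\<close>

definition C11_near :: "'a::real_normed_vector set \<Rightarrow> real \<Rightarrow> real \<Rightarrow> ('a \<Rightarrow> real) \<Rightarrow> 'a \<Rightarrow> bool" where
  "C11_near \<Omega> \<rho> G u x \<longleftrightarrow> (\<forall>h. norm h \<le> \<rho> \<longrightarrow> x + h \<in> \<Omega> \<and>
     \<bar>u (x + h) - u x\<bar> \<le> G * norm h \<and> \<bar>second_diff u x h\<bar> \<le> G * (norm h)\<^sup>2)"

text \<open>In this form the property transfers to squares of positive parts without differentiating them.\<close>

definition locally_C11 :: "'a::real_normed_vector set \<Rightarrow> ('a \<Rightarrow> real) \<Rightarrow> bool" where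
  "locally_C11 \<Omega> u \<longleftrightarrow> (\<forall>K. compact K \<and> K \<subseteq> \<Omega> \<longrightarrow> (\<exists>\<rho>>0. \<exists>G\<ge>0. \<forall>x\<in>K. C11_near \<Omega> \<rho> G u x))"

lemma C11_nearD:
  assumes "C11_near \<Omega> \<rho> G u x" "norm h \<le> \<rho>"
  shows "x + h \<in> \<Omega>" "\<bar>u (x + h) - u x\<bar> \<le> G * norm h" "\<bar>second_diff u x h\<bar> \<le> G * (norm h)\<^sup>2"
  using assms unfolding C11_near_def by auto

lemma locally_C11_diff:
  assumes "locally_C11 \<Omega> u" "locally_C11 \<Omega> v"
  shows "locally_C11 \<Omega> (\<lambda>x. u x - v x)"
  unfolding locally_C11_def
proof (intro allI impI)
  fix K assume K: "compact K \<and> K \<subseteq> \<Omega>"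
  obtain \<rho> G where u: "0 < \<rho>" "0 \<le> G" "\<forall>x\<in>K. C11_near \<Omega> \<rho> G u x"
    using assms(1) K unfolding locally_C11_def by blast
  obtain \<rho>' G' where v: "0 < \<rho>'" "0 \<le> G'" "\<forall>x\<in>K. C11_near \<Omega> \<rho>' G' v x"
    using assms(2) K unfolding locally_C11_def by blast
  have "C11_near \<Omega> (min \<rho> \<rho>') (G + G') (\<lambda>x. u x - v x) x" if x: "x \<in> K" for x
    unfolding C11_near_def
  proof (intro allI impI)
    fix h :: 'a assume "norm h \<le> min \<rho> \<rho>'"
    then have h: "norm h \<le> \<rho>" "norm h \<le> \<rho>'" by auto
    have "second_diff (\<lambda>x. u x - v x) x h = second_diff u x h - second_diff v x h"
      by (simp add: second_diff_def)
    then show "x + h \<in> \<Omega> \<and> \<bar>u (x + h) - v (x + h) - (u x - v x)\<bar> \<le> (G + G') * norm h \<and>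
        \<bar>second_diff (\<lambda>x. u x - v x) x h\<bar> \<le> (G + G') * (norm h)\<^sup>2"
      using C11_nearD[OF u(3)[rule_format, OF x] h(1)] C11_nearD[OF v(3)[rule_format, OF x] h(2)]
      unfolding distrib_right by auto
  qed
  moreover have "0 < min \<rho> \<rho>'" "0 \<le> G + G'" using u(1,2) v(1,2) by auto
  ultimately show "\<exists>\<rho>>0. \<exists>G\<ge>0. \<forall>x\<in>K. C11_near \<Omega> \<rho> G (\<lambda>x. u x - v x) x" by blast
qed

lemma locally_C11_cong:
  assumes "locally_C11 \<Omega> u" "\<And>x. x \<in> \<Omega> \<Longrightarrow> u x = v x"
  shows "locally_C11 \<Omega> v"
proof -
  have "C11_near \<Omega> \<rho> G v x" if "x \<in> \<Omega>" and near: "C11_near \<Omega> \<rho> G u x" for \<rho> G x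
    unfolding C11_near_def
  proof (intro allI impI)
    fix h :: 'a assume h: "norm h \<le> \<rho>"
    have "x + h \<in> \<Omega>" "x - h \<in> \<Omega>" using C11_nearD(1)[OF near, of h] C11_nearD(1)[OF near, of "- h"] h by auto
    then show "x + h \<in> \<Omega> \<and> \<bar>v (x + h) - v x\<bar> \<le> G * norm h \<and> \<bar>second_diff v x h\<bar> \<le> G * (norm h)\<^sup>2"
      using C11_nearD[OF near h] \<open>x \<in> \<Omega>\<close> by (simp add: assms(2) second_diff_def)
  qed
  note transfer = this
  show ?thesis
    unfolding locally_C11_def
  proof (intro allI impI)
    fix K assume K: "compact K \<and> K \<subseteq> \<Omega>"
    then obtain \<rho> G where "0 < \<rho>" "0 \<le> G" "\<forall>x\<in>K. C11_near \<Omega> \<rho> G u x"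
      using assms(1) unfolding locally_C11_def by blast
    moreover from this have "\<forall>x\<in>K. C11_near \<Omega> \<rho> G v x" using transfer K by blast
    ultimately show "\<exists>\<rho>>0. \<exists>G\<ge>0. \<forall>x\<in>K. C11_near \<Omega> \<rho> G v x" by blast
  qed
qed

lemma compact_thickening:
  fixes K :: "'a::euclidean_space set"
  assumes K: "compact K" "K \<subseteq> \<Omega>" "open \<Omega>"
  shows "\<exists>e>0. compact {x + y |x y. x \<in> K \<and> y \<in> cball 0 e} \<and> {x + y |x y. x \<in> K \<and> y \<in> cball 0 e} \<subseteq> \<Omega>"
proof -
  obtain e where e: "0 < e" "(\<Union>x\<in>K. cball x e) \<subseteq> \<Omega>"
    by (rule compact_subset_open_imp_cball_epsilon_subset[OF K(1,3,2)])
  have "x + y \<in> \<Omega>" if "x \<in> K" "norm y \<le> e" for x y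
  proof -
    have "x + y \<in> cball x e" using that by (simp add: dist_norm)
    then show ?thesis using e(2) that(1) by blast
  qed
  moreover have "compact {x + y |x y. x \<in> K \<and> y \<in> cball 0 e}"
    by (intro compact_sums K compact_cball)
  ultimately show ?thesis using e(1) by (intro exI[of _ e]) auto
qed

lemma locally_C11_if_C11_loc:
  fixes u :: "real ^ 'n::finite \<Rightarrow> real"
  assumes "open \<Omega>" "u \<in> C11_loc \<Omega>"
  shows "locally_C11 \<Omega> u"
  unfolding locally_C11_def
proof (intro allI impI, elim conjE)
  fix K :: "(real ^ 'n) set" assume K: "compact K" "K \<subseteq> \<Omega>"
  obtain g where g: "\<And>x. x \<in> \<Omega> \<Longrightarrow> GDERIV u x :> g x"
    and lip: "\<And>K. compact K \<Longrightarrow> K \<subseteq> \<Omega> \<Longrightarrow> \<exists>L. L-lipschitz_on K g"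
    using assms(2) unfolding C11_loc_def by blast
  obtain e K' where e: "0 < e" and K'_def: "K' = {x + y |x y. x \<in> K \<and> y \<in> cball 0 e}"
    and K': "compact K'" "K' \<subseteq> \<Omega>"
    using compact_thickening[OF K assms(1)] by blast
  have inK': "x + h \<in> K'" if "x \<in> K" "norm h \<le> e" for x h
    using that by (auto simp: K'_def)
  obtain L where L: "L-lipschitz_on K' g" using lip[OF K'] by blast
  have "continuous_on K' g" using L by (rule lipschitz_on_continuous_on)
  then have "bounded (g ` K')" using K' compact_continuous_image compact_imp_bounded by blast
  then obtain G0 where "\<forall>y\<in>g ` K'. norm y \<le> G0" unfolding bounded_iff by blast
  then have G0: "norm (g x) \<le> max 0 G0" if "x \<in> K'" for x using that by (auto simp: le_max_iff_disj)
  define G where "G = max 0 G0 + 2 * L"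
  have L0: "0 \<le> L" using L by (rule lipschitz_on_nonneg)
  have "C11_near \<Omega> e G u x" if x: "x \<in> K" for x
    unfolding C11_near_def
  proof (intro allI impI)
    fix h :: "real ^ 'n" assume h: "norm h \<le> e"
    have seg: "x + \<tau> *\<^sub>R h \<in> K'" if "\<bar>\<tau>\<bar> \<le> 1" for \<tau>
    proof -
      have "\<bar>\<tau>\<bar> * norm h \<le> 1 * e" using that h by (intro mult_mono) auto
      then show ?thesis using inK'[OF x, of "\<tau> *\<^sub>R h"] by simp
    qed
    have deriv: "((\<lambda>\<tau>. u (x + \<tau> *\<^sub>R h)) has_real_derivative (h \<bullet> g (x + \<tau> *\<^sub>R h))) (at \<tau>)" if "\<bar>\<tau>\<bar> \<le> 1" for \<tau>
    proof -
      have "GDERIV u (x + \<tau> *\<^sub>R h) :> g (x + \<tau> *\<^sub>R h)" using g seg[OF that] K' by blast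
      then have "(u has_derivative (\<lambda>v. v \<bullet> g (x + \<tau> *\<^sub>R h))) (at (x + \<tau> *\<^sub>R h))"
        by (simp add: gderiv_def)
      moreover have "((\<lambda>\<tau>. x + \<tau> *\<^sub>R h) has_derivative (\<lambda>t. t *\<^sub>R h)) (at \<tau>)"
        by (auto intro!: derivative_eq_intros)
      ultimately have "((\<lambda>\<tau>. u (x + \<tau> *\<^sub>R h)) has_derivative (\<lambda>t. (t *\<^sub>R h) \<bullet> g (x + \<tau> *\<^sub>R h))) (at \<tau>)"
        using has_derivative_compose by fastforce
      then show ?thesis
        unfolding has_field_derivative_def by (simp add: mult.commute[of _ "_ \<bullet> _"])
    qed
    obtain \<xi> where \<xi>: "0 < \<xi>" "\<xi> < 1" "u (x + 1 *\<^sub>R h) - u (x + 0 *\<^sub>R h) = (1 - 0) * (h \<bullet> g (x + \<xi> *\<^sub>R h))"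
      using MVT2[of 0 1 "\<lambda>\<tau>. u (x + \<tau> *\<^sub>R h)" "\<lambda>\<tau>. h \<bullet> g (x + \<tau> *\<^sub>R h)"] deriv by auto
    obtain \<zeta> where \<zeta>: "- 1 < \<zeta>" "\<zeta> < 0" "u (x + 0 *\<^sub>R h) - u (x + (- 1) *\<^sub>R h) = (0 - - 1) * (h \<bullet> g (x + \<zeta> *\<^sub>R h))"
      using MVT2[of "-1" 0 "\<lambda>\<tau>. u (x + \<tau> *\<^sub>R h)" "\<lambda>\<tau>. h \<bullet> g (x + \<tau> *\<^sub>R h)"] deriv by auto
    have 1: "\<bar>u (x + h) - u x\<bar> \<le> G * norm h"
    proof -
      have "\<bar>u (x + h) - u x\<bar> \<le> norm h * norm (g (x + \<xi> *\<^sub>R h))"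
        using \<xi>(3) Cauchy_Schwarz_ineq2[of h "g (x + \<xi> *\<^sub>R h)"] by simp
      also have "\<dots> \<le> norm h * G"
        using G0[OF seg, of \<xi>] \<xi> L0 by (intro mult_left_mono) (auto simp: G_def)
      finally show ?thesis by (simp add: mult.commute)
    qed
    have 2: "\<bar>second_diff u x h\<bar> \<le> G * (norm h)\<^sup>2"
    proof -
      have "second_diff u x h = h \<bullet> (g (x + \<zeta> *\<^sub>R h) - g (x + \<xi> *\<^sub>R h))"
        using \<xi>(3) \<zeta>(3) by (simp add: second_diff_def inner_diff_right)
      then have "\<bar>second_diff u x h\<bar> \<le> norm h * norm (g (x + \<zeta> *\<^sub>R h) - g (x + \<xi> *\<^sub>R h))"
        using Cauchy_Schwarz_ineq2 by simp
      also have "norm (g (x + \<zeta> *\<^sub>R h) - g (x + \<xi> *\<^sub>R h)) \<le> L * norm ((\<zeta> - \<xi>) *\<^sub>R h)"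
        using lipschitz_onD[OF L seg seg, of \<zeta> \<xi>] \<xi> \<zeta> by (simp add: dist_norm algebra_simps)
      also have "\<dots> \<le> L * (2 * norm h)"
        using L0 \<xi> \<zeta> by (intro mult_left_mono) (auto intro!: mult_right_mono)
      finally have "\<bar>second_diff u x h\<bar> \<le> norm h * (L * (2 * norm h))" by (simp add: mult_left_mono)
      also have "\<dots> = 2 * L * (norm h)\<^sup>2" by (simp add: power2_eq_square)
      also have "\<dots> \<le> G * (norm h)\<^sup>2" by (intro mult_right_mono) (auto simp: G_def)
      finally show ?thesis .
    qed
    have "x + h \<in> \<Omega>" using inK'[OF x h] K' by blast
    then show "x + h \<in> \<Omega> \<and> \<bar>u (x + h) - u x\<bar> \<le> G * norm h \<and> \<bar>second_diff u x h\<bar> \<le> G * (norm h)\<^sup>2"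
      using 1 2 by blast
  qed
  moreover have "0 \<le> G" using L0 by (simp add: G_def)
  ultimately show "\<exists>\<rho>>0. \<exists>G\<ge>0. \<forall>x\<in>K. C11_near \<Omega> \<rho> G u x"
    using e(1) by blast
qed

text \<open>All three follow from the tangent inequality and its quadratic counterpart for $a \mapsto (a_+)^2$.\<close>

lemma second_diff_sqr_pos_part:
  "\<bar>(max 0 b)\<^sup>2 - (max 0 a)\<^sup>2\<bar> \<le> 2 * max 0 a * \<bar>b - a\<bar> + (b - a)\<^sup>2"
  "2 * (max 0 a)\<^sup>2 - (max 0 b)\<^sup>2 - (max 0 c)\<^sup>2 \<le> 2 * max 0 a * (2 * a - b - c)"
  "2 * max 0 a * (2 * a - b - c) - (b - a)\<^sup>2 - (c - a)\<^sup>2 \<le> 2 * (max 0 a)\<^sup>2 - (max 0 b)\<^sup>2 - (max 0 c)\<^sup>2"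
  for a b c :: real
proof -
  have "2 * max 0 a * (b - a) \<le> 2 * max 0 a * \<bar>b - a\<bar>" "- (2 * max 0 a * \<bar>b - a\<bar>) \<le> 2 * max 0 a * (b - a)"
    using mult_left_mono[of "b - a" "\<bar>b - a\<bar>" "2 * max 0 a"] mult_left_mono[of "- \<bar>b - a\<bar>" "b - a" "2 * max 0 a"]
    by auto
  then show "\<bar>(max 0 b)\<^sup>2 - (max 0 a)\<^sup>2\<bar> \<le> 2 * max 0 a * \<bar>b - a\<bar> + (b - a)\<^sup>2"
    using sqr_pos_part_convex[of a b] sqr_pos_part_upper[of b a] zero_le_power2[of "b - a"]
    unfolding abs_le_iff by linarith
  have eq: "2 * max 0 a * (2 * a - b - c) = - (2 * max 0 a * (b - a)) - 2 * max 0 a * (c - a)"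
    by (simp add: algebra_simps)
  show "2 * (max 0 a)\<^sup>2 - (max 0 b)\<^sup>2 - (max 0 c)\<^sup>2 \<le> 2 * max 0 a * (2 * a - b - c)"
    unfolding eq using sqr_pos_part_convex[of a b] sqr_pos_part_convex[of a c] by linarith
  show "2 * max 0 a * (2 * a - b - c) - (b - a)\<^sup>2 - (c - a)\<^sup>2 \<le> 2 * (max 0 a)\<^sup>2 - (max 0 b)\<^sup>2 - (max 0 c)\<^sup>2"
    unfolding eq using sqr_pos_part_upper[of b a] sqr_pos_part_upper[of c a] by linarith
qed

lemma locally_C11_sqr_pos_part_bounds:
  assumes near: "C11_near \<Omega> \<rho> G u x"
    and "max 0 (u x) \<le> M" "0 \<le> G" "norm h \<le> \<rho>" "norm h \<le> 1"
  shows "\<bar>(max 0 (u (x + h)))\<^sup>2 - (max 0 (u x))\<^sup>2\<bar> \<le> (2 * M * G + 2 * G\<^sup>2) * norm h"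
    and "\<bar>second_diff (\<lambda>x. (max 0 (u x))\<^sup>2) x h\<bar> \<le> (2 * M * G + 2 * G\<^sup>2) * (norm h)\<^sup>2"
proof -
  define m where "m = max 0 (u x)"
  have m: "0 \<le> m" "m \<le> M" using assms by (auto simp: m_def)
  have lip: "\<bar>u (x + h) - u x\<bar> \<le> G * norm h" "\<bar>u (x - h) - u x\<bar> \<le> G * norm h"
    using C11_nearD(2)[OF near, of h] C11_nearD(2)[OF near, of "- h"] assms by auto
  have sq: "(u (x + h) - u x)\<^sup>2 \<le> G\<^sup>2 * (norm h)\<^sup>2" "(u (x - h) - u x)\<^sup>2 \<le> G\<^sup>2 * (norm h)\<^sup>2"
    using power_mono[OF lip(1), of 2] power_mono[OF lip(2), of 2] by (auto simp: power_mult_distrib)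
  have hh: "(norm h)\<^sup>2 \<le> norm h" using assms by (simp add: power2_eq_square mult_left_le)
  have "2 * m * \<bar>u (x + h) - u x\<bar> \<le> 2 * M * (G * norm h)"
    using m lip by (intro mult_mono) auto
  moreover have "G\<^sup>2 * (norm h)\<^sup>2 \<le> G\<^sup>2 * norm h" using hh by (intro mult_left_mono) auto
  moreover have "0 \<le> G\<^sup>2 * norm h" by simp
  ultimately have "\<bar>(max 0 (u (x + h)))\<^sup>2 - m\<^sup>2\<bar> \<le> 2 * M * (G * norm h) + 2 * (G\<^sup>2 * norm h)"
    using second_diff_sqr_pos_part(1)[of "u (x + h)" "u x"] sq(1)
    unfolding m_def[symmetric] by linarith
  then show "\<bar>(max 0 (u (x + h)))\<^sup>2 - (max 0 (u x))\<^sup>2\<bar> \<le> (2 * M * G + 2 * G\<^sup>2) * norm h"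
    unfolding m_def[symmetric] by (simp add: algebra_simps)
  have "\<bar>2 * m * second_diff u x h\<bar> \<le> 2 * M * (G * (norm h)\<^sup>2)"
    unfolding abs_mult using m C11_nearD(3)[OF near, of h] assms by (intro mult_mono) auto
  then have "\<bar>second_diff (\<lambda>x. (max 0 (u x))\<^sup>2) x h\<bar> \<le> 2 * M * (G * (norm h)\<^sup>2) + 2 * (G\<^sup>2 * (norm h)\<^sup>2)"
    using second_diff_sqr_pos_part(2)[where a = "u x" and b = "u (x + h)" and c = "u (x - h)"]
      second_diff_sqr_pos_part(3)[where a = "u x" and b = "u (x + h)" and c = "u (x - h)"] sq zero_le_power2[of "u (x + h) - u x"]
      zero_le_power2[of "u (x - h) - u x"]
    unfolding m_def[symmetric] second_diff_def by linarith
  then show "\<bar>second_diff (\<lambda>x. (max 0 (u x))\<^sup>2) x h\<bar> \<le> (2 * M * G + 2 * G\<^sup>2) * (norm h)\<^sup>2"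
    by (simp add: algebra_simps)
qed

text \<open>The square of the positive part is of class $C^{1,1}$ across its zero set, and it vanishes off \<open>K\<close>.
  So increments shorter than the distance from \<open>K\<close> to the complement of \<open>\<Omega>\<close> see only the regular
  part of \<open>u\<close> or only zeros; longer ones are handled by boundedness.\<close>

lemma C11_bound_sqr_pos_part:
  fixes u :: "'a::euclidean_space \<Rightarrow> real"
  assumes \<Omega>: "open \<Omega>" and u: "locally_C11 \<Omega> u" and K: "compact K" "K \<subseteq> \<Omega>"
    and pos: "\<And>x. x \<in> \<Omega> \<Longrightarrow> 0 < u x \<Longrightarrow> x \<in> K" and M: "\<And>x. x \<in> \<Omega> \<Longrightarrow> u x \<le> M" "0 \<le> M"
  shows "\<exists>n. C11_bound n (\<lambda>x. if x \<in> \<Omega> then (max 0 (u x))\<^sup>2 else 0)"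
proof -
  define V where "V x = (if x \<in> \<Omega> then (max 0 (u x))\<^sup>2 else 0)" for x
  obtain e K' where e: "0 < e" and K'_def: "K' = {x + y |x y. x \<in> K \<and> y \<in> cball 0 e}"
    and K': "compact K'" "K' \<subseteq> \<Omega>"
    using compact_thickening[OF K \<Omega>] by blast
  obtain \<rho> G where G: "0 < \<rho>" "0 \<le> G" "\<forall>x\<in>K'. C11_near \<Omega> \<rho> G u x"
    using u K' unfolding locally_C11_def by blast
  define r where "r = min (min \<rho> e) 1"
  have r: "0 < r" "r \<le> \<rho>" "r \<le> e" "r \<le> 1" using G e by (auto simp: r_def)
  define n1 where "n1 = 2 * M * G + 2 * G\<^sup>2"
  have n1: "0 \<le> n1" using M G by (simp add: n1_def)
  define n where "n = n1 + 4 * M\<^sup>2 / r\<^sup>2 + 2 * M\<^sup>2 / r"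
  have n: "0 \<le> n" "n1 \<le> n" "2 * M\<^sup>2 \<le> n * r" "4 * M\<^sup>2 \<le> n * r\<^sup>2"
  proof -
    show "n1 \<le> n" using r by (simp add: n_def)
    then show "0 \<le> n" using n1 by simp
    have "0 \<le> (n1 + 4 * M\<^sup>2 / r\<^sup>2) * r" "0 \<le> (n1 + 2 * M\<^sup>2 / r) * r\<^sup>2" using r n1 by auto
    then show "2 * M\<^sup>2 \<le> n * r" "4 * M\<^sup>2 \<le> n * r\<^sup>2" using r by (auto simp: n_def algebra_simps)
  qed
  have Vout: "V x = 0" if "x \<notin> K" for x
    using pos[of x] that by (cases "0 < u x") (auto simp: V_def)
  have V0: "0 \<le> V x" "V x \<le> M\<^sup>2" for x
    using M by (auto simp: V_def intro!: power_mono)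
  have near: "\<bar>V (x + h) - V x\<bar> \<le> n1 * norm h \<and> \<bar>second_diff V x h\<bar> \<le> n1 * (norm h)\<^sup>2" if h: "norm h \<le> r" for x h
  proof (cases "x \<in> K'")
    case True
    have h': "norm h \<le> \<rho>" "norm h \<le> 1" "norm (- h) \<le> \<rho>" using h r by auto
    have in\<Omega>: "x \<in> \<Omega>" "x + h \<in> \<Omega>" "x - h \<in> \<Omega>"
      using C11_nearD(1)[OF G(3)[rule_format, OF True] h'(1)] C11_nearD(1)[OF G(3)[rule_format, OF True] h'(3)] True K' by auto
    have "max 0 (u x) \<le> M" using M in\<Omega> by auto
    from locally_C11_sqr_pos_part_bounds[OF G(3)[rule_format, OF True] this G(2) h'(1,2)]
    show ?thesis using in\<Omega> by (simp add: V_def second_diff_def n1_def)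
  next
    case False
    have out: "x + v \<notin> K" if "norm v \<le> e" for v
    proof
      assume "x + v \<in> K"
      then have "x \<in> K'" unfolding K'_def mem_Collect_eq using that
        by (intro exI[of "\<lambda>z. \<exists>y. x = z + y \<and> z \<in> K \<and> y \<in> cball 0 e" "x + v"] exI[of "\<lambda>y. x = (x + v) + y \<and> x + v \<in> K \<and> y \<in> cball 0 e" "- v"]) simp
      then show False using False by simp
    qed
    have "x \<notin> K" "x + h \<notin> K" "x - h \<notin> K" using out[of 0] out[of h] out[of "- h"] h r e by auto
    then show ?thesis using Vout n1 by (simp add: second_diff_def)
  qed
  have "\<bar>V x - V y\<bar> \<le> n * norm (x - y)" for x y
  proof (cases "norm (x - y) \<le> r")
    case True
    then have "\<bar>V x - V y\<bar> \<le> n1 * norm (x - y)" using near[of "x - y" y] by simp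
    also have "\<dots> \<le> n * norm (x - y)" using n by (intro mult_right_mono) auto
    finally show ?thesis .
  next
    case False
    have "n * r \<le> n * norm (x - y)" using False n by (intro mult_left_mono) auto
    then show ?thesis using V0[of x] V0[of y] n(3) by (auto simp: abs_if)
  qed
  moreover have "\<bar>second_diff V x h\<bar> \<le> n * min 1 ((norm h)\<^sup>2)" for x h
  proof (cases "norm h \<le> r")
    case True
    then have "(norm h)\<^sup>2 \<le> 1" using r by (simp add: power_le_one)
    moreover have "n1 * (norm h)\<^sup>2 \<le> n * (norm h)\<^sup>2" using n by (intro mult_right_mono) auto
    ultimately show ?thesis using near[OF True, of x] by (simp add: min_absorb2)
  next
    case False
    have "r\<^sup>2 \<le> min 1 ((norm h)\<^sup>2)" using False r by (auto intro!: power_mono power_le_one)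
    then have "n * r\<^sup>2 \<le> n * min 1 ((norm h)\<^sup>2)" using n by (intro mult_left_mono) auto
    moreover have "\<bar>second_diff V x h\<bar> \<le> 4 * M\<^sup>2"
      using V0[of x] V0[of "x + h"] V0[of "x - h"] by (auto simp: second_diff_def abs_if)
    ultimately show ?thesis using n(4) by linarith
  qed
  ultimately have "C11_bound n V" using n by (simp add: C11_bound_def)
  then show ?thesis unfolding V_def[abs_def] by blast
qed

lemma locally_C11_layer:
  fixes \<Omega> :: "(real ^ 'n::finite) set"
  assumes \<Omega>: "open \<Omega>" "\<And>x. x \<in> \<Omega> \<Longrightarrow> x $ k < lam" and "0 < \<delta>" "0 \<le> A"
  shows "locally_C11 \<Omega> (\<lambda>x. c - A * (max 0 (1 - (lam - x $ k) / \<delta>))\<^sup>2)"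
  unfolding locally_C11_def
proof (intro allI impI, elim conjE)
  fix K assume K: "compact K" "K \<subseteq> \<Omega>"
  obtain e where e: "0 < e" "(\<Union>x\<in>K. cball x e) \<subseteq> \<Omega>"
    by (rule compact_subset_open_imp_cball_epsilon_subset[OF K(1) \<Omega>(1) K(2)])
  define u where "u x = 1 - (lam - x $ k) / \<delta>" for x :: "real ^ 'n"
  define f where "f x = (max 0 (u x))\<^sup>2" for x
  define H where "H = 2 * 1 * (1 / \<delta>) + 2 * (1 / \<delta>)\<^sup>2"
  have H: "0 \<le> H" using assms by (simp add: H_def)
  have "0 < min e 1" "0 \<le> A * H" using e(1) H assms by auto
  have "C11_near \<Omega> (min e 1) (A * H) (\<lambda>x. c - A * f x) x" if x: "x \<in> K" for x
    unfolding C11_near_def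
  proof (intro allI impI)
    fix h :: "real ^ 'n" assume h: "norm h \<le> min e 1"
    have "x + h \<in> cball x e" using h by (simp add: dist_norm)
    then have "x + h \<in> \<Omega>" using e(2) x by blast
    moreover have "x $ k < lam" using x K \<Omega>(2) by blast
    then have "(lam - x $ k) / \<delta> \<ge> 0" using \<open>0 < \<delta>\<close> by (intro divide_nonneg_pos) auto
    then have mx: "max 0 (u x) \<le> 1" by (simp add: u_def)
    have lin: "\<bar>u (x + v) - u x\<bar> \<le> 1 / \<delta> * norm v" "\<bar>second_diff u x v\<bar> \<le> 1 / \<delta> * (norm v)\<^sup>2" for v
    proof -
      have "u (x + v) - u x = v $ k / \<delta>" by (simp add: u_def diff_divide_distrib add_divide_distrib)
      then show "\<bar>u (x + v) - u x\<bar> \<le> 1 / \<delta> * norm v"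
        using component_le_norm_cart[of v k] assms by (simp add: divide_right_mono)
      have "second_diff u x v = 0" by (simp add: u_def second_diff_def diff_divide_distrib add_divide_distrib)
      then show "\<bar>second_diff u x v\<bar> \<le> 1 / \<delta> * (norm v)\<^sup>2" using assms by simp
    qed
    then have near: "C11_near UNIV 1 (1 / \<delta>) u x" unfolding C11_near_def by blast
    have b: "\<bar>f (x + h) - f x\<bar> \<le> H * norm h" "\<bar>second_diff f x h\<bar> \<le> H * (norm h)\<^sup>2"
    proof -
      have prem: "0 \<le> 1 / \<delta>" "norm h \<le> 1" "norm h \<le> 1" using assms h by auto
      note bounds = locally_C11_sqr_pos_part_bounds[OF near mx prem]
      show "\<bar>f (x + h) - f x\<bar> \<le> H * norm h" "\<bar>second_diff f x h\<bar> \<le> H * (norm h)\<^sup>2"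
        using bounds unfolding f_def[abs_def] H_def by auto
    qed
    have "\<bar>(c - A * f (x + h)) - (c - A * f x)\<bar> = A * \<bar>f (x + h) - f x\<bar>"
    proof -
      have "(c - A * f (x + h)) - (c - A * f x) = - (A * (f (x + h) - f x))" by (simp add: algebra_simps)
      then show ?thesis using assms by (simp add: abs_mult)
    qed
    moreover have "\<bar>second_diff (\<lambda>x. c - A * f x) x h\<bar> = A * \<bar>second_diff f x h\<bar>"
    proof -
      have "second_diff (\<lambda>x. c - A * f x) x h = - (A * second_diff f x h)" by (simp add: second_diff_def algebra_simps)
      then show ?thesis using assms by (simp add: abs_mult)
    qed
    moreover have "A * \<bar>f (x + h) - f x\<bar> \<le> A * (H * norm h)" "A * \<bar>second_diff f x h\<bar> \<le> A * (H * (norm h)\<^sup>2)"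
      using b assms by (auto intro: mult_left_mono)
    ultimately show "x + h \<in> \<Omega> \<and> \<bar>(c - A * f (x + h)) - (c - A * f x)\<bar> \<le> (A * H) * norm h \<and>
        \<bar>second_diff (\<lambda>x. c - A * f x) x h\<bar> \<le> (A * H) * (norm h)\<^sup>2"
      by (simp add: mult.assoc)
  qed
  then show "\<exists>\<rho>>0. \<exists>G\<ge>0. \<forall>x\<in>K. C11_near \<Omega> \<rho> G (\<lambda>x. c - A * (max 0 (1 - (lam - x $ k) / \<delta>))\<^sup>2) x"
    unfolding f_def u_def using \<open>0 < min e 1\<close> \<open>0 \<le> A * H\<close> by blast
qed

section \<open>The fractional Laplacian as an integral of second differences\<close>

abbreviation far :: "real \<Rightarrow> 'a::real_normed_vector \<Rightarrow> real" where
  "far r h \<equiv> indicator {h. r \<le> norm h} h"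

lemma frac_kernel_measurable_lebesgue [measurable]: "frac_kernel s \<in> borel_measurable lebesgue"
  by (rule measurable_completion) simp

lemma integrable_trunc_kernel:
  assumes s: "0 < s" "s < 1" and r: "0 < r"
  shows "integrable lebesgue (\<lambda>h::'a::euclidean_space. far r h * frac_kernel s h :: real)"
proof -
  have "integrable lborel (\<lambda>h::'a. far r h * frac_kernel s h :: real)"
  proof (rule Bochner_Integration.integrable_bound)
    show "integrable lborel (\<lambda>h::'a. (1 / min 1 (r\<^sup>2)) * (min 1 ((norm h)\<^sup>2) * frac_kernel s h))"
      by (intro integrable_mult_right integrable_frac_kernel_min s)
    have bound: "far r h * frac_kernel s h \<le> (1 / min 1 (r\<^sup>2)) * (min 1 ((norm h)\<^sup>2) * frac_kernel s h)" for h :: 'a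
    proof (cases "r \<le> norm h")
      case True
      have "r\<^sup>2 \<le> (norm h)\<^sup>2" using True r by (intro power_mono) auto
      then have "min 1 (r\<^sup>2) \<le> min 1 ((norm h)\<^sup>2)" by (intro min.mono) auto
      moreover have "0 < min 1 (r\<^sup>2)" using r by simp
      ultimately have "1 \<le> min 1 ((norm h)\<^sup>2) / min 1 (r\<^sup>2)" by (subst le_divide_eq_1_pos)
      then have "1 \<le> (1 / min 1 (r\<^sup>2)) * min 1 ((norm h)\<^sup>2)" by simp
      then have "1 * frac_kernel s h \<le> (1 / min 1 (r\<^sup>2)) * min 1 ((norm h)\<^sup>2) * frac_kernel s h"
        using frac_kernel_nonneg by (rule mult_right_mono)
      then show ?thesis using True by (simp add: mult.assoc)
    next
      case False
      have "0 \<le> (1 / min 1 (r\<^sup>2)) * (min 1 ((norm h)\<^sup>2) * frac_kernel s h)"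
        by (intro mult_nonneg_nonneg) (auto simp: frac_kernel_nonneg)
      then show ?thesis using False by simp
    qed
    show "AE h in lborel. norm (far r h * frac_kernel s h :: real) \<le> norm ((1 / min 1 (r\<^sup>2)) * (min 1 ((norm h)\<^sup>2) * frac_kernel s (h::'a)))"
    proof (intro AE_I2)
      fix h :: 'a
      have "0 \<le> far r h * frac_kernel s h" by (simp add: frac_kernel_nonneg)
      then have "norm (far r h * frac_kernel s h :: real) = far r h * frac_kernel s h"
        by simp
      with bound[of h] show "norm (far r h * frac_kernel s h :: real) \<le> norm ((1 / min 1 (r\<^sup>2)) * (min 1 ((norm h)\<^sup>2) * frac_kernel s h))"
        by (metis abs_ge_self order_trans real_norm_def)
    qed
  qed measurable
  then show ?thesis by (subst integrable_completion) auto
qed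

lemma L2s_space_measurable:
  fixes u :: "real ^ 'n::finite \<Rightarrow> real"
  assumes "u \<in> L2s_space s"
  shows "u \<in> borel_measurable lebesgue"
proof (rule borel_measurable_LIMSEQ_real)
  show "(\<lambda>x. indicator (cball 0 (real i)) x * u x) \<in> borel_measurable lebesgue" for i
  proof -
    have "set_integrable lebesgue (cball 0 (real i)) u" using assms by (simp add: L2s_space_def)
    then have "integrable lebesgue (\<lambda>x. indicator (cball 0 (real i)) x *\<^sub>R u x)" by (simp add: set_integrable_def)
    then show ?thesis using borel_measurable_integrable by fastforce
  qed
  show "(\<lambda>i. indicator (cball 0 (real i)) x * u x) \<longlonglongrightarrow> u x" for x
  proof (rule tendsto_eventually)
    have "\<forall>\<^sub>F i in sequentially. norm x \<le> real i"
      by (rule eventually_sequentiallyI[of "nat \<lceil>norm x\<rceil>"]) linarith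
    then show "\<forall>\<^sub>F i in sequentially. indicator (cball 0 (real i)) x * u x = u x"
      by eventually_elim (simp add: indicator_def)
  qed
qed

text \<open>On $|h| \ge r$ the kernel is comparable to the weight $1/(1+|x+h|^{N+2s})$.\<close>

lemma L2s_space_trunc_integrable:
  fixes u :: "real ^ 'n::finite \<Rightarrow> real"
  assumes u: "u \<in> L2s_space s" and s: "0 < s" and r: "0 < r"
  shows "integrable lebesgue (\<lambda>h. far r h * (u (x + h) * frac_kernel s h))"
proof -
  define p where "p = real CARD('n) + 2 * s"
  have p: "0 < p" using s by (simp add: p_def)
  have [measurable]: "u \<in> borel_measurable lebesgue" using L2s_space_measurable[OF u] .
  have um [measurable]: "(\<lambda>h. u (x + h)) \<in> borel_measurable lebesgue"
    by (rule lebesgue_integral_translation(1)) simp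
  define v where "v y = \<bar>u y\<bar> / (1 + norm y powr p)" for y
  have "integrable lebesgue v" using u by (simp add: L2s_space_def v_def[abs_def] p_def)
  then have vi: "integrable lebesgue (\<lambda>h. v (x + h))"
    by (subst lebesgue_integral_translation(2)) auto
  define B where "B = r powr (- p) + (norm x / r + 1) powr p"
  have key: "1 / norm h powr p \<le> B / (1 + norm (x + h) powr p)" if h: "r \<le> norm h" for h
  proof -
    have hp: "0 < norm h powr p" using h r by auto
    have "1 = norm h powr p * norm h powr (- p)" using hp by (simp add: powr_minus)
    also have "\<dots> \<le> norm h powr p * r powr (- p)"
      using h r p by (intro mult_left_mono powr_mono2') auto
    finally have 1: "1 \<le> norm h powr p * r powr (- p)" .
    have "norm x \<le> norm x / r * norm h"
      using h r mult_right_mono[of r "norm h" "norm x"] by (simp add: field_simps)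
    then have "norm (x + h) \<le> norm h * (norm x / r + 1)"
      using norm_triangle_ineq[of x h] by (simp add: algebra_simps)
    then have "norm (x + h) powr p \<le> (norm h * (norm x / r + 1)) powr p"
      using p by (intro powr_mono2) auto
    also have "\<dots> = norm h powr p * (norm x / r + 1) powr p"
      by (rule powr_mult)
    finally have "1 + norm (x + h) powr p \<le> norm h powr p * B"
      using 1 by (simp add: B_def algebra_simps)
    moreover have "0 < 1 + norm (x + h) powr p" by (smt (verit) powr_ge_zero)
    ultimately show ?thesis using hp by (simp add: field_simps)
  qed
  show ?thesis
  proof (rule Bochner_Integration.integrable_bound)
    show "integrable lebesgue (\<lambda>h. B * v (x + h))" using vi by simp
    show "(\<lambda>h. far r h * (u (x + h) * frac_kernel s h)) \<in> borel_measurable lebesgue"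
    proof -
      have [measurable]: "{h. r \<le> norm (h :: real^'n)} \<in> sets lebesgue" by auto
      show ?thesis by measurable
    qed
    have "\<bar>u (x + h)\<bar> * (1 / norm h powr p) \<le> B * v (x + h)" if "r \<le> norm h" for h
      using mult_left_mono[OF key[OF that], of "\<bar>u (x + h)\<bar>"] by (simp add: v_def mult.commute)
    moreover have "0 \<le> B * v y" for y by (simp add: B_def v_def add_nonneg_nonneg)
    ultimately show "AE h in lebesgue. norm (far r h * (u (x + h) * frac_kernel s h)) \<le> norm (B * v (x + h))"
      by (intro AE_I2) (auto simp: indicator_def abs_mult frac_kernel_def p_def abs_mult[symmetric] simp del: abs_mult)
  qed
qed

lemma trunc_integral_tendsto:
  fixes g :: "'a::euclidean_space \<Rightarrow> real"
  assumes g: "integrable lebesgue g" "g 0 = 0"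
  shows "((\<lambda>r. \<integral>h. far r h * g h \<partial>lebesgue) \<longlongrightarrow> (\<integral>h. g h \<partial>lebesgue)) (at_right 0)"
proof (rule tendsto_at_right_sequentially[of 0 1])
  fix S :: "nat \<Rightarrow> real" assume S: "\<And>n. 0 < S n" "S \<longlonglongrightarrow> 0"
  have [measurable]: "g \<in> borel_measurable lebesgue" using g by auto
  show "(\<lambda>n. \<integral>h. far (S n) h * g h \<partial>lebesgue) \<longlonglongrightarrow> (\<integral>h. g h \<partial>lebesgue)"
  proof (rule integral_dominated_convergence[where w = "\<lambda>h. \<bar>g h\<bar>"])
    have "{h. S n \<le> norm (h :: 'a)} \<in> sets lebesgue" for n by auto
    then show "(\<lambda>h. far (S n) h * g h) \<in> borel_measurable lebesgue" for n by measurable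
    show "AE h in lebesgue. (\<lambda>n. far (S n) h * g h) \<longlonglongrightarrow> g h"
    proof (intro AE_I2)
      fix h :: 'a
      show "(\<lambda>n. far (S n) h * g h) \<longlonglongrightarrow> g h"
      proof (cases "h = 0")
        case False
        then have "\<forall>\<^sub>F n in sequentially. S n < norm h" using order_tendstoD(2)[OF S(2), of "norm h"] by simp
        then have "\<forall>\<^sub>F n in sequentially. far (S n) h * g h = g h"
          by eventually_elim (simp add: indicator_def)
        then show ?thesis by (rule tendsto_eventually)
      qed (use g in simp)
    qed
  qed (use g in \<open>auto simp: indicator_def\<close>)
qed simp

text \<open>Average with the reflected increment $-h$.\<close>

lemma trunc_integral_symmetrize:
  fixes u k :: "'a::euclidean_space \<Rightarrow> real"
  assumes k: "\<And>h. k (- h) = k h" "integrable lebesgue (\<lambda>h. far r h * k h)"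
    and u: "integrable lebesgue (\<lambda>h. far r h * (u (x + h) * k h))"
  shows "integrable lebesgue (\<lambda>h. far r h * ((u x - u (x + h)) * k h))"
    and "integrable lebesgue (\<lambda>h. far r h * (second_diff u x h * k h))"
    and "(\<integral>h. far r h * ((u x - u (x + h)) * k h) \<partial>lebesgue) =
         (\<integral>h. far r h * (second_diff u x h * k h) \<partial>lebesgue) / 2"
proof -
  define f where "f h = far r h * ((u x - u (x + h)) * k h)" for h
  have "integrable lebesgue (\<lambda>h. u x * (far r h * k h) - far r h * (u (x + h) * k h))"
    using k(2) u by (intro Bochner_Integration.integrable_diff) auto
  also have "(\<lambda>h. u x * (far r h * k h) - far r h * (u (x + h) * k h)) = f"
    by (auto simp: f_def fun_eq_iff algebra_simps)
  finally have f: "integrable lebesgue f" .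
  then have fm: "f \<in> borel_measurable lebesgue" by auto
  have f': "integrable lebesgue (\<lambda>h. f (- h))" "(\<integral>h. f (- h) \<partial>lebesgue) = (\<integral>h. f h \<partial>lebesgue)"
    using lebesgue_integral_uminus[OF fm] f by auto
  have eq: "f h + f (- h) = far r h * (second_diff u x h * k h)" for h
    by (simp add: f_def k second_diff_def indicator_def algebra_simps)
  show "integrable lebesgue (\<lambda>h. far r h * ((u x - u (x + h)) * k h))"
    using f by (simp add: f_def[abs_def])
  show "integrable lebesgue (\<lambda>h. far r h * (second_diff u x h * k h))"
    unfolding eq[symmetric] using f f'(1) by simp
  have "(\<integral>h. f h + f (- h) \<partial>lebesgue) = 2 * (\<integral>h. f h \<partial>lebesgue)"
    using f f' by simp
  then show "(\<integral>h. far r h * ((u x - u (x + h)) * k h) \<partial>lebesgue) =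
         (\<integral>h. far r h * (second_diff u x h * k h) \<partial>lebesgue) / 2"
    unfolding eq by (simp add: f_def)
qed

text \<open>After symmetrization the truncated integrals have an integrable limit integrand, quadratic in $h$
  near the origin, so the limit defining the fractional Laplacian exists and is the full integral.\<close>

lemma frac_laplace_second_diff:
  fixes u :: "real ^ 'n::finite \<Rightarrow> real"
  assumes u: "u \<in> L2s_space s" and s: "0 < s" "s < 1"
    and reg: "0 < \<rho>" "\<And>h. norm h \<le> \<rho> \<Longrightarrow> \<bar>second_diff u x h\<bar> \<le> G * (norm h)\<^sup>2"
  shows "((\<lambda>r. \<integral>h. far r h * ((u x - u (x + h)) * frac_kernel s h) \<partial>lebesgue)
            \<longlongrightarrow> (\<integral>h. second_diff u x h * frac_kernel s h \<partial>lebesgue) / 2) (at_right 0)"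
    and "frac_laplace s u x = frac_laplace_const CARD('n) s * ((\<integral>h. second_diff u x h * frac_kernel s h \<partial>lebesgue) / 2)"
proof -
  define g where "g h = second_diff u x h * frac_kernel s h" for h
  note sym = trunc_integral_symmetrize[OF frac_kernel_minus integrable_trunc_kernel[OF s] L2s_space_trunc_integrable[OF u s(1)]]
  have [measurable]: "u \<in> borel_measurable lebesgue" using L2s_space_measurable[OF u] .
  have um [measurable]: "(\<lambda>h. u (x + h)) \<in> borel_measurable lebesgue"
    by (rule lebesgue_integral_translation(1)) simp
  have um' [measurable]: "(\<lambda>h. u (x - h)) \<in> borel_measurable lebesgue"
    using lebesgue_integral_uminus(1)[OF um] by simp
  have gm [measurable]: "g \<in> borel_measurable lebesgue"
    unfolding g_def[abs_def] second_diff_def by measurable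
  have far: "integrable lebesgue (\<lambda>h. far \<rho> h * g h)"
    unfolding g_def by (rule sym(2)[OF reg(1) reg(1)])
  have min_int: "integrable lebesgue (\<lambda>h :: real^'n. min 1 ((norm h)\<^sup>2) * frac_kernel s h)"
    by (subst integrable_completion) (use integrable_frac_kernel_min[OF s] in auto)
  have g: "integrable lebesgue g"
  proof (rule Bochner_Integration.integrable_bound[OF _ gm])
    define B where "B = \<bar>G\<bar> * max 1 (\<rho>\<^sup>2)"
    show "integrable lebesgue (\<lambda>h. B * (min 1 ((norm h)\<^sup>2) * frac_kernel s h) + \<bar>far \<rho> h * g h\<bar>)"
      using min_int far by (intro Bochner_Integration.integrable_add) auto
    have "\<bar>g h\<bar> \<le> B * (min 1 ((norm h)\<^sup>2) * frac_kernel s h) + \<bar>far \<rho> h * g h\<bar>" for h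
    proof (cases "\<rho> \<le> norm h")
      case False
      have "(norm h)\<^sup>2 \<le> max 1 (\<rho>\<^sup>2) * min 1 ((norm h)\<^sup>2)"
      proof (cases "norm h \<le> 1")
        case True
        then have "min 1 ((norm h)\<^sup>2) = (norm h)\<^sup>2" by (simp add: min_absorb2 power_le_one)
        moreover have "1 * (norm h)\<^sup>2 \<le> max 1 (\<rho>\<^sup>2) * (norm h)\<^sup>2" by (intro mult_right_mono) auto
        ultimately show ?thesis by simp
      next
        case 1: False
        then have "min 1 ((norm h)\<^sup>2) = 1" by (simp add: min_absorb1 one_le_power)
        moreover have "(norm h)\<^sup>2 \<le> \<rho>\<^sup>2" using False by (intro power_mono) auto
        ultimately show ?thesis by simp
      qed
      then have "\<bar>G\<bar> * (norm h)\<^sup>2 \<le> B * min 1 ((norm h)\<^sup>2)"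
        unfolding B_def mult.assoc by (rule mult_left_mono) simp
      moreover have "G * (norm h)\<^sup>2 \<le> \<bar>G\<bar> * (norm h)\<^sup>2" by (intro mult_right_mono) auto
      ultimately have "\<bar>second_diff u x h\<bar> \<le> B * min 1 ((norm h)\<^sup>2)"
        using reg(2)[of h] False by linarith
      then have "\<bar>second_diff u x h\<bar> * frac_kernel s h \<le> B * min 1 ((norm h)\<^sup>2) * frac_kernel s h"
        by (rule mult_right_mono) (rule frac_kernel_nonneg)
      then show ?thesis using False by (simp add: g_def abs_mult frac_kernel_nonneg mult.assoc)
    next
      case True
      have "0 \<le> B * (min 1 ((norm h)\<^sup>2) * frac_kernel s h)" by (simp add: B_def frac_kernel_nonneg)
      then show ?thesis using True by simp
    qed
    then show "AE h in lebesgue. norm (g h) \<le> norm (B * (min 1 ((norm h)\<^sup>2) * frac_kernel s h) + \<bar>far \<rho> h * g h\<bar>)"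
      by (intro AE_I2) (metis abs_ge_self order_trans real_norm_def)
  qed
  have "g 0 = 0" by (simp add: g_def second_diff_def)
  then have lim: "((\<lambda>r. (\<integral>h. far r h * g h \<partial>lebesgue) / 2) \<longlongrightarrow> (\<integral>h. g h \<partial>lebesgue) / 2) (at_right 0)"
    by (intro tendsto_divide trunc_integral_tendsto[OF g] tendsto_const) auto
  have "\<forall>\<^sub>F r in at_right 0. (\<integral>h. far r h * g h \<partial>lebesgue) / 2 =
          (\<integral>h. far r h * ((u x - u (x + h)) * frac_kernel s h) \<partial>lebesgue)"
    using eventually_at_right_less[of 0] by eventually_elim (simp add: sym(3) g_def)
  from Lim_transform_eventually[OF lim this]
  show L: "((\<lambda>r. \<integral>h. far r h * ((u x - u (x + h)) * frac_kernel s h) \<partial>lebesgue)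
            \<longlongrightarrow> (\<integral>h. second_diff u x h * frac_kernel s h \<partial>lebesgue) / 2) (at_right 0)"
    unfolding g_def .
  have tr: "(LINT y:- ball x r|lebesgue. (u x - u y) / norm (x - y) powr (real CARD('n) + 2 * s)) =
        (\<integral>h. far r h * ((u x - u (x + h)) * frac_kernel s h) \<partial>lebesgue)" for r
  proof -
    define f where "f y = indicator (- ball x r) y * ((u x - u y) * frac_kernel s (x - y))" for y
    have [measurable]: "(\<lambda>y. frac_kernel s (x - y)) \<in> borel_measurable (lebesgue :: (real^'n) measure)"
      by (rule measurable_completion) (auto simp: frac_kernel_def)
    have "f \<in> borel_measurable lebesgue"
      unfolding f_def[abs_def] by (intro borel_measurable_times borel_measurable_diff borel_measurable_indicator) auto
    then have "(\<integral>y. f y \<partial>lebesgue) = (\<integral>h. f (x + h) \<partial>lebesgue)"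
      by (rule lebesgue_integral_translation(3)[symmetric])
    moreover have "f (x + h) = far r h * ((u x - u (x + h)) * frac_kernel s h)" for h
      using frac_kernel_minus[of s h] by (simp add: f_def indicator_def dist_norm not_less)
    moreover have "(LINT y:- ball x r|lebesgue. (u x - u y) / norm (x - y) powr (real CARD('n) + 2 * s)) = (\<integral>y. f y \<partial>lebesgue)"
      unfolding set_lebesgue_integral_def by (simp add: f_def[abs_def] frac_kernel_def)
    ultimately show ?thesis by simp
  qed
  show "frac_laplace s u x = frac_laplace_const CARD('n) s * ((\<integral>h. second_diff u x h * frac_kernel s h \<partial>lebesgue) / 2)"
    unfolding frac_laplace_def tr by (subst tendsto_Lim[OF _ L]) auto
qed

section \<open>Moment and tail of the kernel\<close>

lemma integrable_frac_kernel_min_lebesgue: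
  assumes "0 < s" "s < 1"
  shows "integrable lebesgue (\<lambda>h::'a::euclidean_space. min 1 ((norm h)\<^sup>2) * frac_kernel s h)"
  by (subst integrable_completion) (use integrable_frac_kernel_min[OF assms] in auto)

lemma sets_lebesgue_half_spaces [measurable]:
  "{h :: real ^ 'n::finite. d \<le> h $ k} \<in> sets lebesgue" "{h :: real ^ 'n. d < h $ k} \<in> sets lebesgue"
  "{h :: real ^ 'n. h $ k < d} \<in> sets lebesgue"
proof -
  have "closed {h :: real ^ 'n. d \<le> h $ k}" "open {h :: real ^ 'n. d < h $ k}" "open {h :: real ^ 'n. h $ k < d}"
    by (intro closed_Collect_le open_Collect_less continuous_intros)+
  then show "{h :: real ^ 'n::finite. d \<le> h $ k} \<in> sets lebesgue" "{h :: real ^ 'n. d < h $ k} \<in> sets lebesgue"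
    "{h :: real ^ 'n. h $ k < d} \<in> sets lebesgue"
    by (auto intro: lebesgue_openin simp: lmeasurable_iff_integrable)
qed

lemma frac_kernel_integral_scale:
  fixes f :: "'a::euclidean_space \<Rightarrow> real"
  assumes d: "0 < d" and f [measurable]: "f \<in> borel_measurable lebesgue"
  shows "(\<integral>h. f h * frac_kernel s h \<partial>lebesgue) = d powr (- 2 * s) * (\<integral>h. f (d *\<^sub>R h) * frac_kernel s h \<partial>lebesgue)"
proof -
  have "(\<lambda>h. f h * frac_kernel s h) \<in> borel_measurable lebesgue" by measurable
  from lebesgue_integral_shift_scale(3)[OF this, of d 0] d
  have "(\<integral>h. f h * frac_kernel s h \<partial>lebesgue) = (\<integral>h. d ^ DIM('a) * (f (d *\<^sub>R h) * frac_kernel s (d *\<^sub>R h)) \<partial>lebesgue)" by simp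
  also have "\<dots> = (\<integral>h. d powr (- 2 * s) * (f (d *\<^sub>R h) * frac_kernel s h) \<partial>lebesgue)"
    using frac_kernel_scale[OF d, of s] by (intro Bochner_Integration.integral_cong) (auto simp: mult.left_commute)
  finally show ?thesis by simp
qed

lemma kernel_moment_scale:
  assumes "0 < d"
  shows "(\<integral>h. min 1 ((norm (h::'a::euclidean_space) / d)\<^sup>2) * frac_kernel s h \<partial>lebesgue) =
         d powr (- 2 * s) * (\<integral>h. min 1 ((norm (h::'a))\<^sup>2) * frac_kernel s h \<partial>lebesgue)"
proof -
  have "(\<lambda>h::'a. min 1 ((norm h / d)\<^sup>2)) \<in> borel_measurable lebesgue"
    by (rule measurable_completion) measurable
  from frac_kernel_integral_scale[OF assms this, of s] show ?thesis using assms by simp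
qed

lemma kernel_tail_scale:
  fixes k :: "'n::finite"
  assumes "0 < d"
  shows "(\<integral>h. indicator {h. d \<le> h $ k} h * frac_kernel s h \<partial>lebesgue) =
         d powr (- 2 * s) * (\<integral>h. indicator {h. 1 \<le> h $ k} h * frac_kernel s (h :: real ^ 'n) \<partial>lebesgue)"
proof -
  have "indicator {h. d \<le> h $ k} (d *\<^sub>R h) = (indicator {h. 1 \<le> h $ k} h :: real)" for h :: "real ^ 'n"
    using assms by (simp add: indicator_def)
  moreover have "(\<lambda>h :: real ^ 'n. indicator {h. d \<le> h $ k} h :: real) \<in> borel_measurable lebesgue" by measurable
  ultimately show ?thesis using frac_kernel_integral_scale[OF assms, of "indicator {h. d \<le> h $ k}" s] by simp
qed

lemma kernel_tail_integrable:
  fixes k :: "'n::finite"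
  assumes s: "0 < s" "s < 1" and d: "0 < d"
  shows "integrable lebesgue (\<lambda>h :: real ^ 'n. indicator {h. d \<le> h $ k} h * frac_kernel s h :: real)"
proof (rule Bochner_Integration.integrable_bound[OF integrable_trunc_kernel[OF s d]])
  show "(\<lambda>h :: real ^ 'n. indicator {h. d \<le> h $ k} h * frac_kernel s h :: real) \<in> borel_measurable lebesgue"
    by measurable
  have "d \<le> h $ k \<Longrightarrow> d \<le> norm h" for h :: "real ^ 'n"
    using component_le_norm_cart[of h k] by simp
  then show "AE h in lebesgue. norm (indicator {h. d \<le> h $ k} h * frac_kernel s h :: real) \<le> norm (far d h * frac_kernel s (h :: real ^ 'n) :: real)"
    by (intro AE_I2) (auto simp: indicator_def)
qed

lemma kernel_tail_pos:
  fixes k :: "'n::finite"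
  assumes s: "0 < s" "s < 1"
  shows "0 < (\<integral>h. indicator {h. 1 \<le> h $ k} h * frac_kernel s (h :: real ^ 'n) \<partial>lebesgue)"
proof (rule ccontr)
  define f where "f h = indicator {h. 1 \<le> h $ k} h * frac_kernel s h" for h :: "real ^ 'n"
  assume "\<not> ?thesis"
  moreover have f0: "0 \<le> f h" for h by (simp add: f_def frac_kernel_nonneg)
  then have "0 \<le> (\<integral>h. f h \<partial>lebesgue)" by (rule Bochner_Integration.integral_nonneg)
  ultimately have "(\<integral>h. f h \<partial>lebesgue) = 0" by (simp add: f_def)
  moreover have fi: "integrable lebesgue f"
    unfolding f_def[abs_def] by (rule kernel_tail_integrable[OF s]) simp
  ultimately have "AE h in lebesgue. f h = 0"
    using integral_nonneg_eq_0_iff_AE[OF fi] f0 by simp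
  moreover have "h \<notin> {h. 1 < h $ k}" if "f h = 0" for h
  proof
    assume h: "h \<in> {h. 1 < h $ k}"
    then have "h \<noteq> 0" by auto
    then show False using that h by (simp add: f_def frac_kernel_def)
  qed
  ultimately have "AE h in lebesgue. h \<notin> {h :: real ^ 'n. 1 < h $ k}"
    by (rule eventually_mono)
  then have "{h :: real ^ 'n. 1 < h $ k} \<in> null_sets lebesgue"
    by (subst AE_iff_null_sets) auto
  then have "negligible {h :: real ^ 'n. 1 < h $ k}" by (simp add: negligible_iff_null_sets)
  moreover have "open {h :: real ^ 'n. 1 < h $ k}" by (intro open_Collect_less continuous_intros)
  moreover have "(\<chi> i. 2) \<in> {h :: real ^ 'n. 1 < h $ k}" by simp
  ultimately show False using open_not_negligible by blast
qed

section \<open>Folding along the reflection plane\<close>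

lemma plane_reflection_nth: "plane_reflection k d h $ k = 2 * d - h $ k"
  by (simp add: plane_reflection_def)

lemma norm_le_norm_plane_reflection:
  assumes "0 < d" "h $ k < d"
  shows "norm h \<le> norm (plane_reflection k d h)"
proof -
  have "\<bar>h $ i\<bar> \<le> \<bar>plane_reflection k d h $ i\<bar>" for i
    using assms by (auto simp: plane_reflection_def)
  then show ?thesis by (intro norm_le_componentwise_cart) simp
qed

text \<open>Folding maps the open half space to the complement of the closed one and misses only the plane.\<close>

lemma AE_not_on_hyperplane: "AE h in lebesgue. (h :: real ^ 'n::finite) $ k \<noteq> d"
proof -
  have "negligible {h :: real ^ 'n. h $ k = d}"
    using negligible_hyperplane[of "axis k 1 :: real ^ 'n" d] by (simp add: inner_axis' axis_eq_0_iff)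
  then have "{h :: real ^ 'n. h $ k = d} \<in> null_sets lebesgue" by (simp add: negligible_iff_null_sets)
  from AE_not_in[OF this] show ?thesis by simp
qed

lemma integral_fold_half_space:
  fixes G :: "real ^ 'n::finite \<Rightarrow> real"
  assumes G: "integrable lebesgue G"
  shows "integrable lebesgue (\<lambda>h. indicator {h. h $ k < d} h * G (plane_reflection k d h))"
    and "(\<integral>h. indicator {h. d \<le> h $ k} h * G h \<partial>lebesgue) = (\<integral>h. indicator {h. h $ k < d} h * G (plane_reflection k d h) \<partial>lebesgue)"
    and "(\<integral>h. G h \<partial>lebesgue) = (\<integral>h. indicator {h. h $ k < d} h * (G h + G (plane_reflection k d h)) \<partial>lebesgue)"
proof -
  have [measurable]: "G \<in> borel_measurable lebesgue" using G by auto
  define G' where "G' h = indicator {h. d < h $ k} h * G h" for h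
  have G'm: "G' \<in> borel_measurable lebesgue" unfolding G'_def[abs_def] by measurable
  have G'i: "integrable lebesgue G'"
    by (rule Bochner_Integration.integrable_bound[OF G G'm]) (auto simp: G'_def indicator_def)
  have refl: "G' (plane_reflection k d h) = indicator {h. h $ k < d} h * G (plane_reflection k d h)" for h
    by (simp add: G'_def indicator_def plane_reflection_nth)
  show i2: "integrable lebesgue (\<lambda>h. indicator {h. h $ k < d} h * G (plane_reflection k d h))"
    unfolding refl[symmetric] using lebesgue_integral_plane_reflection(2)[OF G'm] G'i by simp
  have "(\<integral>h. indicator {h. d \<le> h $ k} h * G h \<partial>lebesgue) = (\<integral>h. G' h \<partial>lebesgue)"
  proof (rule integral_cong_AE)
    show "(\<lambda>h. indicator {h. d \<le> h $ k} h * G h) \<in> borel_measurable lebesgue" by measurable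
    show "AE h in lebesgue. indicator {h. d \<le> h $ k} h * G h = G' h"
      using AE_not_on_hyperplane[of k d] by eventually_elim (auto simp: G'_def indicator_def)
  qed (rule G'm)
  also have "\<dots> = (\<integral>h. indicator {h. h $ k < d} h * G (plane_reflection k d h) \<partial>lebesgue)"
    unfolding refl[symmetric] by (rule lebesgue_integral_plane_reflection(3)[OF G'm, symmetric])
  finally show eq: "(\<integral>h. indicator {h. d \<le> h $ k} h * G h \<partial>lebesgue) = (\<integral>h. indicator {h. h $ k < d} h * G (plane_reflection k d h) \<partial>lebesgue)" .
  have i1: "integrable lebesgue (\<lambda>h. indicator {h. h $ k < d} h * G h)"
    by (rule Bochner_Integration.integrable_bound[OF G]) (measurable, auto simp: indicator_def)
  have i3: "integrable lebesgue (\<lambda>h. indicator {h. d \<le> h $ k} h * G h)"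
    by (rule Bochner_Integration.integrable_bound[OF G]) (measurable, auto simp: indicator_def)
  have "(\<integral>h. G h \<partial>lebesgue) = (\<integral>h. indicator {h. h $ k < d} h * G h + indicator {h. d \<le> h $ k} h * G h \<partial>lebesgue)"
    by (rule Bochner_Integration.integral_cong) (auto simp: indicator_def)
  also have "\<dots> = (\<integral>h. indicator {h. h $ k < d} h * G h \<partial>lebesgue) + (\<integral>h. indicator {h. h $ k < d} h * G (plane_reflection k d h) \<partial>lebesgue)"
    using i1 i3 eq by simp
  also have "\<dots> = (\<integral>h. indicator {h. h $ k < d} h * (G h + G (plane_reflection k d h)) \<partial>lebesgue)"
    using i1 i2 by (simp add: distrib_left)
  finally show "(\<integral>h. G h \<partial>lebesgue) = (\<integral>h. indicator {h. h $ k < d} h * (G h + G (plane_reflection k d h)) \<partial>lebesgue)" .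
qed

lemma trunc_integrable_bounded:
  fixes f :: "real ^ 'n::finite \<Rightarrow> real"
  assumes s: "0 < s" "s < 1" and r: "0 < r" and f: "f \<in> borel_measurable borel" "\<And>z. \<bar>f z\<bar> \<le> B"
  shows "integrable lebesgue (\<lambda>h. far r h * (f (x + h) * frac_kernel s h))"
proof (rule Bochner_Integration.integrable_bound)
  show "integrable lebesgue (\<lambda>h :: real^'n. B * (far r h * frac_kernel s h))"
    using integrable_trunc_kernel[OF s r] by (intro integrable_mult_right)
  have [measurable]: "f \<in> borel_measurable borel" using f by simp
  show "(\<lambda>h. far r h * (f (x + h) * frac_kernel s h)) \<in> borel_measurable lebesgue"
    by (rule measurable_completion) measurable
  have "0 \<le> B" using f(2)[of 0] by linarith
  then show "AE h in lebesgue. norm (far r h * (f (x + h) * frac_kernel s h)) \<le> norm (B * (far r h * frac_kernel s h))"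
    using f(2) by (intro AE_I2) (auto simp: indicator_def abs_mult frac_kernel_nonneg intro!: mult_right_mono)
qed

text \<open>Let $u = w(x) + \psi(x) + q - \psi - w$, so that $u(x) = q$. The hypothesis \<open>touch\<close> says that
  $V$ lies above its tangent in terms of \<open>u\<close>, as the square of the positive part of \<open>u\<close> does. Fold the
  truncated integral along the plane: a point $z$ of the half space contributes
  $(w(x)-w(z))k + (w(x)+w(z))k'$, where $k' \le k$ is the kernel at the mirror image. This decreases in
  $w(z)$, so \<open>touch\<close> bounds it in terms of \<open>V\<close> and \<open>\<psi>\<close>. What remains is an operator on
  \<open>V\<close> and one on \<open>\<psi>\<close> over the whole space, plus the total mass of $k'$ times
  $w(x) + \psi(x) + q$: one half of $q$ comes from the mirror terms and one half from extending the
  integral of \<open>V\<close>, which vanishes beyond the plane, to the whole space. When that sum is negative,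
  its product with the tail of the kernel is the gain.\<close>

lemma half_second_diff_upper_bound:
  fixes w V \<psi> :: "real ^ 'n::finite \<Rightarrow> real"
  assumes s: "0 < s" "s < 1" and x: "x $ k < lam" and w: "w \<in> L2s_space s"
    and reg: "0 < \<rho>" "\<And>h. norm h \<le> \<rho> \<Longrightarrow> w (x + h) \<le> 0"
      "\<And>h. norm h \<le> \<rho> \<Longrightarrow> \<bar>second_diff w x h\<bar> \<le> G * (norm h)\<^sup>2"
    and anti: "\<And>z. z $ k < lam \<Longrightarrow> w z = - w (plane_reflection k lam z)"
    and V: "C11_bound n V" "\<And>z. 0 \<le> V z" "\<And>z. V z \<le> B" "\<And>z. lam \<le> z $ k \<Longrightarrow> V z = 0"
    and q: "0 < q" "V x = q\<^sup>2"
    and \<psi>: "\<psi> \<in> borel_measurable borel" "\<And>z. 0 \<le> \<psi> z" "\<And>z. \<psi> z \<le> A" "\<And>z. lam \<le> z $ k \<Longrightarrow> \<psi> x \<le> \<psi> z"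
      "\<And>h. - second_diff \<psi> x h \<le> 8 * A * min 1 ((norm h / (lam - x $ k))\<^sup>2)"
    and touch: "\<And>z. z $ k < lam \<Longrightarrow> w x - w z \<le> (V z - V x) / (2 * q) + (\<psi> z - \<psi> x)"
  shows "(\<integral>h. second_diff w x h * frac_kernel s h \<partial>lebesgue) / 2 \<le>
      - (\<integral>h. second_diff V x h * frac_kernel s h \<partial>lebesgue) / (4 * q) +
      (lam - x $ k) powr (- 2 * s) *
        (4 * A * (\<integral>h. min 1 ((norm (h :: real ^ 'n))\<^sup>2) * frac_kernel s h \<partial>lebesgue) +
         (w x + \<psi> x + q) * (\<integral>h. indicator {h. 1 \<le> h $ k} h * frac_kernel s (h :: real ^ 'n) \<partial>lebesgue))"
proof -
  define d where "d = lam - x $ k"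
  have d: "0 < d" using x by (simp add: d_def)
  define K :: "real ^ 'n \<Rightarrow> real" where "K = frac_kernel s"
  have K0: "0 \<le> K h" for h by (simp add: K_def frac_kernel_nonneg)
  have [measurable]: "K \<in> borel_measurable borel" "K \<in> borel_measurable lebesgue" by (auto simp: K_def)
  have wx: "w x \<le> 0" using reg(1) reg(2)[of 0] by simp
  have KR: "K (plane_reflection k d h) \<le> K h" if "h $ k < d" "h \<noteq> 0" for h
    unfolding K_def frac_kernel_def using norm_le_norm_plane_reflection[OF d that(1)] that(2) s
    by (intro divide_left_mono powr_mono2 mult_pos_pos) auto
  have wR: "w (x + plane_reflection k d h) = - w (x + h)" if "h $ k < d" for h
  proof -
    have "plane_reflection k lam (x + h) = x + plane_reflection k d h"
      by (simp add: vec_eq_iff plane_reflection_def d_def)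
    moreover have "(x + h) $ k < lam" using that by (simp add: d_def)
    ultimately show ?thesis using anti[of "x + h"] by simp
  qed
  define \<kappa> where "\<kappa> = w x + \<psi> x + q"
  define tail where "tail = (\<integral>h. indicator {h. d \<le> h $ k} h * K h \<partial>lebesgue)"
  define mom where "mom = (\<integral>h. min 1 ((norm h / d)\<^sup>2) * K h \<partial>lebesgue)"
  have mom_int: "integrable lebesgue (\<lambda>h. min 1 ((norm h / d)\<^sup>2) * K h)"
  proof (rule Bochner_Integration.integrable_bound)
    show "integrable lebesgue (\<lambda>h. max 1 ((1 / d)\<^sup>2) * (min 1 ((norm h)\<^sup>2) * K h))"
      unfolding K_def by (intro integrable_mult_right integrable_frac_kernel_min_lebesgue s)
    show "(\<lambda>h. min 1 ((norm h / d)\<^sup>2) * K h) \<in> borel_measurable lebesgue"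
      by (rule measurable_completion) measurable
    have "min 1 ((norm h / d)\<^sup>2) \<le> max 1 ((1 / d)\<^sup>2) * min 1 ((norm h)\<^sup>2)" for h :: "real ^ 'n"
    proof -
      have "(norm h / d)\<^sup>2 = (1 / d)\<^sup>2 * (norm h)\<^sup>2" by (simp add: power_divide)
      also have "\<dots> \<le> max 1 ((1 / d)\<^sup>2) * (norm h)\<^sup>2" by (intro mult_right_mono) auto
      finally have "(norm h / d)\<^sup>2 \<le> max 1 ((1 / d)\<^sup>2) * (norm h)\<^sup>2" .
      then show ?thesis by (cases "(norm h)\<^sup>2 \<le> 1") (auto simp: min_def)
    qed
    then have "min 1 ((norm h / d)\<^sup>2) * K h \<le> max 1 ((1 / d)\<^sup>2) * (min 1 ((norm h)\<^sup>2) * K h)" for h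
      unfolding mult.assoc[symmetric] by (rule mult_right_mono) (rule K0)
    moreover have "0 \<le> min 1 ((norm h / d)\<^sup>2) * K h" for h by (simp add: K0)
    ultimately show "AE h in lebesgue. norm (min 1 ((norm h / d)\<^sup>2) * K h) \<le> norm (max 1 ((1 / d)\<^sup>2) * (min 1 ((norm h)\<^sup>2) * K h))"
      by (intro AE_I2) (metis abs_ge_self abs_of_nonneg order_trans real_norm_def)
  qed
  \<comment> \<open>for radii below \<open>d\<close> the removed ball does not meet the plane, so mirror images are never removed\<close>
  define R where "R = min (min d \<rho>) 1"
  have R: "0 < R" "R \<le> d" "R \<le> \<rho>" using d reg(1) by (auto simp: R_def)
  define I where "I r = (\<integral>h. far r h * ((w x - w (x + h)) * K h) \<partial>lebesgue)" for r
  define TV where "TV r = (\<integral>h. far r h * (second_diff V x h * K h) \<partial>lebesgue)" for r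
  have Vb: "\<bar>V z\<bar> \<le> B" "V \<in> borel_measurable borel" for z
    using V(2,3)[of z] C11_bound_continuous[OF V(1)] by (auto intro: borel_measurable_continuous_onI)
  have \<psi>b: "\<bar>\<psi> z\<bar> \<le> A" for z using \<psi>(2,3)[of z] by simp
  have main: "I r \<le> - TV r / (4 * q) + 4 * A * mom + \<kappa> * tail" if r: "0 < r" "r < R" for r
  proof -
    note symm = trunc_integral_symmetrize[OF frac_kernel_minus integrable_trunc_kernel[OF s r(1)], folded K_def]
    note symV = symm[OF trunc_integrable_bounded[OF s r(1) Vb(2,1), of x], folded K_def]
    note sym\<psi> = symm[OF trunc_integrable_bounded[OF s r(1) \<psi>(1) \<psi>b, of x], folded K_def]
    note symw = symm[OF L2s_space_trunc_integrable[OF w s(1) r(1), of x], folded K_def]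
    define f where "f h = far r h * ((w x - w (x + h)) * K h)" for h
    have fint: "integrable lebesgue f" unfolding f_def[abs_def] by (rule symw(1))
    then have [measurable]: "f \<in> borel_measurable lebesgue" by auto
    define eV where "eV h = far r h * ((V x - V (x + h)) * K h)" for h
    define e\<psi> where "e\<psi> h = far r h * ((\<psi> x - \<psi> (x + h)) * K h)" for h
    define T1 where "T1 h = indicator {h. d \<le> h $ k} h * K h" for h
    define T2 where "T2 h = indicator {h. h $ k < d} h * K (plane_reflection k d h)" for h
    have T1int: "integrable lebesgue T1"
      unfolding T1_def[abs_def] K_def by (rule kernel_tail_integrable[OF s d])
    have T2: "integrable lebesgue T2" "(\<integral>h. T2 h \<partial>lebesgue) = tail"
    proof -
      have eq: "T2 h = indicator {h. h $ k < d} h * T1 (plane_reflection k d h)" for h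
        by (auto simp: T1_def T2_def indicator_def plane_reflection_nth)
      have "(\<integral>h. indicator {h. d \<le> h $ k} h * T1 h \<partial>lebesgue) = tail"
        unfolding tail_def by (rule Bochner_Integration.integral_cong) (auto simp: T1_def indicator_def)
      then show "integrable lebesgue T2" "(\<integral>h. T2 h \<partial>lebesgue) = tail"
        using integral_fold_half_space(1,2)[OF T1int, where k = k and d = d] unfolding eq[abs_def] by auto
    qed
    have eVint: "integrable lebesgue eV" unfolding eV_def[abs_def] by (rule symV(1))
    have e\<psi>int: "integrable lebesgue e\<psi>" unfolding e\<psi>_def[abs_def] by (rule sym\<psi>(1))
    have point: "indicator {h. h $ k < d} h * (f h + f (plane_reflection k d h))
        \<le> - eV h / (2 * q) - e\<psi> h + q / 2 * T1 h + (w x + q / 2 + \<psi> x) * T2 h" for h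
    proof (cases "h $ k < d")
      case True
      define K' where "K' = K (plane_reflection k d h)"
      have K'0: "0 \<le> K'" by (simp add: K'_def K0)
      have "r \<le> plane_reflection k d h $ k" using True r R by (simp add: plane_reflection_nth)
      then have far: "r \<le> norm (plane_reflection k d h)"
        using component_le_norm_cart[of "plane_reflection k d h" k] by simp
      have fR: "f (plane_reflection k d h) = (w x + w (x + h)) * K'"
        using far wR[OF True] by (simp add: f_def K'_def)
      have T: "T1 h = 0" "T2 h = K'" using True by (auto simp: T1_def T2_def K'_def)
      show ?thesis
      proof (cases "r \<le> norm h")
        case far': True
        define z where "z = x + h"
        have z: "z $ k < lam" using True by (simp add: z_def d_def)
        define \<Delta> where "\<Delta> = (V z - V x) / (2 * q) + (\<psi> z - \<psi> x)"
        have \<Delta>1: "w x - w z \<le> \<Delta>" unfolding \<Delta>_def by (rule touch[OF z])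
        have \<Delta>2: "- \<Delta> \<le> q / 2 + \<psi> x"
        proof -
          have "(V z - V x) / (2 * q) = V z / (2 * q) - q / 2" using q by (simp add: power2_eq_square diff_divide_distrib)
          moreover have "0 \<le> V z / (2 * q)" using V(2) q by simp
          ultimately show ?thesis using \<psi>(2)[of z] by (simp add: \<Delta>_def)
        qed
        have "h \<noteq> 0" using far' r by auto
        then have "0 \<le> K h - K'" using KR[OF True] by (simp add: K'_def)
        then have 1: "(w x - w z) * (K h - K') \<le> \<Delta> * (K h - K')" using \<Delta>1 by (rule mult_right_mono[rotated])
        have "2 * w x - \<Delta> \<le> w x + q / 2 + \<psi> x" using wx \<Delta>2 by linarith
        then have 2: "(2 * w x - \<Delta>) * K' \<le> (w x + q / 2 + \<psi> x) * K'" using K'0 by (rule mult_right_mono)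
        have "f h + f (plane_reflection k d h) = (w x - w z) * (K h - K') + 2 * w x * K'"
          using far' fR by (simp add: f_def z_def algebra_simps)
        also have "\<dots> \<le> \<Delta> * (K h - K') + 2 * w x * K'" using 1 by simp
        also have "\<dots> = \<Delta> * K h + (2 * w x - \<Delta>) * K'" by (simp add: algebra_simps)
        also have "\<dots> \<le> \<Delta> * K h + (w x + q / 2 + \<psi> x) * K'" using 2 by simp
        also have "\<Delta> * K h = - eV h / (2 * q) - e\<psi> h"
        proof -
          have e: "eV h = (V x - V z) * K h" "e\<psi> h = (\<psi> x - \<psi> z) * K h"
            using far' by (auto simp: eV_def e\<psi>_def z_def)
          show ?thesis unfolding e \<Delta>_def by (simp add: algebra_simps diff_divide_distrib add_divide_distrib)
        qed
        finally show ?thesis using True by (simp add: T)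
      next
        case near: False
        have "w (x + h) \<le> 0" using reg(2)[of h] near r R by simp
        then have "w x + w (x + h) \<le> w x + q / 2 + \<psi> x" using q \<psi>(2)[of x] by linarith
        then have "(w x + w (x + h)) * K' \<le> (w x + q / 2 + \<psi> x) * K'" using K'0 by (rule mult_right_mono)
        then show ?thesis using near True fR by (simp add: T f_def eV_def e\<psi>_def)
      qed
    next
      case False
      then have dh: "d \<le> h $ k" by simp
      have far: "r \<le> norm h" using component_le_norm_cart[of h k] dh r R by simp
      have out: "lam \<le> (x + h) $ k" using dh by (simp add: d_def)
      have T: "T1 h = K h" "T2 h = 0" using dh by (auto simp: T1_def T2_def)
      have eV: "eV h = q\<^sup>2 * K h" using far V(4)[OF out] q by (simp add: eV_def)
      have "e\<psi> h \<le> 0" using far \<psi>(4)[OF out] K0[of h] by (simp add: e\<psi>_def mult_nonpos_nonneg)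
      moreover have "eV h / (2 * q) = q / 2 * K h" using q unfolding eV by (simp add: power2_eq_square)
      ultimately show ?thesis using dh by (simp add: T)
    qed
    have "I r = (\<integral>h. indicator {h. h $ k < d} h * (f h + f (plane_reflection k d h)) \<partial>lebesgue)"
      unfolding I_def f_def[symmetric] by (rule integral_fold_half_space(3)[OF fint])
    also have "\<dots> \<le> (\<integral>h. - eV h / (2 * q) - e\<psi> h + q / 2 * T1 h + (w x + q / 2 + \<psi> x) * T2 h \<partial>lebesgue)"
    proof (rule integral_mono)
      have "integrable lebesgue (\<lambda>h. indicator {h. h $ k < d} h * f (plane_reflection k d h))"
        by (rule integral_fold_half_space(1)[OF fint])
      moreover have "integrable lebesgue (\<lambda>h. indicator {h. h $ k < d} h * f h)"
        by (rule Bochner_Integration.integrable_bound[OF fint])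
           (measurable, auto simp: indicator_def)
      ultimately show "integrable lebesgue (\<lambda>h. indicator {h. h $ k < d} h * (f h + f (plane_reflection k d h)))"
        by (simp add: distrib_left)
      show "integrable lebesgue (\<lambda>h. - eV h / (2 * q) - e\<psi> h + q / 2 * T1 h + (w x + q / 2 + \<psi> x) * T2 h)"
        using eVint e\<psi>int T1int T2(1) by simp
    qed (rule point)
    also have "\<dots> = - (\<integral>h. eV h \<partial>lebesgue) / (2 * q) - (\<integral>h. e\<psi> h \<partial>lebesgue) + q / 2 * tail + (w x + q / 2 + \<psi> x) * tail"
      using eVint e\<psi>int T1int T2 by (simp add: tail_def T1_def[abs_def])
    also have "\<dots> = - (\<integral>h. eV h \<partial>lebesgue) / (2 * q) - (\<integral>h. e\<psi> h \<partial>lebesgue) + \<kappa> * tail"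
      by (simp add: \<kappa>_def algebra_simps)
    also have "(\<integral>h. eV h \<partial>lebesgue) = TV r / 2"
      unfolding eV_def TV_def by (rule symV(3))
    also have "- (TV r / 2) / (2 * q) = - TV r / (4 * q)" by simp
    finally have "I r \<le> - TV r / (4 * q) - (\<integral>h. e\<psi> h \<partial>lebesgue) + \<kappa> * tail" .
    moreover have "- (\<integral>h. e\<psi> h \<partial>lebesgue) \<le> 4 * A * mom"
    proof -
      have "(\<integral>h. - (far r h * (second_diff \<psi> x h * K h)) \<partial>lebesgue) \<le> (\<integral>h. 8 * A * (min 1 ((norm h / d)\<^sup>2) * K h) \<partial>lebesgue)"
      proof (rule integral_mono)
        show "integrable lebesgue (\<lambda>h. - (far r h * (second_diff \<psi> x h * K h)))"
          using sym\<psi>(2) by simp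
        show "integrable lebesgue (\<lambda>h. 8 * A * (min 1 ((norm h / d)\<^sup>2) * K h))"
          using mom_int by (intro integrable_mult_right)
        fix h
        have "- second_diff \<psi> x h * K h \<le> 8 * A * min 1 ((norm h / d)\<^sup>2) * K h"
          using \<psi>(5)[of h] unfolding d_def[symmetric] by (rule mult_right_mono) (rule K0)
        moreover have "0 \<le> 8 * A * (min 1 ((norm h / d)\<^sup>2) * K h)"
          using \<psi>(2,3)[of x] K0[of h] by (intro mult_nonneg_nonneg) auto
        ultimately show "- (far r h * (second_diff \<psi> x h * K h)) \<le> 8 * A * (min 1 ((norm h / d)\<^sup>2) * K h)"
          by (auto simp: indicator_def mult.assoc)
      qed
      moreover have "(\<integral>h. e\<psi> h \<partial>lebesgue) = (\<integral>h. far r h * (second_diff \<psi> x h * K h) \<partial>lebesgue) / 2"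
        unfolding e\<psi>_def by (rule sym\<psi>(3))
      ultimately show ?thesis using mom_int by (simp add: mom_def)
    qed
    ultimately show ?thesis by linarith
  qed
  have limI: "(I \<longlongrightarrow> (\<integral>h. second_diff w x h * K h \<partial>lebesgue) / 2) (at_right 0)"
    unfolding I_def K_def by (rule frac_laplace_second_diff(1)[OF w s reg(1,3)])
  have "levy_kernel (frac_kernel s :: real ^ 'n \<Rightarrow> real)"
    by unfold_locales (use integrable_frac_kernel_min[OF s] in \<open>auto simp: frac_kernel_nonneg\<close>)
  then have Vint: "integrable lborel (\<lambda>h. second_diff V x h * K h)"
    unfolding K_def by (rule levy_kernel.integrable_second_diff[OF _ V(1)])
  then have Vint': "integrable lebesgue (\<lambda>h. second_diff V x h * K h)"
    by (subst integrable_completion) auto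
  have "(TV \<longlongrightarrow> (\<integral>h. second_diff V x h * K h \<partial>lebesgue)) (at_right 0)"
    unfolding TV_def by (rule trunc_integral_tendsto[OF Vint']) (simp add: second_diff_def)
  then have limR: "((\<lambda>r. - TV r / (4 * q) + 4 * A * mom + \<kappa> * tail) \<longlongrightarrow>
      - (\<integral>h. second_diff V x h * K h \<partial>lebesgue) / (4 * q) + 4 * A * mom + \<kappa> * tail) (at_right 0)"
    using q by (intro tendsto_intros) auto
  have "\<forall>\<^sub>F r in at_right 0. I r \<le> - TV r / (4 * q) + 4 * A * mom + \<kappa> * tail"
    using eventually_at_right_real[OF R(1)] by eventually_elim (use main in auto)
  from tendsto_le[OF _ limR limI this]
  have "(\<integral>h. second_diff w x h * K h \<partial>lebesgue) / 2 \<le>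
      - (\<integral>h. second_diff V x h * K h \<partial>lebesgue) / (4 * q) + 4 * A * mom + \<kappa> * tail" by simp
  moreover define m0 where "m0 = (\<integral>h. min 1 ((norm (h :: real ^ 'n))\<^sup>2) * K h \<partial>lebesgue)"
  moreover define t0 where "t0 = (\<integral>h. indicator {h. 1 \<le> h $ k} h * K h \<partial>lebesgue)"
  moreover define P where "P = d powr (- 2 * s)"
  moreover have "mom = P * m0" "tail = P * t0"
    unfolding mom_def tail_def P_def m0_def t0_def K_def
    by (rule kernel_moment_scale[OF d], rule kernel_tail_scale[OF d])
  moreover have "4 * A * (P * m0) + \<kappa> * (P * t0) = P * (4 * A * m0 + \<kappa> * t0)"
    by (simp add: algebra_simps)
  ultimately have "(\<integral>h. second_diff w x h * K h \<partial>lebesgue) / 2 \<le>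
      - (\<integral>h. second_diff V x h * K h \<partial>lebesgue) / (4 * q) + P * (4 * A * m0 + \<kappa> * t0)" by simp
  then show ?thesis
    unfolding P_def m0_def t0_def K_def \<kappa>_def d_def .
qed

section \<open>Sublevel sets, barrier layers and constants\<close>

lemma (in levy_kernel) nonlocal_op_nonpos_at_zero:
  assumes "\<And>y. 0 \<le> f y" "f x = 0"
  shows "nonlocal_op f x \<le> 0"
proof -
  have "0 \<le> (\<integral>h. - (second_diff f x h * K h) \<partial>lborel)"
  proof (rule Bochner_Integration.integral_nonneg)
    fix h
    have "second_diff f x h \<le> 0" using assms(1)[of "x + h"] assms(1)[of "x - h"] assms(2) by (simp add: second_diff_def)
    then show "0 \<le> - (second_diff f x h * K h)" using K_nonneg[of h] by (simp add: mult_nonpos_nonneg)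
  qed
  then show ?thesis by (simp add: nonlocal_op_def)
qed

lemma closed_sublevel_lsc:
  fixes f g :: "'a::metric_space \<Rightarrow> real"
  assumes S: "closed S" and f: "lsc_on S f" and g: "continuous_on UNIV g"
  shows "closed {z \<in> S. f z \<le> g z}"
  unfolding closed_def
proof (rule Topological_Spaces.openI)
  fix z assume z: "z \<in> - {z \<in> S. f z \<le> g z}"
  have "\<forall>\<^sub>F y in nhds z. y \<in> - {z \<in> S. f z \<le> g z}"
  proof (cases "z \<in> S")
    case False
    then have "\<forall>\<^sub>F y in nhds z. y \<in> - S"
      using S by (intro eventually_nhds_in_open) auto
    then show ?thesis by eventually_elim auto
  next
    case True
    then have "g z < f z" using z by auto
    then obtain b where b: "g z < b" "b < f z" using dense by blast
    have "\<forall>\<^sub>F y in at z within S. b < f y" using f True b(2) unfolding lsc_on_def by blast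
    then have 1: "\<forall>\<^sub>F y in nhds z. y \<noteq> z \<longrightarrow> y \<in> S \<longrightarrow> b < f y" by (simp add: eventually_at_filter)
    have "open {y. g y < b}" using g by (intro open_Collect_less continuous_on_const)
    then have 2: "\<forall>\<^sub>F y in nhds z. y \<in> {y. g y < b}" using b(1) by (intro eventually_nhds_in_open) auto
    show ?thesis using 1 2
    proof eventually_elim
      case (elim y)
      then show ?case using b by (cases "y = z") auto
    qed
  qed
  then obtain T where "open T" "z \<in> T" "\<forall>y\<in>T. y \<in> - {z \<in> S. f z \<le> g z}"
    unfolding eventually_nhds by blast
  then show "\<exists>T. open T \<and> z \<in> T \<and> T \<subseteq> - {z \<in> S. f z \<le> g z}" by blast
qed

text \<open>The layer varies on the scale \<open>\<delta>\<close>, but it is measured here on the scale \<open>d\<close> of the distance to the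
  plane. If $d \le 2\delta$, the second differences of order $|h|^2/\delta^2$ suffice. If $d > 2\delta$,
  the layer vanishes on the ball of radius $d/2$. The cut-off by \<open>1\<close>, which matters only beyond the
  plane, acts in the favourable direction.\<close>

lemma layer_second_diff_lower:
  fixes z h :: "real ^ 'n::finite"
  assumes A: "0 \<le> A" and \<delta>: "0 < \<delta>" and d: "0 < lam - z $ k"
  defines "\<psi> \<equiv> \<lambda>y. A * min 1 ((max 0 (1 - (lam - y $ k) / \<delta>))\<^sup>2)"
  shows "- second_diff \<psi> z h \<le> 8 * A * min 1 ((norm h / (lam - z $ k))\<^sup>2)"
proof -
  define d where "d = lam - z $ k"
  have d0: "0 < d" using d by (simp add: d_def)
  define a where "a = 1 - d / \<delta>"
  define e where "e = h $ k / \<delta>"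
  define S where "S b = (max 0 b)\<^sup>2" for b :: real
  have \<psi>: "\<psi> z = A * min 1 (S a)" "\<psi> (z + h) = A * min 1 (S (a + e))" "\<psi> (z - h) = A * min 1 (S (a - e))"
    by (simp_all add: \<psi>_def S_def a_def d_def e_def diff_divide_distrib add_divide_distrib algebra_simps)
  have Sa: "S a \<le> 1" "0 \<le> S a"
    using d0 \<delta> by (auto simp: S_def a_def power_le_one)
  have hk: "\<bar>h $ k\<bar> \<le> norm h" by (rule component_le_norm_cart)
  define X where "X = min 1 (S (a + e)) + min 1 (S (a - e)) - 2 * S a"
  have eq: "- second_diff \<psi> z h = A * X"
    using Sa unfolding second_diff_def \<psi> X_def by (simp add: min_absorb2 algebra_simps)
  have X2: "X \<le> 2" using Sa unfolding X_def by (auto simp: min_def)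
  have Xe: "X \<le> 2 * e\<^sup>2"
    using sqr_pos_part_upper[of "a + e" a] sqr_pos_part_upper[of "a - e" a] unfolding X_def S_def by (auto simp: min_def)
  have "X \<le> 8 * (norm h / d)\<^sup>2"
  proof (cases "d \<le> 2 * \<delta>")
    case True
    have "\<bar>e\<bar> \<le> 2 * (norm h / d)"
    proof -
      have "\<bar>h $ k\<bar> * d \<le> norm h * (2 * \<delta>)" using hk True d0 by (intro mult_mono) auto
      then show ?thesis using d0 \<delta> by (simp add: e_def field_simps)
    qed
    then have "e\<^sup>2 \<le> (2 * (norm h / d))\<^sup>2" by (metis abs_ge_zero power2_abs power_mono)
    also have "(2 * (norm h / d))\<^sup>2 = 4 * (norm h / d)\<^sup>2" by (simp only: power_mult_distrib) simp
    finally show ?thesis using Xe by linarith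
  next
    case far: False
    show ?thesis
    proof (cases "norm h \<le> d / 2")
      case True
      have "a + e = (\<delta> - d + h $ k) / \<delta>" "a - e = (\<delta> - d - h $ k) / \<delta>"
        using \<delta> by (simp_all add: a_def e_def diff_divide_distrib add_divide_distrib)
      moreover have "\<delta> - d + h $ k \<le> 0" "\<delta> - d - h $ k \<le> 0" using far True hk by linarith+
      ultimately have "a + e \<le> 0" "a - e \<le> 0" using \<delta> by (simp_all add: divide_nonpos_pos)
      then have "X \<le> 0" using Sa by (simp add: X_def S_def)
      also have "0 \<le> 8 * (norm h / d)\<^sup>2" by simp
      finally show ?thesis .
    next
      case False
      then have "1 / 2 \<le> norm h / d" using d0 by (simp add: field_simps)
      then have "(1 / 2)\<^sup>2 \<le> (norm h / d)\<^sup>2" by (intro power_mono) auto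
      then show ?thesis using X2 by (simp add: power2_eq_square)
    qed
  qed
  then have "X \<le> 8 * min 1 ((norm h / d)\<^sup>2)" using X2 by (auto simp: min_def)
  then have "A * X \<le> A * (8 * min 1 ((norm h / d)\<^sup>2))" using A by (rule mult_left_mono)
  then show ?thesis unfolding eq d_def by simp
qed

definition kernel_tail :: "'n::finite \<Rightarrow> real \<Rightarrow> real" where
  "kernel_tail k s = (\<integral>h. indicator {h. 1 \<le> h $ k} h * frac_kernel s (h :: real ^ 'n) \<partial>lebesgue)"

text \<open>The fraction \<open>\<theta>\<close> of the current bound that the layer has as height: the layer error
  $4\theta$ times the moment of the kernel is then at most half of the tail.\<close>

definition gain :: "'n::finite \<Rightarrow> real \<Rightarrow> real" where
  "gain k s = min (1 / 2)
     (kernel_tail k s / (8 * ((\<integral>h. min 1 ((norm (h :: real ^ 'n))\<^sup>2) * frac_kernel s h \<partial>lebesgue) + 1)))"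

lemma frac_laplace_const_pos:
  assumes "0 < s" "s < 1" "0 < N"
  shows "0 < frac_laplace_const N s"
  unfolding frac_laplace_const_def using assms by (intro divide_pos_pos mult_pos_pos Gamma_real_pos) auto

lemma gain_bounds:
  fixes k :: "'n::finite"
  assumes s: "0 < s" "s < 1"
  shows "0 < gain k s" "gain k s \<le> 1 / 2"
    "4 * gain k s * (\<integral>h. min 1 ((norm (h :: real ^ 'n))\<^sup>2) * frac_kernel s h \<partial>lebesgue) \<le> kernel_tail k s / 2"
proof -
  define m0 where "m0 = (\<integral>h. min 1 ((norm (h :: real ^ 'n))\<^sup>2) * frac_kernel s h \<partial>lebesgue)"
  have m0: "0 \<le> m0" unfolding m0_def
    by (rule Bochner_Integration.integral_nonneg) (simp add: frac_kernel_nonneg)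
  have t0: "0 < kernel_tail k s" unfolding kernel_tail_def by (rule kernel_tail_pos[OF s])
  have g: "gain k s = min (1 / 2) (kernel_tail k s / (8 * (m0 + 1)))" by (simp add: gain_def m0_def)
  show "0 < gain k s" using t0 m0 by (simp add: g)
  show "gain k s \<le> 1 / 2" unfolding g by (rule min.cobounded1)
  have "gain k s * (8 * m0) \<le> kernel_tail k s / (8 * (m0 + 1)) * (8 * (m0 + 1))"
    using m0 t0 by (intro mult_mono) (auto simp: g)
  also have "\<dots> = kernel_tail k s" using m0 by simp
  finally show "4 * gain k s * (\<integral>h. min 1 ((norm (h :: real ^ 'n))\<^sup>2) * frac_kernel s h \<partial>lebesgue) \<le> kernel_tail k s / 2"
    by (simp add: m0_def)
qed

section \<open>Decay of the negative part in a narrow slab\<close>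

text \<open>The narrowness is expressed as the inequality between the rate $C$ and the tail of the kernel
  at distance \<open>l\<close>. The condition \<open>decay\<close> covers both cases of the theorem;
  a large \<open>R\<close> satisfies it trivially for bounded \<open>\<Omega>\<close>.\<close>

locale narrow_slab_solution =
  fixes k :: "'n::finite" and s C lam l tbar :: real and \<Omega> :: "(real ^ 'n) set"
    and w c :: "real ^ 'n \<Rightarrow> real \<Rightarrow> real"
  assumes s: "0 < s" "s < 1"
    and narrow: "0 < l" "4 * (1 + \<bar>C\<bar>) \<le> frac_laplace_const CARD('n) s * kernel_tail k s * l powr (- 2 * s)"
    and open_\<Omega>: "open \<Omega>" and slab: "\<Omega> \<subseteq> slab k lam l"
    and regular: "w \<in> times_C1 (C11_loc \<Omega> \<inter> L2s_space s) {tbar..}"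
    and lsc: "tbar \<le> t \<Longrightarrow> lsc_on (closure \<Omega>) (\<lambda>x. w x t)"
    and c_le: "x \<in> \<Omega> \<Longrightarrow> tbar \<le> t \<Longrightarrow> c x t \<le> C"
    and equation: "x \<in> \<Omega> \<Longrightarrow> tbar \<le> t \<Longrightarrow>
         vector_derivative (w x) (at t within {tbar..}) + frac_laplace s (\<lambda>y. w y t) x = c x t * w x t"
    and outside: "x $ k < lam \<Longrightarrow> x \<notin> \<Omega> \<Longrightarrow> tbar \<le> t \<Longrightarrow> 0 \<le> w x t"
    and anti: "x $ k < lam \<Longrightarrow> tbar \<le> t \<Longrightarrow> w x t = - w (plane_reflection k lam x) t"
    and decay: "0 < \<epsilon> \<Longrightarrow> \<exists>R. \<forall>x\<in>\<Omega>. R \<le> norm x \<longrightarrow> (\<forall>t\<ge>tbar. - \<epsilon> \<le> w x t)"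
begin

lemma slab_bounds: "x \<in> \<Omega> \<Longrightarrow> 0 < lam - x $ k" "x \<in> \<Omega> \<Longrightarrow> lam - x $ k < l"
  using slab by (force simp: slab_def)+

lemma time_derivative:
  assumes "tbar \<le> a" "a \<le> t"
  shows "(w x has_real_derivative vector_derivative (w x) (at t within {tbar..})) (at t within {a..})"
proof -
  have t: "t \<in> {tbar..}" using assms by simp
  obtain D where "(w x has_vector_derivative D t) (at t within {tbar..})"
    using regular t unfolding times_C1_def C1_on_def by blast
  moreover have "at_right t \<le> at t within {tbar..}" using t by (intro at_le) auto
  then have "at t within {tbar..} \<noteq> bot"
    using trivial_limit_at_right_real[of t] by (metis bot.extremum_uniqueI)
  ultimately have "(w x has_vector_derivative vector_derivative (w x) (at t within {tbar..})) (at t within {tbar..})"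
    using vector_derivative_within by metis
  then have "(w x has_real_derivative vector_derivative (w x) (at t within {tbar..})) (at t within {tbar..})"
    by (simp add: has_real_derivative_iff_has_vector_derivative)
  then show ?thesis by (rule DERIV_subset) (use assms in auto)
qed

text \<open>For a fixed \<open>x\<close> the layer gets as width \<open>\<delta>\<close> the distance of \<open>x\<close> to the plane, so that it
  vanishes at \<open>x\<close>. The function \<open>V\<close> is the square of $(\kappa - \psi - w)_+$. At the initial time $\kappa = -m$, hence
  $V = 0$. Within distance $\delta/4$ of the plane $\psi \ge \theta m/2$, and $\kappa \le -m + \theta m/2$
  forces $V = 0$ there; far away \<open>decay\<close> does. The differential inequality for \<open>V\<close> is trivial
  where $V = 0$.\<close>

lemma lower_bound_improves:
  assumes m: "0 < m" and a: "tbar \<le> a" and lower: "\<And>x t. x \<in> \<Omega> \<Longrightarrow> a \<le> t \<Longrightarrow> - m \<le> w x t"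
    and x: "x \<in> \<Omega>" and t: "a \<le> t"
  shows "- m * (1 - gain k s / 2) - gain k s / 2 * m * exp (- (t - a)) \<le> w x t"
proof -
  define \<theta> where "\<theta> = gain k s"
  have \<theta>: "0 < \<theta>" "\<theta> \<le> 1 / 2" using gain_bounds[OF s] by (auto simp: \<theta>_def)
  define cN where "cN = frac_laplace_const CARD('n) s"
  have cN: "0 < cN" unfolding cN_def using s by (intro frac_laplace_const_pos) auto
  define \<delta> where "\<delta> = lam - x $ k"
  have \<delta>: "0 < \<delta>" using slab_bounds(1)[OF x] by (simp add: \<delta>_def)
  define \<psi> where "\<psi> z = \<theta> * m * min 1 ((max 0 (1 - (lam - z $ k) / \<delta>))\<^sup>2)" for z
  have \<theta>m: "0 < \<theta> * m" "\<theta> * m \<le> m / 2" using \<theta> m by auto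
  have \<psi>0: "0 \<le> \<psi> z" and \<psi>1: "\<psi> z \<le> \<theta> * m" for z
    using \<theta>m(1) by (auto simp: \<psi>_def mult_left_le)
  have \<psi>cont: "continuous_on UNIV \<psi>"
    unfolding \<psi>_def using \<delta> by (intro continuous_intros) auto
  have \<psi>out: "\<psi> z = \<theta> * m" if "lam \<le> z $ k" for z
  proof -
    have "(lam - z $ k) / \<delta> \<le> 0" using that \<delta> by (simp add: divide_nonpos_pos)
    then have "1 \<le> (max 0 (1 - (lam - z $ k) / \<delta>))\<^sup>2" by (simp add: one_le_power)
    then show ?thesis by (simp add: \<psi>_def)
  qed
  define \<kappa> where "\<kappa> t = - m * (1 - \<theta> / 2) - \<theta> / 2 * m * exp (- (t - a))" for t
  define \<kappa>' where "\<kappa>' t = \<theta> / 2 * m * exp (- (t - a))" for t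
  have \<kappa>a: "\<kappa> a = - m" by (simp add: \<kappa>_def algebra_simps)
  have \<kappa>up: "\<kappa> t \<le> - m + \<theta> * m / 2" for t
  proof -
    have "0 \<le> \<theta> / 2 * m * exp (- (t - a))" using \<theta> m by simp
    then show ?thesis by (simp add: \<kappa>_def algebra_simps)
  qed
  have \<kappa>up': "\<kappa> t \<le> - (3 / 4) * m" for t using \<kappa>up[of t] \<theta>m by linarith
  have \<kappa>'m: "\<kappa>' t \<le> m" if "a \<le> t" for t
  proof -
    have "\<theta> / 2 * m * exp (- (t - a)) \<le> 1 * m * 1" using \<theta> m that by (intro mult_mono) auto
    then show ?thesis by (simp add: \<kappa>'_def)
  qed
  have \<kappa>deriv: "(\<kappa> has_real_derivative \<kappa>' t) (at t within {a..})" for t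
    unfolding \<kappa>_def[abs_def] \<kappa>'_def by (auto intro!: derivative_eq_intros)
  define q where "q z t = \<kappa> t - \<psi> z - w z t" for z t
  define V where "V z t = (if z \<in> \<Omega> then (max 0 (q z t))\<^sup>2 else 0)" for z t
  define wt where "wt z t = vector_derivative (w z) (at t within {tbar..})" for z t
  define D where "D z t = (if z \<in> \<Omega> then 2 * max 0 (q z t) * (\<kappa>' t - wt z t) else 0)" for z t
  define K :: "real ^ 'n \<Rightarrow> real" where "K h = cN / 2 * frac_kernel s h" for h
  interpret levy_kernel K
  proof
    show "0 \<le> K h" for h using cN by (simp add: K_def frac_kernel_nonneg)
    show "K \<in> borel_measurable borel" unfolding K_def[abs_def] by measurable
    have "integrable lborel (\<lambda>h :: real ^ 'n. cN / 2 * (min 1 ((norm h)\<^sup>2) * frac_kernel s h))"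
      by (intro integrable_mult_right integrable_frac_kernel_min s)
    then show "integrable lborel (\<lambda>h. min 1 ((norm h)\<^sup>2) * K h)" by (simp add: K_def mult_ac)
  qed
  obtain R where R: "\<And>z t. z \<in> \<Omega> \<Longrightarrow> R \<le> norm z \<Longrightarrow> tbar \<le> t \<Longrightarrow> - (m / 2) \<le> w z t"
    using decay[of "m / 2"] m by auto
  have q_le: "q z t \<le> m" if "z \<in> \<Omega>" "a \<le> t" for z t
    using lower[OF that] \<psi>0[of z] \<kappa>up'[of t] m by (simp add: q_def)
  have q_pos: "z $ k \<le> lam - \<delta> / 4 \<and> norm z \<le> R \<and> w z t \<le> \<kappa> t - \<psi> z" if z: "z \<in> \<Omega>" "a \<le> t" "0 < q z t" for z t
  proof (intro conjI)
    show w_less: "w z t \<le> \<kappa> t - \<psi> z" using z by (simp add: q_def)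
    show "norm z \<le> R"
    proof (rule ccontr)
      assume "\<not> norm z \<le> R"
      then have "- (m / 2) \<le> w z t" using R[OF z(1)] z a by simp
      then show False using w_less \<psi>0[of z] \<kappa>up'[of t] m by linarith
    qed
    show "z $ k \<le> lam - \<delta> / 4"
    proof (rule ccontr)
      assume "\<not> z $ k \<le> lam - \<delta> / 4"
      then have "3 / 4 \<le> 1 - (lam - z $ k) / \<delta>" using \<delta> by (simp add: field_simps)
      then have "3 / 4 \<le> max 0 (1 - (lam - z $ k) / \<delta>)" by (rule max.coboundedI2)
      then have "(3 / 4)\<^sup>2 \<le> (max 0 (1 - (lam - z $ k) / \<delta>))\<^sup>2" by (rule power_mono) simp
      moreover have "1 / 2 \<le> (3 / 4 :: real)\<^sup>2" by (simp add: power2_eq_square)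
      ultimately have "1 / 2 \<le> (max 0 (1 - (lam - z $ k) / \<delta>))\<^sup>2" by (rule order_trans[rotated])
      then have "1 / 2 \<le> min 1 ((max 0 (1 - (lam - z $ k) / \<delta>))\<^sup>2)" by (rule min.boundedI[rotated]) simp
      then have "\<theta> * m * (1 / 2) \<le> \<psi> z" unfolding \<psi>_def using \<theta>m(1) by (intro mult_left_mono) auto
      then have "q z t \<le> 0" using \<kappa>up[of t] lower[OF z(1,2)] by (simp add: q_def)
      then show False using z(3) by simp
    qed
  qed
  have \<psi>in: "\<psi> z = \<theta> * m * (max 0 (1 - (lam - z $ k) / \<delta>))\<^sup>2" if "z \<in> \<Omega>" for z
  proof -
    have "(max 0 (1 - (lam - z $ k) / \<delta>))\<^sup>2 \<le> 1"
      using slab_bounds(1)[OF that] \<delta> by (intro power_le_one) auto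
    then show ?thesis by (simp add: \<psi>_def min_absorb2)
  qed
  have loc_w: "locally_C11 \<Omega> (\<lambda>z. w z t)" if "a \<le> t" for t
    using regular that a open_\<Omega> by (intro locally_C11_if_C11_loc) (auto simp: times_C1_def)
  have C11: "\<exists>n. C11_bound n (\<lambda>z. V z t)" if at: "a \<le> t" for t
  proof -
    define Kt where "Kt = {z \<in> closure \<Omega>. w z t \<le> \<kappa> t - \<psi> z} \<inter> ({z. z $ k \<le> lam - \<delta> / 4} \<inter> cball 0 R)"
    have "closed {z \<in> closure \<Omega>. w z t \<le> \<kappa> t - \<psi> z}"
      by (intro closed_sublevel_lsc lsc continuous_intros \<psi>cont) (use at a in auto)
    moreover have "closed {z :: real ^ 'n. z $ k \<le> lam - \<delta> / 4}"
      by (intro closed_Collect_le continuous_intros)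
    ultimately have "compact Kt"
      unfolding Kt_def by (intro closed_Int_compact compact_cball closed_Int)
    moreover have "Kt \<subseteq> \<Omega>"
    proof
      fix z assume z: "z \<in> Kt"
      then have "z $ k < lam" "w z t < 0" using \<delta> \<psi>0[of z] \<kappa>up'[of t] m by (auto simp: Kt_def)
      then show "z \<in> \<Omega>" using outside[of z t] at a by force
    qed
    moreover have "z \<in> Kt" if "z \<in> \<Omega>" "0 < q z t" for z
      using q_pos[OF that(1) at that(2)] that(1) closure_subset by (auto simp: Kt_def)
    moreover have "locally_C11 \<Omega> (\<lambda>z. q z t)"
    proof (rule locally_C11_cong)
      show "locally_C11 \<Omega> (\<lambda>z. (\<kappa> t - \<theta> * m * (max 0 (1 - (lam - z $ k) / \<delta>))\<^sup>2) - w z t)"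
        using slab_bounds \<delta> \<theta>m by (intro locally_C11_diff loc_w[OF at] locally_C11_layer open_\<Omega>) auto
    qed (simp add: q_def \<psi>in)
    ultimately show ?thesis
      unfolding V_def using q_le[OF _ at] m open_\<Omega> by (intro C11_bound_sqr_pos_part[where K = Kt and M = m]) auto
  qed
  have V0: "0 \<le> V z t" for z t by (simp add: V_def)
  have VM: "V z t \<le> m\<^sup>2" if "a \<le> t" for z t
    using q_le[OF _ that, of z] m by (auto simp: V_def intro!: power_mono)
  have sub: "D z t \<le> - nonlocal_op (\<lambda>z. V z t) z" if at: "a \<le> t" for z t
  proof (cases "z \<in> \<Omega> \<and> 0 < q z t")
    case False
    then have "D z t = 0" "V z t = 0" by (auto simp: D_def V_def)
    then show ?thesis using nonlocal_op_nonpos_at_zero[of "\<lambda>z. V z t" z] V0 by simp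
  next
    case True
    then have z: "z \<in> \<Omega>" and qz: "0 < q z t" by auto
    have tt: "tbar \<le> t" using at a by simp
    define Q where "Q = q z t"
    have Q: "0 < Q" using qz by (simp add: Q_def)
    have wneg: "w z t < 0" using qz \<psi>0[of z] \<kappa>up'[of t] m by (simp add: q_def)
    define d where "d = lam - z $ k"
    have d: "0 < d" "d < l" using slab_bounds[OF z] by (auto simp: d_def)
    obtain n where n: "C11_bound n (\<lambda>z. V z t)" using C11[OF at] by blast
    have "compact {z}" "{z} \<subseteq> \<Omega>" using z by auto
    then obtain \<rho>0 G where G: "0 < \<rho>0" "0 \<le> G" "C11_near \<Omega> \<rho>0 G (\<lambda>z. w z t) z"
      using loc_w[OF at] unfolding locally_C11_def by blast
    note near = C11_nearD(2,3)[OF G(3)]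
    \<comment> \<open>on this radius \<open>w\<close> stays nonpositive, since it is Lipschitz with constant \<open>G\<close> near \<open>z\<close>\<close>
    define \<rho> where "\<rho> = min \<rho>0 (- w z t / (G + 1))"
    have \<rho>: "0 < \<rho>" "\<rho> \<le> \<rho>0" using G wneg by (auto simp: \<rho>_def divide_neg_pos)
    have w_near: "w (z + h) t \<le> 0" if "norm h \<le> \<rho>" for h
    proof -
      have "norm h \<le> - w z t / (G + 1)" using that by (simp add: \<rho>_def)
      then have "(G + 1) * norm h \<le> - w z t" using G by (simp add: field_simps)
      moreover have "w (z + h) t - w z t \<le> G * norm h" using near(1)[of h] that \<rho> by auto
      ultimately show ?thesis using norm_ge_zero[of h] unfolding distrib_right by linarith
    qed
    define m0 where "m0 = (\<integral>h. min 1 ((norm (h :: real ^ 'n))\<^sup>2) * frac_kernel s h \<partial>lebesgue)"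
    define L where "L = (\<integral>h. second_diff (\<lambda>y. w y t) z h * frac_kernel s h \<partial>lebesgue) / 2"
    define J where "J = (\<integral>h. second_diff (\<lambda>y. V y t) z h * frac_kernel s h \<partial>lebesgue)"
    have VQ: "V z t = Q\<^sup>2" using z Q by (simp add: V_def Q_def)
    \<comment> \<open>off \<open>\<Omega>\<close> the positive part vanishes as well, because \<open>w\<close> is nonnegative there and \<open>\<kappa>\<close> is negative\<close>
    have V_half: "V y t = (max 0 (q y t))\<^sup>2" if "y $ k < lam" for y
    proof (cases "y \<in> \<Omega>")
      case False
      then have "q y t \<le> 0" using outside[OF that False tt] \<psi>0[of y] \<kappa>up'[of t] m by (simp add: q_def)
      then show ?thesis using False by (simp add: V_def)
    qed (simp add: V_def)
    have "L \<le> - J / (4 * Q) + (lam - z $ k) powr (- 2 * s) * (4 * (\<theta> * m) * m0 + (w z t + \<psi> z + Q) * kernel_tail k s)"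
      unfolding L_def J_def m0_def kernel_tail_def
    proof (rule half_second_diff_upper_bound[OF s])
      show "z $ k < lam" using d by (simp add: d_def)
      show "(\<lambda>y. w y t) \<in> L2s_space s" using regular tt by (simp add: times_C1_def)
      show "0 < \<rho>" by (rule \<rho>(1))
      show "w (z + h) t \<le> 0" if "norm h \<le> \<rho>" for h using w_near[OF that] .
      show "\<bar>second_diff (\<lambda>y. w y t) z h\<bar> \<le> G * (norm h)\<^sup>2" if "norm h \<le> \<rho>" for h
        using near(2)[of h] that \<rho> by simp
      show "w y t = - w (plane_reflection k lam y) t" if "y $ k < lam" for y using anti[OF that tt] .
      show "C11_bound n (\<lambda>y. V y t)" by (rule n)
      show "0 \<le> V y t" "V y t \<le> m\<^sup>2" for y using V0 VM[OF at] by auto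
      show "V y t = 0" if "lam \<le> y $ k" for y using slab_bounds(1)[of y] that by (auto simp: V_def)
      show "0 < Q" "V z t = Q\<^sup>2" by (rule Q, rule VQ)
      show "\<psi> \<in> borel_measurable borel" using \<psi>cont by (rule borel_measurable_continuous_onI)
      show "0 \<le> \<psi> y" "\<psi> y \<le> \<theta> * m" for y using \<psi>0 \<psi>1 by auto
      show "\<psi> z \<le> \<psi> y" if "lam \<le> y $ k" for y using \<psi>out[OF that] \<psi>1 by simp
      show "- second_diff \<psi> z h \<le> 8 * (\<theta> * m) * min 1 ((norm h / (lam - z $ k))\<^sup>2)" for h
        unfolding \<psi>_def[abs_def] using d \<delta> \<theta>m by (intro layer_second_diff_lower) (auto simp: d_def)
      show "w z t - w y t \<le> (V y t - V z t) / (2 * Q) + (\<psi> y - \<psi> z)" if "y $ k < lam" for y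
      proof -
        have "Q\<^sup>2 + 2 * Q * (q y t - Q) \<le> V y t"
          using sqr_pos_part_convex[of Q "q y t"] Q V_half[OF that] by simp
        then have "(q y t - Q) * (2 * Q) \<le> V y t - V z t"
          unfolding VQ by (simp add: algebra_simps)
        moreover have "0 < 2 * Q" using Q by simp
        ultimately have "q y t - Q \<le> (V y t - V z t) / (2 * Q)"
          by (simp only: pos_le_divide_eq)
        then show ?thesis by (simp add: q_def Q_def)
      qed
    qed
    also have "w z t + \<psi> z + Q = \<kappa> t" by (simp add: Q_def q_def)
    finally have L1: "L \<le> - J / (4 * Q) + d powr (- 2 * s) * (4 * (\<theta> * m) * m0 + \<kappa> t * kernel_tail k s)"
      by (simp add: d_def)
    have tail: "0 < kernel_tail k s" unfolding kernel_tail_def by (rule kernel_tail_pos[OF s])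
    have "4 * (\<theta> * m) * m0 + \<kappa> t * kernel_tail k s \<le> - (m * kernel_tail k s / 4)"
    proof -
      have "4 * (\<theta> * m) * m0 = m * (4 * \<theta> * m0)" by simp
      also have "\<dots> \<le> m * (kernel_tail k s / 2)"
        unfolding \<theta>_def m0_def using m by (intro mult_left_mono gain_bounds[OF s]) auto
      finally have "4 * (\<theta> * m) * m0 \<le> m * (kernel_tail k s / 2)" .
      moreover have "\<kappa> t * kernel_tail k s \<le> - (3 / 4) * m * kernel_tail k s"
        using tail by (intro mult_right_mono \<kappa>up') auto
      ultimately show ?thesis by (simp add: algebra_simps)
    qed
    then have "d powr (- 2 * s) * (4 * (\<theta> * m) * m0 + \<kappa> t * kernel_tail k s) \<le> d powr (- 2 * s) * (- (m * kernel_tail k s / 4))"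
      by (intro mult_left_mono) auto
    also have "\<dots> \<le> l powr (- 2 * s) * (- (m * kernel_tail k s / 4))"
      using d s m tail by (intro mult_right_mono_neg powr_mono2') auto
    finally have "L \<le> - J / (4 * Q) - l powr (- 2 * s) * (m * kernel_tail k s / 4)" using L1 by simp
    then have "cN * L \<le> cN * (- J / (4 * Q) - l powr (- 2 * s) * (m * kernel_tail k s / 4))"
      using cN by (intro mult_left_mono) auto
    also have "\<dots> = - cN * J / (4 * Q) - m * (cN * kernel_tail k s * l powr (- 2 * s)) / 4"
      by (simp add: algebra_simps)
    also have "\<dots> \<le> - cN * J / (4 * Q) - m * (1 + \<bar>C\<bar>)"
    proof -
      have "m * (4 * (1 + \<bar>C\<bar>)) \<le> m * (cN * kernel_tail k s * l powr (- 2 * s))"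
        using narrow(2) m by (intro mult_left_mono) (auto simp: cN_def)
      then show ?thesis by (simp add: algebra_simps)
    qed
    finally have cNL: "cN * L \<le> - cN * J / (4 * Q) - m * (1 + \<bar>C\<bar>)" .
    have "frac_laplace s (\<lambda>y. w y t) z = cN * L"
      unfolding cN_def L_def
      by (rule frac_laplace_second_diff(2)[OF _ s G(1) near(2)]) (use regular tt in \<open>auto simp: times_C1_def\<close>)
    then have wt: "wt z t = c z t * w z t - cN * L"
      using equation[OF z tt] by (simp add: wt_def)
    have "- (c z t * w z t) \<le> \<bar>C\<bar> * m"
    proof -
      have "c z t * (- w z t) \<le> \<bar>C\<bar> * (- w z t)"
        using c_le[OF z tt] wneg by (intro mult_right_mono) auto
      also have "\<dots> \<le> \<bar>C\<bar> * m" using lower[OF z at] by (intro mult_left_mono) auto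
      finally show ?thesis by simp
    qed
    then have "\<kappa>' t - wt z t \<le> m + \<bar>C\<bar> * m + cN * L" using \<kappa>'m[OF at] wt by simp
    also have "\<dots> \<le> - cN * J / (4 * Q)" using cNL by (simp add: algebra_simps)
    finally have "2 * Q * (\<kappa>' t - wt z t) \<le> 2 * Q * (- cN * J / (4 * Q))"
      using Q by (intro mult_left_mono) auto
    also have "\<dots> = - (cN / 2 * J)" using Q by simp
    also have "cN / 2 * J = nonlocal_op (\<lambda>z. V z t) z"
    proof -
      have "nonlocal_op (\<lambda>z. V z t) z = (\<integral>h. second_diff (\<lambda>z. V z t) z h * K h \<partial>lebesgue)"
        unfolding nonlocal_op_def
        by (rule integral_completion[symmetric]) (use integrable_second_diff[OF n, of z] in auto)
      also have "\<dots> = (\<integral>h. cN / 2 * (second_diff (\<lambda>z. V z t) z h * frac_kernel s h) \<partial>lebesgue)"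
        by (simp add: K_def mult_ac)
      also have "\<dots> = cN / 2 * J" unfolding J_def by (rule integral_mult_right_zero)
      finally show ?thesis by simp
    qed
    finally show ?thesis using z Q by (simp add: D_def Q_def)
  qed
  interpret nonlocal_subsolution K V D a R "m\<^sup>2"
  proof
    show "0 \<le> V z t" for z t by (rule V0)
    show "V z t \<le> m\<^sup>2" if "a \<le> t" for z t by (rule VM[OF that])
    show "V z t = 0" if "a \<le> t" "R < norm z" for z t
      using q_pos[of z t] that by (cases "0 < q z t") (auto simp: V_def)
    show "\<exists>n. C11_bound n (\<lambda>z. V z t)" if "a \<le> t" for t by (rule C11[OF that])
    show "(V z has_real_derivative D z t) (at t within {a..})" if "a \<le> t" for z t
    proof (cases "z \<in> \<Omega>")
      case True
      have "((\<lambda>t. q z t) has_real_derivative \<kappa>' t - wt z t) (at t within {a..})"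
        unfolding q_def wt_def by (auto intro!: derivative_eq_intros \<kappa>deriv time_derivative[OF a that])
      from has_real_derivative_sqr_pos_part[OF this] True show ?thesis
        by (simp add: V_def[abs_def] D_def)
    qed (simp add: V_def[abs_def] D_def)
    show "D z t \<le> - nonlocal_op (\<lambda>z. V z t) z" if "a \<le> t" for z t by (rule sub[OF that])
    show "V z a = 0" for z
    proof (cases "z \<in> \<Omega>")
      case True
      then have "q z a \<le> 0" using lower[OF True, of a] \<psi>0[of z] \<kappa>a by (simp add: q_def)
      then show ?thesis by (simp add: V_def)
    qed (simp add: V_def)
  qed
  have "V x t = 0" by (rule V_vanishes[OF t])
  then have "q x t \<le> 0" using x by (simp add: V_def max_def split: if_splits)
  moreover have "\<psi> x = 0" using \<delta> by (simp add: \<psi>_def \<delta>_def)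
  ultimately show ?thesis by (simp add: q_def \<kappa>_def \<theta>_def)
qed

text \<open>After a waiting time of \<open>ln 2\<close> the exponential is at most one half, and the bound has improved
  by the factor $1 - \theta/4$.\<close>

lemma lower_bound_iterated:
  assumes M: "0 < M" "\<And>x t. x \<in> \<Omega> \<Longrightarrow> tbar \<le> t \<Longrightarrow> - M \<le> w x t"
  shows "\<exists>T\<ge>tbar. \<forall>x\<in>\<Omega>. \<forall>t\<ge>T. - (M * (1 - gain k s / 4) ^ n) \<le> w x t"
proof (induction n)
  case 0
  then show ?case using M by (intro exI[of _ tbar]) auto
next
  case (Suc n)
  define \<theta> where "\<theta> = gain k s"
  have \<theta>: "0 < \<theta>" "\<theta> \<le> 1 / 2" using gain_bounds[OF s] by (auto simp: \<theta>_def)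
  define m where "m = M * (1 - \<theta> / 4) ^ n"
  have m: "0 < m" using M \<theta> by (simp add: m_def)
  obtain T where T: "tbar \<le> T" "\<And>x t. x \<in> \<Omega> \<Longrightarrow> T \<le> t \<Longrightarrow> - m \<le> w x t"
    using Suc by (auto simp: m_def \<theta>_def)
  have "- (M * (1 - \<theta> / 4) ^ Suc n) \<le> w x t" if x: "x \<in> \<Omega>" and t: "T + ln 2 \<le> t" for x t
  proof -
    have "0 \<le> ln (2 :: real)" by simp
    then have Tt: "T \<le> t" using t by linarith
    have "exp (- (t - T)) \<le> exp (- ln 2)" using t by simp
    also have "\<dots> = (1 / 2 :: real)" by (simp add: exp_minus)
    finally have "\<theta> / 2 * m * exp (- (t - T)) \<le> \<theta> / 2 * m * (1 / 2)"
      using \<theta> m by (intro mult_left_mono) auto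
    moreover have "- m * (1 - \<theta> / 2) - \<theta> / 2 * m * exp (- (t - T)) \<le> w x t"
      unfolding \<theta>_def by (rule lower_bound_improves[OF m T x Tt])
    moreover have "M * (1 - \<theta> / 4) ^ Suc n = m * (1 - \<theta> / 4)" by (simp add: m_def)
    ultimately show ?thesis by (simp add: algebra_simps)
  qed
  moreover have "tbar \<le> T + ln 2" using T(1) by (simp add: add_increasing2)
  ultimately show ?case unfolding \<theta>_def by blast
qed

theorem liminf_nonneg:
  assumes bnd: "\<And>x t. x \<in> \<Omega> \<Longrightarrow> tbar \<le> t \<Longrightarrow> - M \<le> w x t" and x: "x \<in> \<Omega>"
  shows "0 \<le> Liminf at_top (\<lambda>t. ereal (w x t))"
  unfolding le_Liminf_iff
proof (intro allI impI)
  fix y :: ereal assume y: "y < 0"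
  define M' where "M' = max 1 M"
  have M': "0 < M'" "\<And>x t. x \<in> \<Omega> \<Longrightarrow> tbar \<le> t \<Longrightarrow> - M' \<le> w x t"
    using bnd by (auto simp: M'_def) (smt (verit, best) max.cobounded2)
  obtain e where e: "0 < e" "y < ereal (- e)"
  proof -
    obtain r where "y < ereal r" "ereal r < 0" using ereal_dense2[OF y] by blast
    then show ?thesis by (intro that[of "- r"]) auto
  qed
  have g: "0 < gain k s" "gain k s \<le> 1 / 2" using gain_bounds[OF s] by auto
  have "(\<lambda>n. M' * (1 - gain k s / 4) ^ n) \<longlonglongrightarrow> M' * 0"
    using g by (intro tendsto_mult tendsto_const LIMSEQ_realpow_zero) auto
  then have "\<forall>\<^sub>F n in sequentially. M' * (1 - gain k s / 4) ^ n < e"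
    using e(1) by (intro order_tendstoD(2)) auto
  then obtain n where n: "M' * (1 - gain k s / 4) ^ n < e" by (auto simp: eventually_sequentially)
  obtain T where T: "\<And>t. T \<le> t \<Longrightarrow> - (M' * (1 - gain k s / 4) ^ n) \<le> w x t"
    using lower_bound_iterated[OF M', of n] x by blast
  have "y < ereal (w x t)" if "T \<le> t" for t
  proof -
    have "- e < w x t" using T[OF that] n by simp
    then have "ereal (- e) < ereal (w x t)" by simp
    then show ?thesis using e(2) by (rule less_trans[rotated])
  qed
  then show "\<forall>\<^sub>F t in at_top. y < ereal (w x t)" by (intro eventually_at_top_linorderI)
qed

end

section \<open>The narrow region principle\<close>

theorem theorem3:
  fixes k :: "'n::finite" and s C :: real
  assumes s: "0 < s" "s < 1"
  shows "\<exists>l0>0. \<forall>(lam::real) (l::real) (\<Omega>::(real ^ 'n) set) (tbar::real)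
           (w::real ^ 'n \<Rightarrow> real \<Rightarrow> real) (c::real ^ 'n \<Rightarrow> real \<Rightarrow> real).
      0 < l \<longrightarrow> l < l0 \<longrightarrow>
      open \<Omega> \<longrightarrow> connected \<Omega> \<longrightarrow> \<Omega> \<subseteq> slab k lam l \<longrightarrow>
      w \<in> times_C1 (C11_loc \<Omega> \<inter> L2s_space s) {tbar..} \<longrightarrow>
      (\<exists>M. \<forall>x\<in>closure \<Omega>. \<forall>t\<ge>tbar. \<bar>w x t\<bar> \<le> M) \<longrightarrow>
      (\<forall>t\<ge>tbar. lsc_on (closure \<Omega>) (\<lambda>x. w x t)) \<longrightarrow>
      (\<forall>x\<in>\<Omega>. \<forall>t\<ge>tbar. c x t \<le> C) \<longrightarrow>
      (\<forall>x\<in>\<Omega>. \<forall>t\<ge>tbar.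
         vector_derivative (w x) (at t within {tbar..}) + frac_laplace s (\<lambda>y. w y t) x
           = c x t * w x t) \<longrightarrow>
      (\<forall>x\<in>left_half_space k lam - \<Omega>. \<forall>t\<ge>tbar. 0 \<le> w x t) \<longrightarrow>
      (\<forall>x\<in>left_half_space k lam. \<forall>t\<ge>tbar. w x t = - w (plane_reflection k lam x) t) \<longrightarrow>
      (bounded \<Omega> \<longrightarrow> (\<forall>x\<in>\<Omega>. 0 \<le> Liminf at_top (\<lambda>t. ereal (w x t)))) \<and>
      (\<not> bounded \<Omega> \<longrightarrow>
         (\<forall>\<epsilon>>0. \<exists>R. \<forall>x\<in>\<Omega>. R \<le> norm x \<longrightarrow> (\<forall>t\<ge>tbar. - \<epsilon> \<le> w x t)) \<longrightarrow>
         (\<forall>x\<in>\<Omega>. 0 \<le> Liminf at_top (\<lambda>t. ereal (w x t))))"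
proof -
  define b where "b = frac_laplace_const CARD('n) s * kernel_tail k s"
  have b: "0 < b"
    unfolding b_def kernel_tail_def using kernel_tail_pos[OF s, of k] frac_laplace_const_pos[OF s, of "CARD('n)"] by simp
  define B where "B = 4 * (1 + \<bar>C\<bar>) / b"
  have B: "0 < B" using b by (simp add: B_def add_pos_nonneg)
  \<comment> \<open>the width at which the gain \<open>b * l powr (- 2 * s)\<close> equals \<open>4 * (1 + \<bar>C\<bar>)\<close>\<close>
  define l0 where "l0 = B powr (- 1 / (2 * s))"
  have narrow: "4 * (1 + \<bar>C\<bar>) \<le> b * l powr (- 2 * s)" if l: "0 < l" "l < l0" for l
  proof -
    have "B = l0 powr (- 2 * s)"
      unfolding l0_def powr_powr using s B by simp
    also have "\<dots> \<le> l powr (- 2 * s)" using l s by (intro powr_mono2') auto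
    finally show ?thesis using b by (simp add: B_def field_simps)
  qed
  show ?thesis
  proof (intro exI[of _ l0] conjI allI impI ballI)
    show "0 < l0" using B by (simp add: l0_def)
    fix lam l :: real and \<Omega> :: "(real ^ 'n) set" and tbar :: real and w c :: "real ^ 'n \<Rightarrow> real \<Rightarrow> real"
    assume l: "0 < l" "l < l0" and \<Omega>: "open \<Omega>" "connected \<Omega>" "\<Omega> \<subseteq> slab k lam l"
      and w: "w \<in> times_C1 (C11_loc \<Omega> \<inter> L2s_space s) {tbar..}"
      and bnd: "\<exists>M. \<forall>x\<in>closure \<Omega>. \<forall>t\<ge>tbar. \<bar>w x t\<bar> \<le> M"
      and lsc: "\<forall>t\<ge>tbar. lsc_on (closure \<Omega>) (\<lambda>x. w x t)"
      and c: "\<forall>x\<in>\<Omega>. \<forall>t\<ge>tbar. c x t \<le> C"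
      and eq: "\<forall>x\<in>\<Omega>. \<forall>t\<ge>tbar. vector_derivative (w x) (at t within {tbar..}) + frac_laplace s (\<lambda>y. w y t) x = c x t * w x t"
      and out: "\<forall>x\<in>left_half_space k lam - \<Omega>. \<forall>t\<ge>tbar. 0 \<le> w x t"
      and anti: "\<forall>x\<in>left_half_space k lam. \<forall>t\<ge>tbar. w x t = - w (plane_reflection k lam x) t"
    obtain M where M: "\<forall>x\<in>closure \<Omega>. \<forall>t\<ge>tbar. \<bar>w x t\<bar> \<le> M" using bnd by blast
    have lower: "- M \<le> w x t" if "x \<in> \<Omega>" "tbar \<le> t" for x t
      using M closure_subset[of \<Omega>] that by (force simp: abs_le_iff)
    have concl: "0 \<le> Liminf at_top (\<lambda>t. ereal (w x t))"
      if x: "x \<in> \<Omega>" and decay: "\<forall>\<epsilon>>0. \<exists>R. \<forall>x\<in>\<Omega>. R \<le> norm x \<longrightarrow> (\<forall>t\<ge>tbar. - \<epsilon> \<le> w x t)" for x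
    proof -
      interpret narrow_slab_solution k s C lam l tbar \<Omega> w c
        using s l(1) narrow[OF l] \<Omega> w lsc c eq out anti decay
        by unfold_locales (auto simp: b_def left_half_space_def)
      show ?thesis by (rule liminf_nonneg[OF lower x])
    qed
    show "0 \<le> Liminf at_top (\<lambda>t. ereal (w x t))" if "bounded \<Omega>" "x \<in> \<Omega>" for x
    proof (rule concl[OF that(2)], intro allI impI)
      obtain B where B: "\<forall>x\<in>\<Omega>. norm x \<le> B" using \<open>bounded \<Omega>\<close> unfolding bounded_iff by blast
      show "\<exists>R. \<forall>x\<in>\<Omega>. R \<le> norm x \<longrightarrow> (\<forall>t\<ge>tbar. - \<epsilon> \<le> w x t)" for \<epsilon>
        by (rule exI[of _ "B + 1"]) (use B in fastforce)
    qed
    show "0 \<le> Liminf at_top (\<lambda>t. ereal (w x t))"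
      if "\<not> bounded \<Omega>" "\<forall>\<epsilon>>0. \<exists>R. \<forall>x\<in>\<Omega>. R \<le> norm x \<longrightarrow> (\<forall>t\<ge>tbar. - \<epsilon> \<le> w x t)" "x \<in> \<Omega>" for x
      by (rule concl[OF that(3,2)])
  qed
qed

end
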